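(* Let $p,Q$ be Hermitian coefficient functions as described in the context, with the associated minimal operator $L_{\min}$ and, for each linear operator $K$ on $\mathbb{C}^{2s}$, the associated operators $L_K$ and $L^K$. Then the following hold. (i) If $K$ is a contracting operator on $\mathbb{C}^{2s}$, then $L_K$ is a maximal dissipative extension of $L_{\min}$, and $L^K$ is a maximal accumulative extension of $L_{\min}$. (ii) Conversely, for any maximal dissipative (respectively, maximal accumulative) extension $\widetilde L$ of $L_{\min}$ there exists a contracting operator $K$ on $\mathbb{C}^{2s}$ such that $\widetilde L=L_K$ (respectively, $\widetilde L=L^K$). (iii) The extensions $L_K$ and $L^K$ are self-adjoint if and only if $K$ is a unitary operator on $\mathbb{C}^{2s}$. (iv) These correspondences between the operators $K$ and the extensions $\widetilde L$ are all bijective.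
   Context: Let $s$ be a positive integer and $\mathcal{J}=(a,b)$ a finite interval. $p,Q:\mathcal{J}\to\mathbb{C}^{s\times s}$ are Lebesgue measurable functions whose values are Hermitian matrices, $p$ is invertible almost everywhere, and $$p^{-1},\quad p^{-1}Q,\quad Qp^{-1},\quad Qp^{-1}Q\in L_1(\mathcal{J},\mathbb{C}^{s\times s}).$$ Quasi-derivatives: $$D^{[0]}y=y,\qquad D^{[1]}y=py'-Qy,\qquad D^{[2]}y=(D^{[1]}y)'+Qp^{-1}D^{[1]}y+Qp^{-1}Qy,$$ and $l[y]:=-D^{[2]}y$. Write $L_2=L_2(\mathcal{J},\mathbb{C}^s)$. The maximal operator is $L_{\max}y=l[y]$ with $$\operatorname{Dom}(L_{\max})=\{y\in L_2:\ y,\,D^{[1]}y\in AC([a,b],\mathbb{C}^s),\ D^{[2]}y\in L_2\}$$ ($AC$ = absolutely continuous; $D^{[1]}y$ is identified with its absolutely continuous representative), and the minimal operator $L_{\min}$ is the restriction of $L_{\max}$ to $$\operatorname{Dom}(L_{\min})=\{y\in\operatorname{Dom}(L_{\max}):\ D^{[k]}y(a)=D^{[k]}y(b)=0,\ k=0,1\}.$$ Define linear maps $\Gamma_1,\Gamma_2:\operatorname{Dom}(L_{\max})\to\mathbb{C}^{2s}$ by $$\Gamma_1y=(D^{[1]}y(a),-D^{[1]}y(b)),\qquad \Gamma_2y=(y(a),y(b)).$$ For a linear operator $K$ on $\mathbb{C}^{2s}$, $L_K$ is the restriction of $L_{\max}$ to the set of $y\in\operatorname{Dom}(L_{\max})$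 satisfying $$(K-I)\Gamma_1y+i(K+I)\Gamma_2y=0,$$ and $L^K$ is the restriction of $L_{\max}$ to the set of $y\in\operatorname{Dom}(L_{\max})$ satisfying $$(K-I)\Gamma_1y-i(K+I)\Gamma_2y=0.$$ $K$ is contracting if $\|K\|\le 1$ (operator norm for the Euclidean norm of $\mathbb{C}^{2s}$). A densely defined linear operator $T$ on a complex Hilbert space $\mathcal{H}$ is dissipative (resp. accumulative) if $\operatorname{Im}(Tx,x)_{\mathcal{H}}\ge 0$ (resp. $\le 0$) for all $x\in\operatorname{Dom}(T)$; it is maximal dissipative (resp. maximal accumulative) if, in addition, it has no non-trivial dissipative (resp. accumulative) extensions in $\mathcal{H}$. The inner product is linear in the first argument. *)

theory Defs
  imports "HOL-Analysis.Analysis"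
begin

section \<open>Finite-dimensional preliminaries\<close>

text \<open>The Hermitian inner product, linear in the first argument; the library norm of
  \<^typ>\<open>complex ^ 'n\<close> is the Euclidean norm induced by it.\<close>

definition cdot :: "complex ^ 'n \<Rightarrow> complex ^ 'n \<Rightarrow> complex" where
  "cdot x y = (\<Sum>i\<in>UNIV. x $ i * cnj (y $ i))"

definition hermitian :: "complex ^ 'n ^ 'n \<Rightarrow> bool" where
  "hermitian A \<longleftrightarrow> (\<forall>i j. A $ i $ j = cnj (A $ j $ i))"

abbreviation clinear_op :: "(complex ^ 'n \<Rightarrow> complex ^ 'n) \<Rightarrow> bool" where
  "clinear_op K \<equiv> Vector_Spaces.linear (*s) (*s) K"

definition contracting :: "(complex ^ 'n \<Rightarrow> complex ^ 'n) \<Rightarrow> bool" where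
  "contracting K \<longleftrightarrow> clinear_op K \<and> onorm K \<le> 1"

definition unitary_op :: "(complex ^ 'n \<Rightarrow> complex ^ 'n) \<Rightarrow> bool" where
  "unitary_op K \<longleftrightarrow> clinear_op K \<and> surj K \<and> (\<forall>x y. cdot (K x) (K y) = cdot x y)"

text \<open>\<^typ>\<open>complex ^ ('s + 's)\<close> plays the role of the 2s-dimensional space;
  \<^term>\<open>vec_join u v\<close> is the column with upper block \<^term>\<open>u\<close> and lower block \<^term>\<open>v\<close>.\<close>

definition vec_join :: "complex ^ 's \<Rightarrow> complex ^ 's \<Rightarrow> complex ^ ('s + 's)" where
  "vec_join u v = (\<chi> k. case k of Inl i \<Rightarrow> u $ i | Inr i \<Rightarrow> v $ i)"


section \<open>Absolute continuity\<close>

text \<open>The usual epsilon-delta condition; for reals the members of a division are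
  non-overlapping compact intervals \<open>K = {Inf K..Sup K}\<close>.\<close>

definition abs_continuous_on :: "real \<Rightarrow> real \<Rightarrow> (real \<Rightarrow> 'v::real_normed_vector) \<Rightarrow> bool" where
  "abs_continuous_on a b f \<longleftrightarrow>
    (\<forall>\<epsilon>>0. \<exists>\<delta>>0. \<forall>D t. D division_of t \<and> t \<subseteq> {a..b} \<and> (\<Sum>K\<in>D. Sup K - Inf K) < \<delta>
      \<longrightarrow> (\<Sum>K\<in>D. norm (f (Sup K) - f (Inf K))) < \<epsilon>)"


section \<open>The Hilbert space of square-integrable vector functions on (a,b)\<close>

text \<open>Elements of \<^term>\<open>L2\<close> are almost-everywhere equivalence classes. Functions are total on
  the reals, but only their restrictions to (a,b) matter.\<close>

definition L2_fun :: "real \<Rightarrow> real \<Rightarrow> (real \<Rightarrow> complex ^ 's) set" where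
  "L2_fun a b = {f. f \<in> borel_measurable (lebesgue_on {a<..<b}) \<and>
                    integrable (lebesgue_on {a<..<b}) (\<lambda>x. (norm (f x))\<^sup>2)}"

definition L2_eq :: "real \<Rightarrow> real \<Rightarrow> ((real \<Rightarrow> complex ^ 's) \<times> (real \<Rightarrow> complex ^ 's)) set" where
  "L2_eq a b = {(f, g). f \<in> L2_fun a b \<and> g \<in> L2_fun a b \<and>
                        (AE x in lebesgue_on {a<..<b}. f x = g x)}"

type_synonym 's l2 = "(real \<Rightarrow> complex ^ 's) set"

definition L2 :: "real \<Rightarrow> real \<Rightarrow> ('s::finite) l2 set" where
  "L2 a b = L2_fun a b // L2_eq a b"

definition L2_class :: "real \<Rightarrow> real \<Rightarrow> (real \<Rightarrow> complex ^ 's) \<Rightarrow> ('s::finite) l2" where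
  "L2_class a b f = L2_eq a b `` {f}"

definition L2_rep :: "('s::finite) l2 \<Rightarrow> real \<Rightarrow> complex ^ 's" where
  "L2_rep u = (SOME f. f \<in> u)"

definition L2_add :: "real \<Rightarrow> real \<Rightarrow> ('s::finite) l2 \<Rightarrow> 's l2 \<Rightarrow> 's l2" where
  "L2_add a b u v = L2_class a b (\<lambda>x. L2_rep u x + L2_rep v x)"

definition L2_scale :: "real \<Rightarrow> real \<Rightarrow> complex \<Rightarrow> ('s::finite) l2 \<Rightarrow> 's l2" where
  "L2_scale a b c u = L2_class a b (\<lambda>x. c *s L2_rep u x)"

definition L2_inner :: "real \<Rightarrow> real \<Rightarrow> ('s::finite) l2 \<Rightarrow> 's l2 \<Rightarrow> complex" where
  "L2_inner a b u v = (LINT x|lebesgue_on {a<..<b}. cdot (L2_rep u x) (L2_rep v x))"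

definition L2_norm :: "real \<Rightarrow> real \<Rightarrow> ('s::finite) l2 \<Rightarrow> real" where
  "L2_norm a b u = sqrt (Re (L2_inner a b u u))"


section \<open>Unbounded operators\<close>

text \<open>An operator in \<^term>\<open>L2 a b\<close> is represented by its graph, so that extension of operators is
  inclusion, and equality of operators is equality of sets.\<close>

type_synonym 's l2_op = "('s l2 \<times> 's l2) set"

definition linear_operator :: "real \<Rightarrow> real \<Rightarrow> ('s::finite) l2_op \<Rightarrow> bool" where
  "linear_operator a b T \<longleftrightarrow>
     T \<subseteq> L2 a b \<times> L2 a b \<and> single_valued T \<and>
     (L2_class a b (\<lambda>_. 0), L2_class a b (\<lambda>_. 0)) \<in> T \<and>
     (\<forall>(u, v)\<in>T. \<forall>(u', v')\<in>T. (L2_add a b u u', L2_add a b v v') \<in> T) \<and>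
     (\<forall>(u, v)\<in>T. \<forall>c. (L2_scale a b c u, L2_scale a b c v) \<in> T)"

definition densely_defined :: "real \<Rightarrow> real \<Rightarrow> ('s::finite) l2_op \<Rightarrow> bool" where
  "densely_defined a b T \<longleftrightarrow>
     (\<forall>u\<in>L2 a b. \<forall>\<epsilon>>0. \<exists>v\<in>Domain T. L2_norm a b (L2_add a b u (L2_scale a b (-1) v)) < \<epsilon>)"

definition dissipative :: "real \<Rightarrow> real \<Rightarrow> ('s::finite) l2_op \<Rightarrow> bool" where
  "dissipative a b T \<longleftrightarrow> linear_operator a b T \<and> densely_defined a b T \<and>
     (\<forall>(u, v)\<in>T. Im (L2_inner a b v u) \<ge> 0)"

definition accumulative :: "real \<Rightarrow> real \<Rightarrow> ('s::finite) l2_op \<Rightarrow> bool" where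
  "accumulative a b T \<longleftrightarrow> linear_operator a b T \<and> densely_defined a b T \<and>
     (\<forall>(u, v)\<in>T. Im (L2_inner a b v u) \<le> 0)"

definition maximal_dissipative :: "real \<Rightarrow> real \<Rightarrow> ('s::finite) l2_op \<Rightarrow> bool" where
  "maximal_dissipative a b T \<longleftrightarrow>
     dissipative a b T \<and> (\<forall>T'. dissipative a b T' \<and> T \<subseteq> T' \<longrightarrow> T' = T)"

definition maximal_accumulative :: "real \<Rightarrow> real \<Rightarrow> ('s::finite) l2_op \<Rightarrow> bool" where
  "maximal_accumulative a b T \<longleftrightarrow>
     accumulative a b T \<and> (\<forall>T'. accumulative a b T' \<and> T \<subseteq> T' \<longrightarrow> T' = T)"

definition L2_adjoint :: "real \<Rightarrow> real \<Rightarrow> ('s::finite) l2_op \<Rightarrow> 's l2_op" where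
  "L2_adjoint a b T =
     {(w, z) \<in> L2 a b \<times> L2 a b. \<forall>(u, v)\<in>T. L2_inner a b v w = L2_inner a b u z}"

definition self_adjoint :: "real \<Rightarrow> real \<Rightarrow> ('s::finite) l2_op \<Rightarrow> bool" where
  "self_adjoint a b T \<longleftrightarrow>
     linear_operator a b T \<and> densely_defined a b T \<and> L2_adjoint a b T = T"


section \<open>Quasi-derivatives and the maximal and minimal operators\<close>

text \<open>The formula for the first quasi-derivative only determines it almost everywhere. An
  absolutely continuous representative, if there is one, is unique on [a,b], and
  \<open>qderiv1\<close> picks it; hence its boundary values are well defined.\<close>

definition has_qderiv1 ::
  "real \<Rightarrow> real \<Rightarrow> (real \<Rightarrow> complex ^ 's ^ 's) \<Rightarrow> (real \<Rightarrow> complex ^ 's ^ 's) \<Rightarrow>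
   (real \<Rightarrow> complex ^ 's) \<Rightarrow> (real \<Rightarrow> complex ^ 's) \<Rightarrow> bool" where
  "has_qderiv1 a b p Q y u \<longleftrightarrow> abs_continuous_on a b u \<and>
     (AE x in lebesgue_on {a<..<b}. u x = p x *v vector_derivative y (at x) - Q x *v y x)"

definition qderiv1 ::
  "real \<Rightarrow> real \<Rightarrow> (real \<Rightarrow> complex ^ 's ^ 's) \<Rightarrow> (real \<Rightarrow> complex ^ 's ^ 's) \<Rightarrow>
   (real \<Rightarrow> complex ^ 's) \<Rightarrow> (real \<Rightarrow> complex ^ 's)" where
  "qderiv1 a b p Q y = (SOME u. has_qderiv1 a b p Q y u)"

definition qderiv2 ::
  "real \<Rightarrow> real \<Rightarrow> (real \<Rightarrow> complex ^ 's ^ 's) \<Rightarrow> (real \<Rightarrow> complex ^ 's ^ 's) \<Rightarrow>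
   (real \<Rightarrow> complex ^ 's) \<Rightarrow> (real \<Rightarrow> complex ^ 's)" where
  "qderiv2 a b p Q y = (\<lambda>x.
     vector_derivative (qderiv1 a b p Q y) (at x)
     + (Q x ** matrix_inv (p x)) *v qderiv1 a b p Q y x
     + (Q x ** matrix_inv (p x) ** Q x) *v y x)"

definition max_domain ::
  "real \<Rightarrow> real \<Rightarrow> (real \<Rightarrow> complex ^ 's ^ 's) \<Rightarrow> (real \<Rightarrow> complex ^ 's ^ 's) \<Rightarrow>
   (real \<Rightarrow> complex ^ 's) set" where
  "max_domain a b p Q = {y \<in> L2_fun a b. abs_continuous_on a b y \<and>
     (\<exists>u. has_qderiv1 a b p Q y u) \<and> qderiv2 a b p Q y \<in> L2_fun a b}"

text \<open>The restriction of the maximal operator to those (absolutely continuous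
  representatives) \<^term>\<open>y\<close> that satisfy \<^term>\<open>P\<close>.\<close>

definition restr_max_op ::
  "real \<Rightarrow> real \<Rightarrow> (real \<Rightarrow> complex ^ 's ^ 's) \<Rightarrow> (real \<Rightarrow> complex ^ 's ^ 's) \<Rightarrow>
   ((real \<Rightarrow> complex ^ 's) \<Rightarrow> bool) \<Rightarrow> ('s::finite) l2_op" where
  "restr_max_op a b p Q P =
     {(L2_class a b y, L2_class a b (\<lambda>x. - qderiv2 a b p Q y x)) | y. y \<in> max_domain a b p Q \<and> P y}"

definition L_max ::
  "real \<Rightarrow> real \<Rightarrow> (real \<Rightarrow> complex ^ 's ^ 's) \<Rightarrow> (real \<Rightarrow> complex ^ 's ^ 's) \<Rightarrow> ('s::finite) l2_op" where
  "L_max a b p Q = restr_max_op a b p Q (\<lambda>_. True)"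

definition L_min ::
  "real \<Rightarrow> real \<Rightarrow> (real \<Rightarrow> complex ^ 's ^ 's) \<Rightarrow> (real \<Rightarrow> complex ^ 's ^ 's) \<Rightarrow> ('s::finite) l2_op" where
  "L_min a b p Q = restr_max_op a b p Q (\<lambda>y. y a = 0 \<and> y b = 0 \<and>
     qderiv1 a b p Q y a = 0 \<and> qderiv1 a b p Q y b = 0)"

definition Gamma1 ::
  "real \<Rightarrow> real \<Rightarrow> (real \<Rightarrow> complex ^ 's ^ 's) \<Rightarrow> (real \<Rightarrow> complex ^ 's ^ 's) \<Rightarrow>
   (real \<Rightarrow> complex ^ 's) \<Rightarrow> complex ^ ('s + 's)" where
  "Gamma1 a b p Q y = vec_join (qderiv1 a b p Q y a) (- qderiv1 a b p Q y b)"

definition Gamma2 ::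
  "real \<Rightarrow> real \<Rightarrow> (real \<Rightarrow> complex ^ 's) \<Rightarrow> complex ^ ('s + 's)" where
  "Gamma2 a b y = vec_join (y a) (y b)"

text \<open>\<open>L_lower K\<close> and \<open>L_upper K\<close> are the operators with \<open>K\<close> as a subscript and as a
  superscript, respectively.\<close>

definition L_lower ::
  "real \<Rightarrow> real \<Rightarrow> (real \<Rightarrow> complex ^ 's ^ 's) \<Rightarrow> (real \<Rightarrow> complex ^ 's ^ 's) \<Rightarrow>
   (complex ^ ('s + 's) \<Rightarrow> complex ^ ('s + 's)) \<Rightarrow> ('s::finite) l2_op" where
  "L_lower a b p Q K = restr_max_op a b p Q (\<lambda>y.
     (K (Gamma1 a b p Q y) - Gamma1 a b p Q y) + \<i> *s (K (Gamma2 a b y) + Gamma2 a b y) = 0)"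

definition L_upper ::
  "real \<Rightarrow> real \<Rightarrow> (real \<Rightarrow> complex ^ 's ^ 's) \<Rightarrow> (real \<Rightarrow> complex ^ 's ^ 's) \<Rightarrow>
   (complex ^ ('s + 's) \<Rightarrow> complex ^ ('s + 's)) \<Rightarrow> ('s::finite) l2_op" where
  "L_upper a b p Q K = restr_max_op a b p Q (\<lambda>y.
     (K (Gamma1 a b p Q y) - Gamma1 a b p Q y) - \<i> *s (K (Gamma2 a b y) + Gamma2 a b y) = 0)"

end

theory Submission
  imports Defs
begin

text \<open>
  The proof is a boundary triple argument. For \<open>y\<close> in the domain of the maximal operator write
  \<open>\<xi> = \<Gamma>\<^sub>1 y + i \<Gamma>\<^sub>2 y\<close> and \<open>\<eta> = \<Gamma>\<^sub>1 y - i \<Gamma>\<^sub>2 y\<close>. The boundary condition of \<open>L_lower K\<close> is \<open>K \<xi> = \<eta>\<close>, and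
  Green's formula becomes
  \<open>(l y, z) - (y, l z) = (i / 2) ((\<xi>, \<xi>') - (\<eta>, \<eta>'))\<close>, so that \<open>4 Im (l y, y) = \<bar>\<xi>\<bar>\<^sup>2 - \<bar>\<eta>\<bar>\<^sup>2\<close>
  (\<open>green_xi_eta\<close>). All pairs \<open>(\<xi>, \<eta>)\<close> occur (\<open>xi_eta_surj\<close>), hence \<open>K\<close> is determined by its extension.
  Dissipativity says that \<open>\<xi> \<mapsto> \<eta>\<close> is a contraction, symmetry that it is isometric, and maximality
  that it is everywhere defined, because a contraction on a subspace extends to the whole space
  (\<open>contraction_extension\<close>). Replacing \<open>i\<close> by \<open>- i\<close> interchanges dissipative and accumulative operators
  and yields the statements on \<open>L_upper K\<close>; a sign parameter covers both cases.

  An extension of the minimal operator is not assumed to be a restriction of the maximal one. That it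
  is one follows from the general fact that a dissipative extension of a symmetric operator lies in
  its adjoint (\<open>sdissipative_extension_subset_adjoint\<close>) and from the inclusion of the adjoint of the
  minimal operator in the maximal operator (\<open>min_adjoint\<close>). The latter, the surjectivity of the
  boundary maps (\<open>Gamma_surj\<close>) and the density of the minimal domain (\<open>min_dom_dense\<close>) rest on Green's
  formula, on the solvability of initial value problems with integrable coefficients, and on the
  invertible Gram matrix of a fundamental system of solutions of the homogeneous equation; density
  also uses the completeness of \<open>L2\<close>.

  Green's formula for functions that are only absolutely continuous needs the fundamental theorem of
  calculus in Lebesgue's form (\<open>abs_continuous_on_is_integral\<close>, \<open>is_integral_derivative\<close>): an absolutely
  continuous function is a difference of increasing ones, whose Stieltjes measures have
  Radon-Nikodym densities, and an indefinite integral is differentiable almost everywhere with the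
  integrand as its derivative, by Vitali's covering theorem and Henstock's lemma.
\<close>

section \<open>Differentiation of indefinite integrals\<close>

text \<open>Lebesgue's differentiation theorem on the line. A point is bad if it lies in arbitrarily short
  intervals on which the integral of \<^term>\<open>f\<close> differs from the value of \<^term>\<open>f\<close> times the length by
  more than a fixed proportion of the length. Vitali's covering theorem selects disjoint such
  intervals that cover almost all bad points, and Henstock's lemma bounds their total length.\<close>

lemma ae_derivative_indefinite_integral:
  fixes f :: "real \<Rightarrow> 'a::euclidean_space"
  assumes f: "f integrable_on {a..b}"
  obtains N where "negligible N"
    "\<And>x. x \<in> {a<..<b} - N \<Longrightarrow> ((\<lambda>t. integral {a..t} f) has_vector_derivative f x) (at x)"
proof -
  define bad where "bad \<equiv> \<lambda>n x c e. a \<le> c \<and> c \<le> x \<and> x \<le> e \<and> e \<le> b \<and> c < e \<and>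
      norm ((e - c) *\<^sub>R f x - integral {c..e} f) > (e - c) / real (Suc n)"
  define E where "E \<equiv> \<lambda>n. {x \<in> {a<..<b}. \<forall>d>0. \<exists>c e. bad n x c e \<and> e - c < d}"
  have neg: "negligible (E n)" for n
    unfolding negligible_outer_le
  proof (intro allI impI)
    fix \<epsilon> :: real assume "\<epsilon> > 0"
    define \<epsilon>' where "\<epsilon>' = \<epsilon> / real (Suc n)"
    have "\<epsilon>' > 0" using \<open>\<epsilon> > 0\<close> by (simp add: \<epsilon>'_def)
    obtain \<gamma> where \<gamma>: "gauge \<gamma>"
      and hen: "\<And>q. \<lbrakk>q tagged_partial_division_of (cbox a b); \<gamma> fine q\<rbrakk> \<Longrightarrow>
             sum (\<lambda>(x,k). norm(measure lborel k *\<^sub>R f x - integral k f)) q < \<epsilon>'"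
      using Henstock_lemma[of f a b \<epsilon>'] f \<open>\<epsilon>' > 0\<close> by (auto simp: cbox_interval)
    define I where "I = {(x, c, e). x \<in> E n \<and> bad n x c e \<and> {c..e} \<subseteq> \<gamma> x}"
    \<comment> \<open>An indexed interval \<open>(x, c, e)\<close> is presented to the covering theorem as a ball with centre \<open>cc\<close> and radius \<open>rr\<close>.\<close>
    define cc where "cc = (\<lambda>(x::real, c::real, e::real). (c + e) / 2)"
    define rr where "rr = (\<lambda>(x::real, c::real, e::real). (e - c) / 2)"
    have cb: "cball (cc i) (rr i) = {fst (snd i)..snd (snd i)}" for i
      by (auto simp: cc_def rr_def cball_eq_atLeastAtMost field_simps split: prod.splits)
    obtain C where C: "countable C" "C \<subseteq> I"
        "pairwise (\<lambda>i j. disjnt (cball (cc i) (rr i)) (cball (cc j) (rr j))) C"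
        "negligible (E n - (\<Union>i \<in> C. cball (cc i) (rr i)))"
    proof (rule Vitali_covering_theorem_cballs[of I rr "E n" cc])
      show "0 < rr i" if "i \<in> I" for i using that by (auto simp: I_def rr_def bad_def)
      fix x d :: real assume x: "x \<in> E n" and "0 < d"
      obtain d' where d': "d' > 0" "ball x d' \<subseteq> \<gamma> x"
        using \<gamma> by (meson gaugeD open_contains_ball)
      have "min d d' > 0" using d' \<open>0 < d\<close> by simp
      with x obtain c e where ce: "bad n x c e" "e - c < min d d'" unfolding E_def by blast
      have "{c..e} \<subseteq> ball x d'"
        using ce by (auto simp: bad_def dist_real_def)
      with ce x d' show "\<exists>i. i \<in> I \<and> x \<in> cball (cc i) (rr i) \<and> rr i < d"
        by (intro exI[of _ "(x, c, e)"], subst cb) (auto simp: I_def bad_def rr_def)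
    qed
    have fin: "measure lebesgue (\<Union>i\<in>F. cball (cc i) (rr i)) \<le> \<epsilon>" if F: "F \<subseteq> C" "finite F" for F
    proof -
      define q where "q = (\<lambda>(x, c, e). (x, {c..e})) ` F"
      have inj: "inj_on (\<lambda>(x, c, e). (x, {c..e})) F"
      proof (rule inj_onI)
        fix i j assume i: "i \<in> F" and j: "j \<in> F"
          and e: "(case i of (x, c, e) \<Rightarrow> (x, {c..e})) = (case j of (x, c, e) \<Rightarrow> (x, {c..e}))"
        obtain x c e x' c' e' where ij: "i = (x, c, e)" "j = (x', c', e')" by (metis prod.exhaust)
        have "bad n x c e" "bad n x' c' e'" using F C(2) i j by (auto simp: I_def ij)
        then show "i = j" using e by (auto simp: bad_def ij Icc_eq_Icc)
      qed
      have "q tagged_partial_division_of cbox a b"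
        unfolding tagged_partial_division_of_def
      proof (intro conjI allI impI)
        show "finite q" using F by (simp add: q_def)
      next
        fix x K assume "(x, K) \<in> q"
        then obtain c e where "(x,c,e) \<in> F" "K = {c..e}" by (auto simp: q_def)
        then have "bad n x c e" using F C(2) by (auto simp: I_def)
        then show "x \<in> K" "K \<subseteq> cbox a b" "\<exists>a b. K = cbox a b"
          unfolding \<open>K = _\<close> by (auto simp: bad_def cbox_interval intro!: exI[of _ c] exI[of _ e])
      next
        fix x1 K1 x2 K2 assume *: "(x1, K1) \<in> q \<and> (x2, K2) \<in> q \<and> (x1, K1) \<noteq> (x2, K2)"
        then obtain c1 e1 c2 e2 where 1: "(x1,c1,e1) \<in> F" "K1 = {c1..e1}" "(x2,c2,e2) \<in> F" "K2 = {c2..e2}"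
          by (auto simp: q_def)
        then have "(x1,c1,e1) \<noteq> (x2,c2,e2)" using * by auto
        then have "disjnt K1 K2" using C(3) 1 F by (force simp: pairwise_def cb)
        then show "interior K1 \<inter> interior K2 = {}"
          using interior_subset by (fastforce simp: disjnt_def)
      qed
      moreover have "\<gamma> fine q" using F C(2) by (auto simp: fine_def q_def I_def)
      ultimately have "sum (\<lambda>(x,k). norm(measure lborel k *\<^sub>R f x - integral k f)) q < \<epsilon>'" by (rule hen)
      also have "sum (\<lambda>(x,k). norm(measure lborel k *\<^sub>R f x - integral k f)) q =
        (\<Sum>(x,c,e)\<in>F. norm (measure lborel {c..e} *\<^sub>R f x - integral {c..e} f))"
        unfolding q_def by (subst sum.reindex[OF inj]) (simp add: case_prod_unfold)
      finally have l: "(\<Sum>(x,c,e)\<in>F. norm (measure lborel {c..e} *\<^sub>R f x - integral {c..e} f)) < \<epsilon>'" .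
      have "(\<Sum>i\<in>F. measure lebesgue (cball (cc i) (rr i)) / real (Suc n)) \<le> \<epsilon>'"
      proof (rule order_trans[OF sum_mono less_imp_le[OF l]])
        fix i assume "i \<in> F"
        then show "measure lebesgue (cball (cc i) (rr i)) / real (Suc n) \<le>
           (case i of (x, c, e) \<Rightarrow> norm (measure lborel {c..e} *\<^sub>R f x - integral {c..e} f))"
          using F C(2) unfolding cb by (auto simp: I_def bad_def)
      qed
      then have "(\<Sum>i\<in>F. measure lebesgue (cball (cc i) (rr i))) \<le> \<epsilon>"
        by (simp add: \<epsilon>'_def divide_right_mono sum_divide_distrib[symmetric] divide_le_cancel del: of_nat_Suc)
      moreover have "measure lebesgue (\<Union>i\<in>F. cball (cc i) (rr i)) \<le> (\<Sum>i\<in>F. measure lebesgue (cball (cc i) (rr i)))"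
        using F by (intro measure_UNION_le) auto
      ultimately show ?thesis by simp
    qed
    let ?U = "\<Union>i\<in>C. cball (cc i) (rr i)"
    have U: "?U \<in> lmeasurable" "measure lebesgue ?U \<le> \<epsilon>"
      using fmeasurable_UN_bound[of C "\<lambda>i. cball (cc i) (rr i)" lebesgue \<epsilon>]
        measure_UN_bound[of C "\<lambda>i. cball (cc i) (rr i)" lebesgue \<epsilon>] C fin by auto
    let ?M = "E n - ?U"
    have "measure lebesgue (?U \<union> ?M) = measure lebesgue ?U"
      using C(4) by (intro measure_Un_null_set) (auto simp: negligible_iff_null_sets U(1) fmeasurableD)
    moreover have "?U \<union> ?M \<in> lmeasurable"
      using U(1) C(4) by (intro fmeasurable.Un) (auto simp: negligible_imp_measurable)
    ultimately show "\<exists>T. E n \<subseteq> T \<and> T \<in> lmeasurable \<and> measure lebesgue T \<le> \<epsilon>"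
      using U(2) by (intro exI[of _ "?U \<union> ?M"]) auto
  qed
  show ?thesis
  proof
    show "negligible (\<Union>n. E n)" using neg by (intro negligible_countable_Union) auto
    fix x assume x: "x \<in> {a<..<b} - (\<Union>n. E n)"
    show "((\<lambda>t. integral {a..t} f) has_vector_derivative f x) (at x)"
      unfolding has_vector_derivative_def has_derivative_at_alt
    proof (intro conjI allI impI)
      show "bounded_linear (\<lambda>h. h *\<^sub>R f x)" by (rule bounded_linear_scaleR_left)
      fix \<epsilon> :: real assume "\<epsilon> > 0"
      then obtain n where n: "1 / real (Suc n) < \<epsilon>" using nat_approx_posE by auto
      have "x \<notin> E n" using x by auto
      then have "\<not> (\<forall>d>0. \<exists>c e. bad n x c e \<and> e - c < d)"
        using x unfolding E_def mem_Collect_eq by simp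
      then obtain d where "d > 0" and d: "\<And>c e. e - c < d \<Longrightarrow> \<not> bad n x c e" by metis
      have key: "norm (integral {a..e} f - integral {a..c} f - (e - c) *\<^sub>R f x) \<le> \<epsilon> * (e - c)"
        if "a \<le> c" "c \<le> x" "x \<le> e" "e \<le> b" "c \<le> e" "e - c < d" for c e
      proof (cases "c = e")
        case False
        have "norm ((e - c) *\<^sub>R f x - integral {c..e} f) \<le> (e - c) / real (Suc n)"
          using d[of e c] that False by (auto simp: bad_def)
        also have "\<dots> \<le> (e - c) * \<epsilon>"
          using n that mult_left_mono[of "1 / real (Suc n)" \<epsilon> "e - c"] by simp
        finally have "norm ((e - c) *\<^sub>R f x - integral {c..e} f) \<le> \<epsilon> * (e - c)" by (simp add: mult.commute)
        moreover have "integral {a..c} f + integral {c..e} f = integral {a..e} f"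
          using that by (intro Henstock_Kurzweil_Integration.integral_combine integrable_subinterval_real[OF f]) auto
        ultimately show ?thesis
          by (metis add_diff_cancel_left' norm_minus_commute)
      qed simp
      define d' where "d' = min d (min (x - a) (b - x))"
      show "\<exists>d>0. \<forall>y. norm (y - x) < d \<longrightarrow>
        norm (integral {a..y} f - integral {a..x} f - (y - x) *\<^sub>R f x) \<le> \<epsilon> * norm (y - x)"
      proof (intro exI[of _ d'] conjI allI impI)
        show "d' > 0" using \<open>d > 0\<close> x by (simp add: d'_def)
        fix y assume y: "norm (y - x) < d'"
        show "norm (integral {a..y} f - integral {a..x} f - (y - x) *\<^sub>R f x) \<le> \<epsilon> * norm (y - x)"
        proof (cases "x \<le> y")
          case True
          then show ?thesis using key[of x y] y by (simp add: d'_def)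
        next
          case False
          have "norm (integral {a..x} f - integral {a..y} f - (x - y) *\<^sub>R f x) \<le> \<epsilon> * (x - y)"
            using False key[of y x] y by (simp add: d'_def)
          moreover have "integral {a..x} f - integral {a..y} f - (x - y) *\<^sub>R f x =
            - (integral {a..y} f - integral {a..x} f - (y - x) *\<^sub>R f x)" by (simp add: algebra_simps)
          ultimately have "norm (integral {a..y} f - integral {a..x} f - (y - x) *\<^sub>R f x) \<le> \<epsilon> * (x - y)"
            by (simp only: norm_minus_cancel)
          then show ?thesis using False by simp
        qed
      qed
    qed
  qed
qed

section \<open>Absolutely continuous functions\<close>

lemma division_real_interval:
  fixes K :: "real set"
  assumes "D division_of t" "K \<in> D"
  obtains c d where "c \<le> d" "K = {c..d}" "Inf K = c" "Sup K = d"
proof -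
  obtain c d where "K = cbox c d" using division_ofD(4)[OF assms] by blast
  moreover have "K \<noteq> {}" using division_ofD(3)[OF assms] .
  ultimately show ?thesis using that[of c d] by (auto simp: cbox_interval)
qed

text \<open>The two sums in the definition of absolute continuity: the increments of a function over the
  members of a division, and their lengths.\<close>

abbreviation incr_sum :: "(real \<Rightarrow> 'v::real_normed_vector) \<Rightarrow> real set set \<Rightarrow> real" where
  "incr_sum f \<equiv> \<lambda>D. \<Sum>K\<in>D. norm (f (Sup K) - f (Inf K))"

abbreviation total_length :: "real set set \<Rightarrow> real" where
  "total_length D \<equiv> \<Sum>K\<in>D. Sup K - Inf K"

lemma division_measure_interval:
  assumes "D division_of t" "K \<in> D"
  shows "Sup K - Inf K = measure lborel K"
  using division_real_interval[OF assms] by (metis measure_lborel_Icc)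

lemma abs_continuous_onD:
  assumes "abs_continuous_on a b f" "\<epsilon> > 0"
  obtains \<delta> where "\<delta> > 0" "\<And>D t. \<lbrakk>D division_of t; t \<subseteq> {a..b}; total_length D < \<delta>\<rbrakk>
     \<Longrightarrow> incr_sum f D < \<epsilon>"
proof -
  have "\<exists>\<delta>>0. \<forall>D t. D division_of t \<and> t \<subseteq> {a..b} \<and> total_length D < \<delta>
      \<longrightarrow> incr_sum f D < \<epsilon>"
    using assms by (simp add: abs_continuous_on_def)
  then obtain \<delta> where d: "\<delta> > 0" "\<forall>D t. D division_of t \<and> t \<subseteq> {a..b} \<and> total_length D < \<delta>
      \<longrightarrow> incr_sum f D < \<epsilon>"
    by (elim exE conjE)
  show ?thesis by (rule that[OF d(1)]) (use d(2) in blast)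
qed

text \<open>Where \<^term>\<open>norm (f x)\<close> is cut off at \<open>n\<close>, the integral over a set is at most \<open>n\<close> times its measure,
  and the integral of the excess \<open>h n\<close> tends to 0 by dominated convergence.\<close>

lemma abs_continuous_on_indefinite_integral:
  fixes f :: "real \<Rightarrow> 'a::euclidean_space"
  assumes f: "f absolutely_integrable_on {a..b}"
  shows "abs_continuous_on a b (\<lambda>t. integral {a..t} f)"
  unfolding abs_continuous_on_def
proof (intro allI impI)
  fix \<epsilon> :: real assume "\<epsilon> > 0"
  define h where "h = (\<lambda>n x. norm (f x) - min (norm (f x)) (real n))"
  have nf: "(\<lambda>x. norm (f x)) integrable_on {a..b}" and fi: "f integrable_on {a..b}"
    using f by (auto simp: absolutely_integrable_on_def)
  have hi: "h n integrable_on {a..b}" for n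
  proof -
    have "(\<lambda>x. norm (f x)) absolutely_integrable_on {a..b}"
      using nf by (intro nonnegative_absolutely_integrable_1) auto
    moreover have "(\<lambda>x. real n) absolutely_integrable_on {a..b}"
      by (intro absolutely_integrable_continuous_real) auto
    ultimately have "(\<lambda>x. min (norm (f x)) (real n)) absolutely_integrable_on {a..b}"
      by (rule absolutely_integrable_min_1)
    then have "(\<lambda>x. min (norm (f x)) (real n)) integrable_on {a..b}"
      by (simp add: absolutely_integrable_on_def)
    then show ?thesis unfolding h_def by (intro integrable_diff nf)
  qed
  have "(\<lambda>n. integral {a..b} (h n)) \<longlonglongrightarrow> integral {a..b} (\<lambda>_. 0::real)"
  proof (rule dominated_convergence(2)[OF hi nf])
    show "norm (h n x) \<le> norm (f x)" for n x by (auto simp: h_def)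
    show "(\<lambda>n. h n x) \<longlonglongrightarrow> 0" for x
    proof (rule tendsto_eventually)
      obtain N where "norm (f x) \<le> real N" using real_arch_simple by blast
      then show "\<forall>\<^sub>F n in sequentially. h n x = 0"
        by (intro eventually_sequentiallyI[of N]) (auto simp: h_def min_def)
    qed
  qed
  then have "\<forall>\<^sub>F n in sequentially. integral {a..b} (h n) < \<epsilon> / 2"
    using \<open>\<epsilon> > 0\<close> by (auto dest!: order_tendstoD(2)[where a = "\<epsilon>/2"])
  then obtain n where n: "integral {a..b} (h n) < \<epsilon> / 2" by (metis eventually_sequentially order_refl)
  show "\<exists>\<delta>>0. \<forall>D t. D division_of t \<and> t \<subseteq> {a..b} \<and> total_length D < \<delta>
      \<longrightarrow> (\<Sum>K\<in>D. norm (integral {a..Sup K} f - integral {a..Inf K} f)) < \<epsilon>"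
  proof (intro exI[of _ "\<epsilon> / (2 * real (Suc n))"] conjI allI impI)
    show "\<epsilon> / (2 * real (Suc n)) > 0" using \<open>\<epsilon> > 0\<close> by simp
    fix D t assume D: "D division_of t \<and> t \<subseteq> {a..b} \<and> total_length D < \<epsilon> / (2 * real (Suc n))"
    then have Dt: "D division_of t" and t: "t \<subseteq> {a..b}" by auto
    have K: "norm (integral {a..Sup K} f - integral {a..Inf K} f) \<le> integral K (h n) + real n * (Sup K - Inf K)"
      if "K \<in> D" for K
    proof -
      obtain c d where cd: "c \<le> d" "K = {c..d}" "Inf K = c" "Sup K = d"
        using division_real_interval[OF Dt \<open>K \<in> D\<close>] by blast
      have "K \<subseteq> {a..b}" using division_ofD(2)[OF Dt that] t by auto
      then have ab: "a \<le> c" "d \<le> b" using cd by auto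
      have sub: "{c..d} \<subseteq> {a..b}" using ab by auto
      have "integral {a..c} f + integral {c..d} f = integral {a..d} f"
        using ab cd by (intro Henstock_Kurzweil_Integration.integral_combine integrable_subinterval_real[OF fi]) auto
      then have "norm (integral {a..Sup K} f - integral {a..Inf K} f) = norm (integral {c..d} f)"
        unfolding cd(3,4) by (metis add_diff_cancel_left')
      also have "\<dots> \<le> integral {c..d} (\<lambda>x. h n x + real n)"
      proof (rule integral_norm_bound_integral)
        show "f integrable_on {c..d}" using integrable_subinterval_real[OF fi sub] .
        show "(\<lambda>x. h n x + real n) integrable_on {c..d}"
          using integrable_subinterval_real[OF hi sub] by (intro integrable_add) auto
      qed (auto simp: h_def)
      also have "\<dots> = integral {c..d} (h n) + real n * (d - c)"
        using integrable_subinterval_real[OF hi sub] cd(1)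
        by (subst Henstock_Kurzweil_Integration.integral_add) auto
      finally show ?thesis using cd by simp
    qed
    have hit: "h n integrable_on t"
      using integrable_on_subdivision[OF Dt] hi t
      by (metis integrable_on_subdivision[OF Dt])
    have "(\<Sum>K\<in>D. integral K (h n)) = integral t (h n)"
      using integral_combine_division_topdown[OF hit Dt] by simp
    also have "\<dots> \<le> integral {a..b} (h n)"
      by (rule integral_subset_le[OF t hit hi]) (auto simp: h_def)
    finally have 1: "(\<Sum>K\<in>D. integral K (h n)) < \<epsilon> / 2" using n by simp
    have "real n * total_length D \<le> real n * (\<epsilon> / (2 * real (Suc n)))"
      using D by (intro mult_left_mono) auto
    also have "\<dots> \<le> \<epsilon> / 2" using \<open>\<epsilon> > 0\<close> by (simp add: field_simps)
    finally have 2: "real n * total_length D \<le> \<epsilon> / 2" .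
    have "(\<Sum>K\<in>D. norm (integral {a..Sup K} f - integral {a..Inf K} f)) \<le>
      (\<Sum>K\<in>D. integral K (h n) + real n * (Sup K - Inf K))" by (rule sum_mono[OF K])
    also have "\<dots> = (\<Sum>K\<in>D. integral K (h n)) + real n * total_length D"
      by (simp add: sum.distrib sum_distrib_left)
    finally show "(\<Sum>K\<in>D. norm (integral {a..Sup K} f - integral {a..Inf K} f)) < \<epsilon>"
      using 1 2 by linarith
  qed
qed

text \<open>The permanence principle behind absolute continuity of sums, components, and products.\<close>

lemma abs_continuous_on_bound:
  assumes f: "abs_continuous_on a b f" and g: "abs_continuous_on a b g" and "B \<ge> 0"
    and bd: "\<And>x y. \<lbrakk>x \<in> {a..b}; y \<in> {a..b}\<rbrakk> \<Longrightarrow>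
        norm (h x - h y) \<le> B * (norm (f x - f y) + norm (g x - g y))"
  shows "abs_continuous_on a b h"
  unfolding abs_continuous_on_def
proof (intro allI impI)
  fix \<epsilon> :: real assume "\<epsilon> > 0"
  define \<epsilon>' where "\<epsilon>' = \<epsilon> / (B + 1) / 2"
  have "\<epsilon>' > 0" using \<open>\<epsilon> > 0\<close> \<open>B \<ge> 0\<close> by (simp add: \<epsilon>'_def)
  obtain \<delta>1 where 1: "\<delta>1 > 0" "\<And>D t. \<lbrakk>D division_of t; t \<subseteq> {a..b}; total_length D < \<delta>1\<rbrakk>
     \<Longrightarrow> incr_sum f D < \<epsilon>'" using abs_continuous_onD[OF f \<open>\<epsilon>' > 0\<close>] by blast
  obtain \<delta>2 where 2: "\<delta>2 > 0" "\<And>D t. \<lbrakk>D division_of t; t \<subseteq> {a..b}; total_length D < \<delta>2\<rbrakk>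
     \<Longrightarrow> incr_sum g D < \<epsilon>'" using abs_continuous_onD[OF g \<open>\<epsilon>' > 0\<close>] by blast
  show "\<exists>\<delta>>0. \<forall>D t. D division_of t \<and> t \<subseteq> {a..b} \<and> total_length D < \<delta>
      \<longrightarrow> incr_sum h D < \<epsilon>"
  proof (intro exI[of _ "min \<delta>1 \<delta>2"] conjI allI impI)
    show "min \<delta>1 \<delta>2 > 0" using 1 2 by simp
    fix D t assume D: "D division_of t \<and> t \<subseteq> {a..b} \<and> total_length D < min \<delta>1 \<delta>2"
    have "incr_sum h D \<le>
       (\<Sum>K\<in>D. B * (norm (f (Sup K) - f (Inf K)) + norm (g (Sup K) - g (Inf K))))"
    proof (rule sum_mono)
      fix K assume "K \<in> D"
      obtain c d where cd: "c \<le> d" "K = {c..d}" "Inf K = c" "Sup K = d"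
        using division_real_interval \<open>K \<in> D\<close> D by blast
      have "K \<subseteq> {a..b}" using division_ofD(2) D \<open>K \<in> D\<close> by blast
      then show "norm (h (Sup K) - h (Inf K)) \<le> B * (norm (f (Sup K) - f (Inf K)) + norm (g (Sup K) - g (Inf K)))"
        using cd by (intro bd) auto
    qed
    also have "\<dots> = B * (incr_sum f D + incr_sum g D)"
      by (simp only: sum_distrib_left[symmetric] sum.distrib)
    also have "\<dots> \<le> B * (\<epsilon>' + \<epsilon>')"
      using 1(2)[of D t] 2(2)[of D t] D \<open>B \<ge> 0\<close> by (intro mult_left_mono add_mono) auto
    also have "\<epsilon>' + \<epsilon>' = \<epsilon> / (B + 1)" unfolding \<epsilon>'_def by (rule field_sum_of_halves)
    also have "B * (\<epsilon> / (B + 1)) = \<epsilon> * (B / (B + 1))" by simp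
    also have "\<dots> < \<epsilon>" using \<open>B \<ge> 0\<close> \<open>\<epsilon> > 0\<close> by (simp add: field_simps)
    finally show "incr_sum h D < \<epsilon>" .
  qed
qed

lemma abs_continuous_on_imp_uniform:
  assumes f: "abs_continuous_on a b f" and "\<epsilon> > 0"
  obtains \<delta> where "\<delta> > 0" "\<And>x y. \<lbrakk>x \<in> {a..b}; y \<in> {a..b}; \<bar>x - y\<bar> < \<delta>\<rbrakk> \<Longrightarrow> norm (f x - f y) < \<epsilon>"
proof -
  obtain \<delta> where d: "\<delta> > 0" "\<And>D t. \<lbrakk>D division_of t; t \<subseteq> {a..b}; total_length D < \<delta>\<rbrakk>
     \<Longrightarrow> incr_sum f D < \<epsilon>" using abs_continuous_onD[OF f \<open>\<epsilon> > 0\<close>] by blast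
  have *: "norm (f y - f x) < \<epsilon>" if "x \<in> {a..b}" "y \<in> {a..b}" "x \<le> y" "y - x < \<delta>" for x y
    using d(2)[of "{{x..y}}" "{x..y}"] that division_of_self[of x y] by (auto simp: cbox_interval)
  show ?thesis
  proof (rule that[OF d(1)])
    fix x y assume "x \<in> {a..b}" "y \<in> {a..b}" "\<bar>x - y\<bar> < \<delta>"
    then show "norm (f x - f y) < \<epsilon>"
      using *[of x y] *[of y x] by (cases "x \<le> y") (auto simp: norm_minus_commute)
  qed
qed

lemma abs_continuous_on_imp_continuous_on:
  assumes "abs_continuous_on a b f"
  shows "continuous_on {a..b} f"
  unfolding continuous_on_iff
proof (intro ballI allI impI)
  fix x \<epsilon> :: real assume "x \<in> {a..b}" "\<epsilon> > 0"
  obtain \<delta> where "\<delta> > 0" "\<And>x y. \<lbrakk>x \<in> {a..b}; y \<in> {a..b}; \<bar>x - y\<bar> < \<delta>\<rbrakk> \<Longrightarrow> norm (f x - f y) < \<epsilon>"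
    using abs_continuous_on_imp_uniform[OF assms \<open>\<epsilon> > 0\<close>] by blast
  then show "\<exists>d>0. \<forall>x'\<in>{a..b}. dist x' x < d \<longrightarrow> dist (f x') (f x) < \<epsilon>"
    using \<open>x \<in> {a..b}\<close> by (intro exI[of _ \<delta>]) (auto simp: dist_norm)
qed

section \<open>Total variation\<close>

lemma division_overlap_degenerate:
  fixes S :: "real set"
  assumes D: "D division_of t" and K: "K \<in> D" "K' \<in> D" "K \<noteq> K'"
    and S: "S \<subseteq> K" "S \<subseteq> K'" and "S = {c..d}" "c \<le> d"
  shows "c = d"
proof (rule ccontr)
  assume "c \<noteq> d"
  then have "c < d" using \<open>c \<le> d\<close> by simp
  then have "(c + d) / 2 \<in> interior S" using \<open>S = _\<close> by (simp add: interior_atLeastAtMost_real)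
  then have "(c + d) / 2 \<in> interior K \<inter> interior K'" using S interior_mono by blast
  then show False using division_ofD(5)[OF D K] by simp
qed

text \<open>Different members of a division may have the same trace on \<^term>\<open>S\<close>, but then the trace is a
  single point and contributes nothing.\<close>

lemma incr_sum_restrict:
  fixes f :: "real \<Rightarrow> real"
  assumes D: "D division_of t" and "\<And>p q. p \<le> q \<Longrightarrow> {p..q} \<inter> S \<noteq> {} \<Longrightarrow> \<exists>c d. c \<le> d \<and> {p..q} \<inter> S = {c..d}"
  shows "incr_sum f {K \<inter> S | K. K \<in> D \<and> K \<inter> S \<noteq> {}} =
    (\<Sum>K\<in>D. if K \<inter> S = {} then 0 else norm (f (Sup (K \<inter> S)) - f (Inf (K \<inter> S))))"
proof -
  let ?w = "\<lambda>K. norm (f (Sup K) - f (Inf K))"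
  let ?D = "{K \<in> D. K \<inter> S \<noteq> {}}"
  have fin: "finite D" using division_ofD(1)[OF D] .
  have "incr_sum f {K \<inter> S | K. K \<in> D \<and> K \<inter> S \<noteq> {}} = sum ?w ((\<lambda>K. K \<inter> S) ` ?D)"
    by (rule sum.cong) auto
  also have "\<dots> = sum (?w \<circ> (\<lambda>K. K \<inter> S)) ?D"
  proof (rule sum.reindex_nontrivial)
    show "finite ?D" using fin by simp
    fix K K' assume *: "K \<in> ?D" "K' \<in> ?D" "K \<noteq> K'" "K \<inter> S = K' \<inter> S"
    obtain p q where "p \<le> q" "K = {p..q}" using division_real_interval[OF D, of K] * by blast
    then obtain c d where cd: "c \<le> d" "K \<inter> S = {c..d}" using assms(2)[of p q] * by auto
    have "c = d"
      using division_overlap_degenerate[OF D _ _ *(3), of "K \<inter> S" c d] * cd by blast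
    then show "?w (K \<inter> S) = 0" using cd by simp
  qed
  also have "\<dots> = (\<Sum>K\<in>D. if K \<inter> S = {} then 0 else ?w (K \<inter> S))"
    using fin by (simp add: sum.If_cases Int_def o_def)
  finally show ?thesis .
qed

lemma incr_sum_split:
  fixes f :: "real \<Rightarrow> real"
  assumes D: "D division_of {c..e}" and x: "c \<le> x" "x \<le> e"
  obtains D1 D2 where "D1 division_of {c..x}" "D2 division_of {x..e}"
     "incr_sum f D \<le> incr_sum f D1 + incr_sum f D2"
proof -
  let ?D1 = "{K \<inter> {..x} | K. K \<in> D \<and> K \<inter> {..x} \<noteq> {}}"
  let ?D2 = "{K \<inter> {x..} | K. K \<in> D \<and> K \<inter> {x..} \<noteq> {}}"
  have D': "D division_of (cbox c e)" using D by (simp add: cbox_interval)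
  have "?D1 division_of {c..e} \<inter> {..x}" "?D2 division_of {c..e} \<inter> {x..}"
    using division_split[OF D', of 1 x] by (simp_all add: atMost_def atLeast_def cbox_interval)
  moreover have "{c..e} \<inter> {..x} = {c..x}" "{c..e} \<inter> {x..} = {x..e}" using x by auto
  ultimately have 12: "?D1 division_of {c..x}" "?D2 division_of {x..e}" by (simp_all only:)
  have e1: "incr_sum f ?D1 = (\<Sum>K\<in>D. if K \<inter> {..x} = {} then 0 else norm (f (Sup (K \<inter> {..x})) - f (Inf (K \<inter> {..x}))))"
  proof (rule incr_sum_restrict[OF D])
    fix p q :: real assume "p \<le> q" "{p..q} \<inter> {..x} \<noteq> {}"
    then show "\<exists>c d. c \<le> d \<and> {p..q} \<inter> {..x} = {c..d}"
      by (intro exI[of _ p] exI[of _ "min q x"]) auto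
  qed
  have e2: "incr_sum f ?D2 = (\<Sum>K\<in>D. if K \<inter> {x..} = {} then 0 else norm (f (Sup (K \<inter> {x..})) - f (Inf (K \<inter> {x..}))))"
  proof (rule incr_sum_restrict[OF D])
    fix p q :: real assume "p \<le> q" "{p..q} \<inter> {x..} \<noteq> {}"
    then show "\<exists>c d. c \<le> d \<and> {p..q} \<inter> {x..} = {c..d}"
      by (intro exI[of _ "max p x"] exI[of _ q]) auto
  qed
  have "incr_sum f D \<le> incr_sum f ?D1 + incr_sum f ?D2"
    unfolding e1 e2 sum.distrib[symmetric]
  proof (rule sum_mono)
    fix K assume "K \<in> D"
    then obtain p q where pq: "p \<le> q" "K = {p..q}" using division_real_interval[OF D] by blast
    consider "q < x" | "x < p" | "p \<le> x" "x \<le> q" by linarith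
    then show "norm (f (Sup K) - f (Inf K)) \<le>
       (if K \<inter> {..x} = {} then 0 else norm (f (Sup (K \<inter> {..x})) - f (Inf (K \<inter> {..x})))) +
       (if K \<inter> {x..} = {} then 0 else norm (f (Sup (K \<inter> {x..})) - f (Inf (K \<inter> {x..}))))"
    proof cases
      case 1
      then have "K \<inter> {..x} = K" using pq by auto
      then show ?thesis using pq by auto
    next
      case 2
      then have "K \<inter> {x..} = K" using pq by auto
      then show ?thesis using pq by auto
    next
      case 3
      then have "K \<inter> {..x} = {p..x}" "K \<inter> {x..} = {x..q}" using pq by auto
      then show ?thesis using 3 pq by auto
    qed
  qed
  then show ?thesis using that 12 by blast
qed

lemma incr_sum_join:
  fixes f :: "real \<Rightarrow> real"
  assumes D1: "D1 division_of {c..x}" and D2: "D2 division_of {x..e}" and x: "c \<le> x" "x \<le> e"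
  shows "(D1 \<union> D2) division_of {c..e}" "incr_sum f (D1 \<union> D2) = incr_sum f D1 + incr_sum f D2"
proof -
  have "{c..x} \<union> {x..e} = {c..e}" using x by auto
  moreover have "(D1 \<union> D2) division_of ({c..x} \<union> {x..e})"
    by (rule division_disjoint_union[OF D1 D2]) (auto simp: interior_atLeastAtMost_real)
  ultimately show "(D1 \<union> D2) division_of {c..e}" by simp
  show "incr_sum f (D1 \<union> D2) = incr_sum f D1 + incr_sum f D2"
  proof (rule sum.union_inter_neutral)
    show "finite D1" "finite D2" using division_ofD(1) D1 D2 by blast+
    show "\<forall>K\<in>D1 \<inter> D2. norm (f (Sup K) - f (Inf K)) = 0"
    proof
      fix K assume "K \<in> D1 \<inter> D2"
      then have "K \<subseteq> {x}" "K \<noteq> {}" using division_ofD(2,3)[OF D1] division_ofD(2)[OF D2] by fastforce+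
      then have "K = {x}" by auto
      then show "norm (f (Sup K) - f (Inf K)) = 0" by simp
    qed
  qed
qed

text \<open>The total variation over \<open>[c, d]\<close>; the supremum is meaningful under \<open>bv_on f c d\<close>.\<close>

definition variation :: "(real \<Rightarrow> real) \<Rightarrow> real \<Rightarrow> real \<Rightarrow> real" where
  "variation f c d = (SUP D\<in>{D. D division_of {c..d}}. incr_sum f D)"

text \<open>Bounded variation on \<open>[c, d]\<close>.\<close>

abbreviation bv_on :: "(real \<Rightarrow> real) \<Rightarrow> real \<Rightarrow> real \<Rightarrow> bool" where
  "bv_on f c d \<equiv> bdd_above (incr_sum f ` {D. D division_of {c..d}})"

lemma division_of_Icc_self: "c \<le> d \<Longrightarrow> {{c..d}} division_of {c..d::real}"
  using division_of_self[of c d] by (auto simp: cbox_interval)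

lemma bv_on_join:
  assumes "bv_on f c x" "bv_on f x e" "c \<le> x" "x \<le> e"
  shows "bv_on f c e"
proof -
  obtain M1 M2 where M: "\<And>D. D division_of {c..x} \<Longrightarrow> incr_sum f D \<le> M1"
     "\<And>D. D division_of {x..e} \<Longrightarrow> incr_sum f D \<le> M2"
    using assms(1,2) by (auto simp: bdd_above_def)
  have "incr_sum f D \<le> M1 + M2" if D: "D division_of {c..e}" for D
  proof -
    obtain D1 D2 where *: "D1 division_of {c..x}" "D2 division_of {x..e}"
      "incr_sum f D \<le> incr_sum f D1 + incr_sum f D2"
      by (rule incr_sum_split[OF D assms(3,4), of f])
    show ?thesis using *(3) M(1)[OF *(1)] M(2)[OF *(2)] by linarith
  qed
  then show ?thesis by (auto simp: bdd_above_def)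
qed

lemma bv_on_subinterval:
  assumes bv: "bv_on f c e" and "c \<le> x" "x \<le> y" "y \<le> e"
  shows "bv_on f x y"
proof -
  obtain M where M: "\<And>D. D division_of {c..e} \<Longrightarrow> incr_sum f D \<le> M"
    using bv by (auto simp: bdd_above_def)
  have "incr_sum f D \<le> M" if D: "D division_of {x..y}" for D
  proof -
    note 1 = incr_sum_join[OF division_of_Icc_self D \<open>c \<le> x\<close> \<open>x \<le> y\<close>, OF \<open>c \<le> x\<close>]
    have "c \<le> y" using assms by simp
    note 2 = incr_sum_join[OF 1(1) division_of_Icc_self \<open>c \<le> y\<close> \<open>y \<le> e\<close>, OF \<open>y \<le> e\<close>]
    have "incr_sum f D \<le> incr_sum f (({{c..x}} \<union> D) \<union> {{y..e}})"
      unfolding 2(2) 1(2) by simp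
    then show ?thesis using M[OF 2(1)] by simp
  qed
  then show ?thesis by (auto simp: bdd_above_def)
qed

lemma incr_sum_le_variation:
  assumes "bv_on f c d" "D division_of {c..d}"
  shows "incr_sum f D \<le> variation f c d"
  unfolding variation_def using assms by (intro cSUP_upper) auto

lemma variation_approx:
  assumes "bv_on f c d" "c \<le> d" "\<epsilon> > 0"
  obtains D where "D division_of {c..d}" "variation f c d < incr_sum f D + \<epsilon>"
proof -
  have "variation f c d - \<epsilon> < (SUP D\<in>{D. D division_of {c..d}}. incr_sum f D)"
    using assms by (simp add: variation_def)
  then obtain D where "D division_of {c..d}" "variation f c d - \<epsilon> < incr_sum f D"
    using assms(1) division_of_Icc_self[OF assms(2)] by (subst (asm) less_cSUP_iff) auto
  then show ?thesis using that by auto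
qed

lemma variation_join:
  assumes bv: "bv_on f c e" and x: "c \<le> x" "x \<le> e"
  shows "variation f c e = variation f c x + variation f x e"
proof (rule antisym)
  have b1: "bv_on f c x" and b2: "bv_on f x e"
    using bv_on_subinterval[OF bv] x by auto
  show "variation f c e \<le> variation f c x + variation f x e"
    unfolding variation_def[of f c e]
  proof (rule cSUP_least)
    show "{D. D division_of {c..e}} \<noteq> {}" using division_of_Icc_self[of c e] x by auto
    fix D assume "D \<in> {D. D division_of {c..e}}"
    then have D: "D division_of {c..e}" by simp
    obtain D1 D2 where *: "D1 division_of {c..x}" "D2 division_of {x..e}"
      "incr_sum f D \<le> incr_sum f D1 + incr_sum f D2"
      by (rule incr_sum_split[OF D x, of f])
    then show "incr_sum f D \<le> variation f c x + variation f x e"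
      using incr_sum_le_variation[OF b1 *(1)] incr_sum_le_variation[OF b2 *(2)] by linarith
  qed
  show "variation f c x + variation f x e \<le> variation f c e"
  proof (rule field_le_epsilon)
    fix \<epsilon> :: real assume "\<epsilon> > 0"
    then have "\<epsilon> / 2 > 0" by simp
    obtain D1 where D1: "D1 division_of {c..x}" "variation f c x < incr_sum f D1 + \<epsilon> / 2"
      using variation_approx[OF b1 x(1) \<open>\<epsilon> / 2 > 0\<close>] by blast
    obtain D2 where D2: "D2 division_of {x..e}" "variation f x e < incr_sum f D2 + \<epsilon> / 2"
      using variation_approx[OF b2 x(2) \<open>\<epsilon> / 2 > 0\<close>] by blast
    have "incr_sum f (D1 \<union> D2) \<le> variation f c e"
      using incr_sum_join(1)[OF D1(1) D2(1) x] incr_sum_le_variation[OF bv] by blast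
    then show "variation f c x + variation f x e \<le> variation f c e + \<epsilon>"
      using D1 D2 incr_sum_join(2)[OF D1(1) D2(1) x, of f] by simp
  qed
qed

lemma abs_increment_le_variation:
  assumes "bv_on f c d" "c \<le> d"
  shows "\<bar>f d - f c\<bar> \<le> variation f c d"
  using incr_sum_le_variation[OF assms(1) division_of_Icc_self[OF assms(2)]] assms(2)
  by simp

text \<open>On short intervals the variation is at most 1, and bounded variation passes to the union of
  adjacent intervals, so bisection applies.\<close>

lemma abs_continuous_on_imp_bv_on:
  assumes f: "abs_continuous_on a b f" and "a \<le> b"
  shows "bv_on f a b"
proof -
  obtain \<delta> where d: "\<delta> > 0" "\<And>D t. \<lbrakk>D division_of t; t \<subseteq> {a..b}; total_length D < \<delta>\<rbrakk>
     \<Longrightarrow> incr_sum f D < 1" using abs_continuous_onD[OF f, of 1] by auto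
  have "a \<le> a \<and> b \<le> b \<longrightarrow> bv_on f a b"
  proof (rule Bolzano[of a b "\<lambda>c d. a \<le> c \<and> d \<le> b \<longrightarrow> bv_on f c d"])
    show "a \<le> b" by fact
  next
    fix c x e assume "a \<le> c \<and> x \<le> b \<longrightarrow> bv_on f c x" "a \<le> x \<and> e \<le> b \<longrightarrow> bv_on f x e" "c \<le> x" "x \<le> e"
    then show "a \<le> c \<and> e \<le> b \<longrightarrow> bv_on f c e" using bv_on_join[of f c x e] by auto
  next
    fix x
    show "\<exists>d>0. \<forall>c e. c \<le> x \<and> x \<le> e \<and> e - c < d \<longrightarrow> a \<le> c \<and> e \<le> b \<longrightarrow> bv_on f c e"
    proof (intro exI[of _ \<delta>] conjI allI impI)
      show "\<delta> > 0" by fact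
      fix c e assume ce: "c \<le> x \<and> x \<le> e \<and> e - c < \<delta>" "a \<le> c \<and> e \<le> b"
      have "incr_sum f D \<le> 1" if D: "D division_of {c..e}" for D
      proof -
        have "total_length D = (\<Sum>K\<in>D. measure lborel K)"
          using division_measure_interval[OF D] by simp
        also have "\<dots> = e - c" using additive_content_division[of D c e] D ce by (simp add: cbox_interval)
        finally show ?thesis using d(2)[OF D] ce by fastforce
      qed
      then show "bv_on f c e" by (auto simp: bdd_above_def)
    qed
  qed
  then show ?thesis by simp
qed

text \<open>Near-optimal divisions of the members of a division \<^term>\<open>D\<close> together form one division \<open>U\<close> of
  the same total length.\<close>

lemma abs_continuous_on_variation:
  assumes f: "abs_continuous_on a b f" and "a \<le> b"
  shows "abs_continuous_on a b (variation f a)"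
  unfolding abs_continuous_on_def
proof (intro allI impI)
  fix \<epsilon> :: real assume "\<epsilon> > 0"
  then have "\<epsilon> / 2 > 0" by simp
  note bv = abs_continuous_on_imp_bv_on[OF assms]
  obtain \<delta> where d: "\<delta> > 0" "\<And>D t. \<lbrakk>D division_of t; t \<subseteq> {a..b}; total_length D < \<delta>\<rbrakk>
     \<Longrightarrow> incr_sum f D < \<epsilon>/2" using abs_continuous_onD[OF f \<open>\<epsilon> / 2 > 0\<close>] by blast
  show "\<exists>\<delta>>0. \<forall>D t. D division_of t \<and> t \<subseteq> {a..b} \<and> total_length D < \<delta>
      \<longrightarrow> incr_sum (variation f a) D < \<epsilon>"
  proof (intro exI[of _ \<delta>] conjI allI impI)
    show "\<delta> > 0" by fact
    fix D t assume "D division_of t \<and> t \<subseteq> {a..b} \<and> total_length D < \<delta>"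
    then have D: "D division_of t" and t: "t \<subseteq> {a..b}" and len: "total_length D < \<delta>" by auto
    have fin: "finite D" using division_ofD(1)[OF D] .
    define \<eta> where "\<eta> = \<epsilon> / 2 / real (Suc (card D))"
    have "\<eta> > 0" using \<open>\<epsilon> > 0\<close> by (simp add: \<eta>_def)
    have "\<exists>E. E division_of K \<and> norm (variation f a (Sup K) - variation f a (Inf K)) \<le> incr_sum f E + \<eta>"
      if "K \<in> D" for K
    proof -
      obtain c d where cd: "c \<le> d" "K = {c..d}" "Inf K = c" "Sup K = d"
        using division_real_interval[OF D \<open>K \<in> D\<close>] by blast
      have "K \<subseteq> {a..b}" using division_ofD(2)[OF D that] t by auto
      then have ab: "a \<le> c" "d \<le> b" using cd by auto
      then have "a \<le> d" using cd by simp
      have bcd: "bv_on f c d" using bv_on_subinterval[OF bv ab(1) cd(1) ab(2)] .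
      have "bv_on f a d" using bv_on_subinterval[OF bv order_refl \<open>a \<le> d\<close> ab(2)] .
      then have v: "variation f a d = variation f a c + variation f c d" using ab cd by (intro variation_join)
      have "0 \<le> variation f c d" using abs_increment_le_variation[OF bcd cd(1)] by linarith
      obtain E where "E division_of {c..d}" "variation f c d < incr_sum f E + \<eta>"
        using variation_approx[OF bcd cd(1) \<open>\<eta> > 0\<close>] by blast
      then show ?thesis using v cd \<open>0 \<le> variation f c d\<close> by (intro exI[of _ E]) auto
    qed
    then obtain E where E: "\<And>K. K \<in> D \<Longrightarrow> E K division_of K"
      and E': "\<And>K. K \<in> D \<Longrightarrow> norm (variation f a (Sup K) - variation f a (Inf K)) \<le> incr_sum f (E K) + \<eta>"
      by metis
    have degen: "Sup S = Inf S" if KS: "K \<in> D" "K' \<in> D" "K \<noteq> K'" "S \<in> E K" "S \<in> E K'" for K K' S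
    proof -
      obtain c d where cd: "c \<le> d" "S = {c..d}" "Inf S = c" "Sup S = d"
        using division_real_interval[OF E[OF KS(1)] KS(4)] by blast
      have "c = d" using division_overlap_degenerate[OF D KS(1-3) _ _ cd(2,1)]
          division_ofD(2)[OF E[OF KS(1)] KS(4)] division_ofD(2)[OF E[OF KS(2)] KS(5)] by blast
      then show ?thesis using cd by simp
    qed
    have fE: "\<forall>K\<in>E ` D. finite K" using E division_ofD(1) by auto
    define U where "U = \<Union>(E ` D)"
    have U: "U division_of t"
    proof (rule division_ofI)
      show "finite U" using fin fE by (auto simp: U_def)
      fix S assume "S \<in> U"
      then obtain K where K: "K \<in> D" "S \<in> E K" by (auto simp: U_def)
      show "S \<subseteq> t" "S \<noteq> {}" "\<exists>a b. S = cbox a b"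
        using division_ofD(2-4)[OF E[OF K(1)] K(2)] division_ofD(2)[OF D K(1)] by blast+
      fix S' assume "S' \<in> U" "S \<noteq> S'"
      then obtain K' where K': "K' \<in> D" "S' \<in> E K'" by (auto simp: U_def)
      show "interior S \<inter> interior S' = {}"
      proof (cases "K = K'")
        case True
        then show ?thesis using division_ofD(5)[OF E[OF K(1)] K(2)] K' \<open>S \<noteq> S'\<close> by blast
      next
        case False
        have "interior S \<subseteq> interior K" "interior S' \<subseteq> interior K'"
          using division_ofD(2)[OF E[OF K(1)] K(2)] division_ofD(2)[OF E[OF K'(1)] K'(2)]
          by (auto intro!: interior_mono)
        then show ?thesis using division_ofD(5)[OF D K(1) K'(1) False] by blast
      qed
    next
      have "\<Union>U = (\<Union>K\<in>D. \<Union>(E K))" by (auto simp: U_def)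
      also have "\<dots> = \<Union>D" using division_ofD(6)[OF E] by simp
      finally show "\<Union>U = t" using division_ofD(6)[OF D] by simp
    qed
    have sumU: "(\<Sum>S\<in>U. w S) = (\<Sum>K\<in>D. \<Sum>S\<in>E K. w S)"
      if w: "\<And>S. Sup S = Inf S \<Longrightarrow> w S = 0" for w :: "real set \<Rightarrow> real"
    proof -
      have 1: "sum w (\<Union>(E ` D)) = sum (sum w) (E ` D)"
      proof -
        have "w S = 0" if "A \<in> E ` D" "A' \<in> E ` D" "A \<noteq> A'" "S \<in> A" "S \<in> A'" for A A' S
          using that degen w by blast
        then show ?thesis using fE by (subst sum.Union_comp) (auto simp: o_def)
      qed
      have "sum (sum w) (E ` D) = sum (sum w \<circ> E) D"
      proof (rule sum.reindex_nontrivial[OF fin])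
        fix K K' assume "K \<in> D" "K' \<in> D" "K \<noteq> K'" "E K = E K'"
        then show "sum w (E K) = 0" by (intro sum.neutral ballI w) (metis degen)
      qed
      then show ?thesis using 1 by (simp add: U_def)
    qed
    have "(\<Sum>S\<in>U. Sup S - Inf S) = (\<Sum>K\<in>D. \<Sum>S\<in>E K. Sup S - Inf S)" by (rule sumU) simp
    also have "\<dots> = total_length D"
    proof (rule sum.cong)
      fix K assume "K \<in> D"
      then obtain c d where cd: "c \<le> d" "K = {c..d}" "Inf K = c" "Sup K = d"
        using division_real_interval[OF D] by blast
      have "(\<Sum>S\<in>E K. Sup S - Inf S) = (\<Sum>S\<in>E K. measure lborel S)"
        using division_measure_interval[OF E[OF \<open>K \<in> D\<close>]] by simp
      also have "\<dots> = measure lborel K"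
        using additive_content_division[of "E K" c d] E[OF \<open>K \<in> D\<close>] cd by (simp add: cbox_interval)
      also have "\<dots> = Sup K - Inf K" using division_measure_interval[OF D \<open>K \<in> D\<close>] by simp
      finally show "(\<Sum>S\<in>E K. Sup S - Inf S) = Sup K - Inf K" .
    qed simp
    finally have "incr_sum f U < \<epsilon> / 2" using d(2)[OF U t] len by simp
    then have "(\<Sum>K\<in>D. incr_sum f (E K)) < \<epsilon> / 2"
      by (subst (asm) sumU) auto
    moreover have "incr_sum (variation f a) D \<le> (\<Sum>K\<in>D. incr_sum f (E K) + \<eta>)"
      by (rule sum_mono[OF E'])
    moreover have "(\<Sum>K\<in>D. incr_sum f (E K) + \<eta>) = (\<Sum>K\<in>D. incr_sum f (E K)) + real (card D) * \<eta>"
      by (simp add: sum.distrib)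
    moreover have "real (card D) * \<eta> \<le> \<epsilon> / 2"
      using \<open>\<epsilon> > 0\<close> by (simp add: \<eta>_def field_simps)
    ultimately show "incr_sum (variation f a) D < \<epsilon>" by linarith
  qed
qed

section \<open>The fundamental theorem of calculus for absolutely continuous functions\<close>

text \<open>The Stieltjes measure of a monotone absolutely continuous function vanishes on Lebesgue null
  sets: by inner regularity only compact null sets matter, and these are covered by finitely many
  intervals of small total length. The integrand is its Radon-Nikodym density.\<close>

lemma mono_abs_continuous_on_is_integral:
  fixes v :: "real \<Rightarrow> real"
  assumes ac: "abs_continuous_on a b v" and "a \<le> b"
    and mono: "\<And>x y. \<lbrakk>a \<le> x; x \<le> y; y \<le> b\<rbrakk> \<Longrightarrow> v x \<le> v y"
  obtains g where "g absolutely_integrable_on {a..b}"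
    "\<And>x. x \<in> {a..b} \<Longrightarrow> v x = v a + integral {a..x} g"
proof -
  \<comment> \<open>The extension by constants makes the Stieltjes measure finite and concentrated on \<open>[a, b]\<close>.\<close>
  define V where "V = (\<lambda>x. v (max a (min b x)))"
  have Vmono: "V x \<le> V y" if "x \<le> y" for x y
    unfolding V_def using that \<open>a \<le> b\<close> by (intro mono) auto
  have Vcont: "continuous_on UNIV V"
    unfolding V_def using \<open>a \<le> b\<close>
    by (intro continuous_on_compose2[OF abs_continuous_on_imp_continuous_on[OF ac]] continuous_intros) auto
  then have Vright: "continuous (at_right x) V" for x
    by (meson continuous_on_eq_continuous_at continuous_at_imp_continuous_within UNIV_I open_UNIV)
  define \<mu> where "\<mu> = interval_measure V"
  have [simp]: "sets \<mu> = sets borel" "space \<mu> = UNIV" by (simp_all add: \<mu>_def)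
  have \<mu>_Ioc: "emeasure \<mu> {x<..y} = V y - V x" if "x \<le> y" for x y
    unfolding \<mu>_def using that Vmono Vright by (intro emeasure_interval_measure_Ioc)
  have \<mu>_Icc: "emeasure \<mu> {x..y} = V y - V x" if "x \<le> y" for x y
    unfolding \<mu>_def using that Vmono Vcont by (intro emeasure_interval_measure_Icc)
  have \<mu>_le: "emeasure \<mu> {x..y} \<le> v b - v a" if "x \<le> y" for x y
    unfolding \<mu>_Icc[OF that] using \<open>a \<le> b\<close>
    by (intro ennreal_leI diff_mono) (auto simp: V_def intro!: mono)
  have fin: "emeasure \<mu> UNIV \<noteq> \<infinity>"
  proof -
    have "(\<lambda>n. emeasure \<mu> {- real n..real n}) \<longlonglongrightarrow> emeasure \<mu> (\<Union>n. {- real n..real n})"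
      by (rule Lim_emeasure_incseq) (auto simp: incseq_def)
    moreover have "(\<Union>n. {- real n..real n}) = UNIV"
    proof -
      have "\<exists>n. x \<in> {- real n..real n}" for x
        using real_arch_simple[of "\<bar>x\<bar>"] by (auto simp: abs_le_iff minus_le_iff)
      then show ?thesis by blast
    qed
    ultimately have "emeasure \<mu> UNIV \<le> v b - v a"
      by (auto intro!: LIMSEQ_le_const2[of "\<lambda>n. emeasure \<mu> {- real n..real n}"] \<mu>_le)
    then show ?thesis by (metis ennreal_neq_top infinity_ennreal_def neq_top_trans)
  qed
  have null: "emeasure \<mu> C = 0" if C: "compact C" "emeasure lborel C = 0" for C
  proof (rule ccontr)
    assume "emeasure \<mu> C \<noteq> 0"
    moreover have "emeasure \<mu> C \<noteq> \<infinity>"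
      using fin emeasure_mono[of C UNIV \<mu>] by (auto simp: top_unique borel_compact C)
    ultimately obtain \<epsilon> where \<epsilon>: "\<epsilon> > 0" "emeasure \<mu> C = ennreal \<epsilon>"
      by (cases "emeasure \<mu> C") (auto simp: less_le)
    obtain \<delta> where d: "\<delta> > 0" "\<And>D t. \<lbrakk>D division_of t; t \<subseteq> {a..b}; total_length D < \<delta>\<rbrakk>
       \<Longrightarrow> incr_sum v D < \<epsilon>" using abs_continuous_onD[OF ac \<open>\<epsilon> > 0\<close>] by blast
    obtain U where U: "open U" "C \<subseteq> U" "emeasure lborel (U - C) < \<delta>"
      using outer_regular_lborel[of C \<delta>] C d(1) by (auto simp: borel_compact)
    have Ud: "emeasure lborel U < \<delta>"
    proof -
      have "emeasure lborel U = emeasure lborel (C \<union> (U - C))" using U by (simp add: Un_absorb1)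
      also have "\<dots> \<le> emeasure lborel C + emeasure lborel (U - C)"
        using C U by (intro emeasure_subadditive) (auto simp: borel_compact)
      finally show ?thesis using C U by simp
    qed
    have "\<forall>x\<in>C. \<exists>r>0. cball x r \<subseteq> U" using U open_contains_cball by blast
    then obtain r where r: "\<And>x. x \<in> C \<Longrightarrow> r x > 0" "\<And>x. x \<in> C \<Longrightarrow> cball x (r x) \<subseteq> U" by metis
    obtain C' where C': "C' \<subseteq> C" "finite C'" "C \<subseteq> (\<Union>x\<in>C'. ball x (r x))"
    proof (rule compactE_image[OF C(1), of C "\<lambda>x. ball x (r x)"])
      show "C \<subseteq> (\<Union>x\<in>C. ball x (r x))" using r(1) by auto
    qed auto
    define \<F> where "\<F> = (\<lambda>x. cball x (r x) \<inter> {a..b}) ` C'"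
    obtain D where D: "D division_of (\<Union>\<F>)"
    proof (rule elementary_unions_intervals[of \<F>])
      show "finite \<F>" using C' by (simp add: \<F>_def)
      show "\<exists>a b. s = cbox a b" if "s \<in> \<F>" for s
      proof -
        obtain x where x: "s = cball x (r x) \<inter> {a..b}" using \<open>s \<in> \<F>\<close> by (auto simp: \<F>_def)
        have "s = {max (x - r x) a..min (x + r x) b}"
          unfolding x by (auto simp: cball_eq_atLeastAtMost)
        then show ?thesis by (metis cbox_interval)
      qed
    qed auto
    have sub: "\<Union>\<F> \<subseteq> {a..b}" "\<Union>\<F> \<subseteq> U" using r(2) C'(1) by (auto simp: \<F>_def)
    have finD: "finite D" using division_ofD(1)[OF D] .
    have "Sup K - Inf K = measure lebesgue K" if "K \<in> D" for K
      using division_real_interval[OF D that] by (metis measure_completion measure_lborel_Icc sets_lborel borel_closed closed_atLeastAtMost)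
    then have "total_length D = (\<Sum>K\<in>D. measure lebesgue K)" by simp
    also have "\<dots> = measure lebesgue (\<Union>\<F>)" using content_division[OF D] by simp
    also have "\<dots> < \<delta>"
    proof -
      have "\<Union>\<F> \<in> sets borel"
        unfolding \<F>_def using C' by (auto intro!: sets.finite_UN)
      moreover from this have "emeasure lborel (\<Union>\<F>) \<le> emeasure lborel U" using sub U by (intro emeasure_mono) auto
      then have lt: "emeasure lborel (\<Union>\<F>) < ennreal \<delta>" using Ud by (rule le_less_trans)
      then have "emeasure lborel (\<Union>\<F>) \<noteq> top" by auto
      with lt have "measure lborel (\<Union>\<F>) < \<delta>"
        by (metis emeasure_eq_ennreal_measure ennreal_less_iff measure_nonneg)
      ultimately show ?thesis by simp
    qed
    finally have less: "incr_sum v D < \<epsilon>" by (rule d(2)[OF D sub(1)])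
    have out: "{..<a} \<in> null_sets \<mu>" "{b<..} \<in> null_sets \<mu>"
    proof -
      have "(\<Union>n. {a - real n..a}) \<in> null_sets \<mu>" "(\<Union>n. {b..b + real n}) \<in> null_sets \<mu>"
        using \<open>a \<le> b\<close> by (intro null_sets_UN null_setsI; simp add: \<mu>_Icc V_def)+
      moreover have "{..<a} \<subseteq> (\<Union>n. {a - real n..a})"
      proof
        fix x assume "x \<in> {..<a}"
        moreover obtain n where "a - x \<le> real n" using real_arch_simple by blast
        ultimately show "x \<in> (\<Union>n. {a - real n..a})" by (intro UN_I[of n]) auto
      qed
      moreover have "{b<..} \<subseteq> (\<Union>n. {b..b + real n})"
      proof
        fix x assume "x \<in> {b<..}"
        moreover obtain n where "x - b \<le> real n" using real_arch_simple by blast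
        ultimately show "x \<in> (\<Union>n. {b..b + real n})" by (intro UN_I[of n]) auto
      qed
      ultimately show "{..<a} \<in> null_sets \<mu>" "{b<..} \<in> null_sets \<mu>"
        by (auto intro: null_sets_subset)
    qed
    have Dm: "K \<in> sets borel" "emeasure \<mu> K = ennreal (norm (v (Sup K) - v (Inf K)))" if K: "K \<in> D" for K
    proof -
      obtain c e where cd: "c \<le> e" "K = {c..e}" "Inf K = c" "Sup K = e"
        using division_real_interval[OF D K] by blast
      have "K \<subseteq> {a..b}" using division_ofD(2)[OF D K] sub by auto
      then have ab: "a \<le> c" "e \<le> b" using cd by auto
      then have "V e - V c = norm (v e - v c)" using cd mono[of c e] by (simp add: V_def)
      then show "K \<in> sets borel" "emeasure \<mu> K = ennreal (norm (v (Sup K) - v (Inf K)))"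
        using cd \<mu>_Icc[OF cd(1)] by (simp_all add: cd)
    qed
    have "C \<subseteq> {..<a} \<union> {b<..} \<union> \<Union>D"
    proof
      fix x assume "x \<in> C"
      then obtain y where "y \<in> C'" "x \<in> cball y (r y)" using C'(3) ball_subset_cball by blast
      then show "x \<in> {..<a} \<union> {b<..} \<union> \<Union>D"
        unfolding division_ofD(6)[OF D] by (cases "x \<in> {a..b}") (auto simp: \<F>_def)
    qed
    then have "emeasure \<mu> C \<le> emeasure \<mu> (({..<a} \<union> {b<..}) \<union> \<Union>D)"
      using Dm finD by (intro emeasure_mono) (auto intro!: sets.finite_Union)
    also have "\<dots> = emeasure \<mu> (\<Union>D)"
      using emeasure_Un_null_set[of "\<Union>D" \<mu> "{..<a} \<union> {b<..}"] null_sets.Un[OF out] Dm finD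
      by (simp add: Un_commute sets.finite_Union subset_iff)
    also have "\<dots> \<le> (\<Sum>K\<in>D. emeasure \<mu> K)"
      using emeasure_subadditive_finite[OF finD, of "\<lambda>K. K" \<mu>] Dm by auto
    also have "\<dots> = ennreal (incr_sum v D)" using Dm by simp
    also have "\<dots> < ennreal \<epsilon>" using less \<epsilon>(1) by (simp add: ennreal_less_iff sum_nonneg)
    finally show False using \<epsilon> by simp
  qed
  have "absolutely_continuous lborel \<mu>"
    unfolding absolutely_continuous_def
  proof
    fix N :: "real set" assume N: "N \<in> null_sets lborel"
    then have Nb: "N \<in> sets borel" by auto
    have "emeasure \<mu> N = (SUP C \<in> {C. C \<subseteq> N \<and> compact C}. emeasure \<mu> C)"
      by (rule inner_regular) (use fin Nb in auto)
    also have "\<dots> \<le> 0"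
    proof (rule SUP_least)
      fix C assume C: "C \<in> {C. C \<subseteq> N \<and> compact C}"
      then have "C \<in> null_sets lborel" using N by (intro null_sets_subset[OF N]) (auto simp: borel_compact)
      then show "emeasure \<mu> C \<le> 0" using C null by auto
    qed
    finally show "N \<in> null_sets \<mu>" using Nb by auto
  qed
  then obtain h where h: "h \<in> borel_measurable lborel" "density lborel h = \<mu>"
    using sigma_finite_measure.Radon_Nikodym[OF sigma_finite_lborel, of \<mu>] by auto
  have hI: "(\<integral>\<^sup>+t. h t * indicator {x<..y} t \<partial>lborel) = V y - V x" if "x \<le> y" for x y
    using \<mu>_Ioc[OF that] emeasure_density[OF h(1), of "{x<..y}"] unfolding h(2) by simp
  define g where "g = (\<lambda>x. enn2real (h x))"
  have gm: "g \<in> borel_measurable borel" using h(1) by (simp add: g_def)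
  have hfin: "AE x in lborel. x \<in> {a<..b} \<longrightarrow> h x \<noteq> \<infinity>"
  proof -
    have "(\<integral>\<^sup>+x. h x * indicator {a<..b} x \<partial>lborel) \<noteq> \<infinity>"
      unfolding hI[OF \<open>a \<le> b\<close>] by simp
    then have "AE x in lborel. h x * indicator {a<..b} x \<noteq> \<infinity>"
      using h(1) by (intro nn_integral_PInf_AE) auto
    then show ?thesis by eventually_elim (auto simp: indicator_def)
  qed
  have gint: "(g has_integral (v x - v a)) {a<..x}" if x: "x \<in> {a..b}" for x
  proof -
    have "(\<integral>\<^sup>+t. ennreal (g t) * indicator {a<..x} t \<partial>lborel) = (\<integral>\<^sup>+t. h t * indicator {a<..x} t \<partial>lborel)"
      by (rule nn_integral_cong_AE, use hfin in eventually_elim) (use x in \<open>auto simp: g_def indicator_def less_top\<close>)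
    also have "\<dots> = V x - V a" using hI[of a x] x by simp
    also have "V x - V a = v x - v a" using x by (simp add: V_def)
    finally have "(\<integral>\<^sup>+t. ennreal (g t) * indicator {a<..x} t \<partial>lborel) = ennreal (v x - v a)" .
    moreover have "ennreal (g t) * indicator {a<..x} t = ennreal (g t * indicator {a<..x} t)" for t
      by (auto simp: indicator_def)
    ultimately have I: "(\<integral>\<^sup>+t. ennreal (g t * indicator {a<..x} t) \<partial>lborel) = ennreal (v x - v a)" by simp
    have "((\<lambda>t. g t * indicator {a<..x} t) has_integral (v x - v a)) UNIV"
    proof (rule nn_integral_has_integral)
      show "(\<integral>\<^sup>+t. ennreal (g t * indicator {a<..x} t) \<partial>lborel) = ennreal (v x - v a)" by (rule I)
    qed (use gm x mono[of a x] in \<open>auto simp: g_def\<close>)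
    moreover have "(\<lambda>t. g t * indicator {a<..x} t) = (\<lambda>t. if t \<in> {a<..x} then g t else 0)"
      by (auto simp: indicator_def)
    ultimately show ?thesis by (simp only: has_integral_restrict_UNIV)
  qed
  have gint': "(g has_integral (v x - v a)) {a..x}" if x: "x \<in> {a..b}" for x
    using gint[OF x] x
    by (subst has_integral_spike_set_eq[where T = "{a<..x}"]) (auto intro: negligible_subset[of "{a}"])
  show ?thesis
  proof
    have "g integrable_on {a..b}" using gint'[of b] \<open>a \<le> b\<close> by auto
    then show "g absolutely_integrable_on {a..b}"
      by (intro nonnegative_absolutely_integrable_1) (auto simp: g_def)
    show "v x = v a + integral {a..x} g" if "x \<in> {a..b}" for x
      using gint'[OF that] by (simp add: integral_unique)
  qed
qed

text \<open>Both the variation \<open>v\<close> of \<^term>\<open>f\<close> and \<open>f + v\<close> are increasing and absolutely continuous.\<close>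

lemma abs_continuous_on_real_is_integral:
  fixes f :: "real \<Rightarrow> real"
  assumes f: "abs_continuous_on a b f" and "a \<le> b"
  obtains g where "g absolutely_integrable_on {a..b}"
    "\<And>x. x \<in> {a..b} \<Longrightarrow> f x = f a + integral {a..x} g"
proof -
  let ?v = "variation f a"
  note bv = abs_continuous_on_imp_bv_on[OF assms]
  note v = abs_continuous_on_variation[OF assms]
  have inc: "\<bar>f y - f x\<bar> \<le> ?v y - ?v x" if "a \<le> x" "x \<le> y" "y \<le> b" for x y
  proof -
    have "bv_on f a y" using that by (intro bv_on_subinterval[OF bv]) auto
    then have "?v y = ?v x + variation f x y" using that by (intro variation_join) auto
    moreover have "\<bar>f y - f x\<bar> \<le> variation f x y"
      using that by (intro abs_increment_le_variation bv_on_subinterval[OF bv]) auto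
    ultimately show ?thesis by simp
  qed
  have w: "abs_continuous_on a b (\<lambda>x. f x + ?v x)"
    by (rule abs_continuous_on_bound[OF f v, of 1]) auto
  obtain g1 where g1: "g1 absolutely_integrable_on {a..b}" "\<And>x. x \<in> {a..b} \<Longrightarrow> ?v x = ?v a + integral {a..x} g1"
  proof (rule mono_abs_continuous_on_is_integral[OF v \<open>a \<le> b\<close>])
    show "?v x \<le> ?v y" if "a \<le> x" "x \<le> y" "y \<le> b" for x y using inc[OF that] by linarith
  qed blast
  obtain g2 where g2: "g2 absolutely_integrable_on {a..b}" "\<And>x. x \<in> {a..b} \<Longrightarrow> f x + ?v x = f a + ?v a + integral {a..x} g2"
  proof (rule mono_abs_continuous_on_is_integral[OF w \<open>a \<le> b\<close>])
    show "f x + ?v x \<le> f y + ?v y" if "a \<le> x" "x \<le> y" "y \<le> b" for x y using inc[OF that] by linarith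
  qed blast
  show ?thesis
  proof (rule that[of "\<lambda>x. g2 x - g1 x"])
    show "(\<lambda>x. g2 x - g1 x) absolutely_integrable_on {a..b}" by (intro set_integral_diff g1 g2)
    fix x assume x: "x \<in> {a..b}"
    have "g1 integrable_on {a..x}" "g2 integrable_on {a..x}"
      using x g1(1) g2(1) by (auto simp: absolutely_integrable_on_def intro: integrable_subinterval_real)
    then have "integral {a..x} (\<lambda>x. g2 x - g1 x) = integral {a..x} g2 - integral {a..x} g1"
      by (rule Henstock_Kurzweil_Integration.integral_diff[rotated])
    then show "f x = f a + integral {a..x} (\<lambda>x. g2 x - g1 x)" using g1(2)[OF x] g2(2)[OF x] by simp
  qed
qed

theorem abs_continuous_on_is_integral:
  fixes f :: "real \<Rightarrow> 'a::euclidean_space"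
  assumes f: "abs_continuous_on a b f" and "a \<le> b"
  obtains g where "g absolutely_integrable_on {a..b}"
    "\<And>x. x \<in> {a..b} \<Longrightarrow> f x = f a + integral {a..x} g"
proof -
  have "\<exists>g. g absolutely_integrable_on {a..b} \<and> (\<forall>x\<in>{a..b}. f x \<bullet> i = f a \<bullet> i + integral {a..x} g)" for i
  proof -
    have "abs_continuous_on a b (\<lambda>x. f x \<bullet> i)"
      by (rule abs_continuous_on_bound[OF f f, of "norm i"])
        (auto simp flip: inner_diff_left intro!: order_trans[OF Cauchy_Schwarz_ineq2]
          simp: mult.commute mult_right_mono)
    from abs_continuous_on_real_is_integral[OF this \<open>a \<le> b\<close>] show ?thesis by metis
  qed
  then obtain g where g: "\<And>i. g i absolutely_integrable_on {a..b}"
    "\<And>i x. x \<in> {a..b} \<Longrightarrow> f x \<bullet> i = f a \<bullet> i + integral {a..x} (g i)" by metis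
  show ?thesis
  proof (rule that[of "\<lambda>x. \<Sum>i\<in>Basis. g i x *\<^sub>R i"])
    show "(\<lambda>x. \<Sum>i\<in>Basis. g i x *\<^sub>R i) absolutely_integrable_on {a..b}"
      by (intro absolutely_integrable_sum absolutely_integrable_scaleR_right g) auto
    fix x assume x: "x \<in> {a..b}"
    have "((\<lambda>x. \<Sum>i\<in>Basis. g i x *\<^sub>R i) has_integral (\<Sum>i\<in>Basis. (f x \<bullet> i - f a \<bullet> i) *\<^sub>R i)) {a..x}"
    proof (intro has_integral_sum has_integral_scaleR_left)
      fix i
      have "g i integrable_on {a..b}" using g(1)[of i] by (simp add: absolutely_integrable_on_def)
      then have "g i integrable_on {a..x}" by (rule integrable_subinterval_real) (use x in auto)
      then show "(g i has_integral (f x \<bullet> i - f a \<bullet> i)) {a..x}"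
        using g(2)[OF x, of i] by (simp add: has_integral_iff)
    qed auto
    then show "f x = f a + integral {a..x} (\<lambda>x. \<Sum>i\<in>Basis. g i x *\<^sub>R i)"
      by (simp add: integral_unique euclidean_representation flip: inner_diff_left)
  qed
qed

lemma abs_continuous_on_cong:
  assumes "abs_continuous_on a b f" "\<And>x. x \<in> {a..b} \<Longrightarrow> f x = g x"
  shows "abs_continuous_on a b g"
  by (rule abs_continuous_on_bound[OF assms(1) assms(1), of 1]) (use assms(2) in auto)

text \<open>Conversely, an indefinite integral is absolutely continuous, and its derivative is the integrand
  almost everywhere.\<close>

lemma is_integral_derivative:
  fixes f :: "real \<Rightarrow> 'a::euclidean_space"
  assumes g: "g absolutely_integrable_on {a..b}" and f: "\<And>x. x \<in> {a..b} \<Longrightarrow> f x = f a + integral {a..x} g"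
  shows "abs_continuous_on a b f"
    and "AE x in lebesgue_on {a<..<b}. (f has_vector_derivative g x) (at x)"
proof -
  have "abs_continuous_on a b (\<lambda>x. f a + integral {a..x} g)"
    by (rule abs_continuous_on_bound[OF abs_continuous_on_indefinite_integral[OF g] abs_continuous_on_indefinite_integral[OF g], of 1]) auto
  then show "abs_continuous_on a b f" by (rule abs_continuous_on_cong) (rule f[symmetric])
  obtain N where N: "negligible N"
    "\<And>x. x \<in> {a<..<b} - N \<Longrightarrow> ((\<lambda>t. integral {a..t} g) has_vector_derivative g x) (at x)"
  proof -
    have "g integrable_on {a..b}" using g by (simp add: absolutely_integrable_on_def)
    from ae_derivative_indefinite_integral[OF this] show ?thesis using that by blast
  qed
  have "(f has_vector_derivative g x) (at x)" if "x \<in> {a<..<b} - N" for x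
  proof -
    have "((\<lambda>t. f a + integral {a..t} g) has_vector_derivative g x) (at x)"
      using N(2)[OF that] by (auto intro!: derivative_eq_intros)
    then show ?thesis
    proof (rule has_vector_derivative_transform_within_open[of _ _ _ "{a<..<b}"])
      show "f a + integral {a..y} g = f y" if "y \<in> {a<..<b}" for y using f[of y] that by simp
    qed (use that in auto)
  qed
  moreover have "AE x in lebesgue. x \<notin> N" using N(1) by (simp add: negligible_iff_null_sets AE_not_in)
  ultimately show "AE x in lebesgue_on {a<..<b}. (f has_vector_derivative g x) (at x)"
    by (subst AE_restrict_space_iff) auto
qed

section \<open>Caratheodory differential equations\<close>

text \<open>Equations \<open>y' = f t y\<close> whose right-hand side is Lipschitz in \<open>y\<close> with a Lebesgue integrable Lipschitz
  constant \<open>m t\<close>, and integrable along continuous functions.\<close>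

locale caratheodory =
  fixes a b :: real and f :: "real \<Rightarrow> 'e::euclidean_space \<Rightarrow> 'e" and m :: "real \<Rightarrow> real"
  assumes integrable_rhs: "\<And>y. continuous_on {a..b} y \<Longrightarrow> (\<lambda>t. f t (y t)) absolutely_integrable_on {a..b}"
    and m_integrable: "m absolutely_integrable_on {a..b}"
    and m_nonneg: "\<And>t. t \<in> {a..b} \<Longrightarrow> 0 \<le> m t"
    and lipschitz: "\<And>t v w. t \<in> {a..b} \<Longrightarrow> norm (f t v - f t w) \<le> m t * norm (v - w)"
begin

text \<open>Solutions on \<open>[c, d]\<close> with value \<^term>\<open>v\<close> at \<open>c\<close>, in the sense of the integral equation.\<close>

definition solves :: "(real \<Rightarrow> 'e) \<Rightarrow> real \<Rightarrow> real \<Rightarrow> 'e \<Rightarrow> bool" where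
  "solves y c d v \<longleftrightarrow> continuous_on {c..d} y \<and> (\<forall>t\<in>{c..d}. y t = v + integral {c..t} (\<lambda>s. f s (y s)))"

lemma integrable_rhs_sub:
  assumes y: "continuous_on {c..d} y" and cd: "a \<le> c" "c \<le> d" "d \<le> b"
  shows "(\<lambda>t. f t (y t)) integrable_on {c..d}"
proof -
  have "continuous_on {a..b} (\<lambda>t. y (max c (min d t)))"
    using cd by (intro continuous_on_compose2[OF y] continuous_intros) auto
  from integrable_rhs[OF this] have "(\<lambda>t. f t (y (max c (min d t)))) integrable_on {a..b}"
    by (simp add: absolutely_integrable_on_def)
  then have "(\<lambda>t. f t (y (max c (min d t)))) integrable_on {c..d}"
    by (rule integrable_subinterval_real) (use cd in auto)
  then show ?thesis by (rule integrable_eq) (auto simp: min_absorb2 max_absorb2)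
qed

lemma solves_join:
  assumes 1: "solves y1 c x v" and 2: "solves y2 x e (y1 x)" and cx: "a \<le> c" "c \<le> x" "x \<le> e" "e \<le> b"
  shows "solves (\<lambda>t. if t \<le> x then y1 t else y2 t) c e v"
proof -
  let ?y = "\<lambda>t. if t \<le> x then y1 t else y2 t"
  have y2x: "y2 x = y1 x" using 2 cx by (auto simp: solves_def)
  have "continuous_on ({c..x} \<union> {x..e}) ?y"
    using 1 2 y2x by (intro continuous_on_cases) (auto simp: solves_def)
  moreover have "{c..x} \<union> {x..e} = {c..e}" using cx by auto
  ultimately have cont: "continuous_on {c..e} ?y" by simp
  have "?y t = v + integral {c..t} (\<lambda>s. f s (?y s))" if t: "t \<in> {c..e}" for t
  proof (cases "t \<le> x")
    case True
    have "integral {c..t} (\<lambda>s. f s (?y s)) = integral {c..t} (\<lambda>s. f s (y1 s))"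
      by (rule integral_cong) (use True in auto)
    then show ?thesis using 1 t True by (auto simp: solves_def)
  next
    case False
    have i: "(\<lambda>s. f s (?y s)) integrable_on {c..t}"
      using t cx by (intro integrable_rhs_sub continuous_on_subset[OF cont]) auto
    have "integral {c..t} (\<lambda>s. f s (?y s)) = integral {c..x} (\<lambda>s. f s (?y s)) + integral {x..t} (\<lambda>s. f s (?y s))"
      using cx False by (subst Henstock_Kurzweil_Integration.integral_combine[OF _ _ i]) auto
    also have "integral {c..x} (\<lambda>s. f s (?y s)) = integral {c..x} (\<lambda>s. f s (y1 s))"
      by (rule integral_cong) auto
    also have "integral {x..t} (\<lambda>s. f s (?y s)) = integral {x..t} (\<lambda>s. f s (y2 s))"
      by (rule integral_cong) (use y2x in auto)
    finally have "v + integral {c..t} (\<lambda>s. f s (?y s)) =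
       (v + integral {c..x} (\<lambda>s. f s (y1 s))) + integral {x..t} (\<lambda>s. f s (y2 s))" by simp
    also have "v + integral {c..x} (\<lambda>s. f s (y1 s)) = y1 x" using 1 cx by (simp add: solves_def)
    also have "y1 x + integral {x..t} (\<lambda>s. f s (y2 s)) = y2 t" using 2 t False by (simp add: solves_def)
    finally show ?thesis using False by simp
  qed
  then show ?thesis using cont by (simp add: solves_def)
qed

text \<open>On an interval where \<open>m\<close> has integral at most 1/2, the Picard operator is a contraction of the
  space of bounded continuous functions; the clamping of \<open>t\<close> to \<open>[c, d]\<close> makes its values functions
  on the whole line.\<close>

lemma solves_short:
  assumes cd: "a \<le> c" "c \<le> d" "d \<le> b" and short: "integral {c..d} m \<le> 1 / 2"
  shows "\<exists>y. solves y c d v"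
proof -
  define T where "T = (\<lambda>g::real \<Rightarrow>\<^sub>C 'e. Bcontfun (\<lambda>t. v + integral {c..max c (min d t)} (\<lambda>s. f s (g s))))"
  have cg: "continuous_on {c..d} (apply_bcontfun g)" for g :: "real \<Rightarrow>\<^sub>C 'e" by simp
  note int = integrable_rhs_sub[OF cg cd]
  have T: "apply_bcontfun (T g) t = v + integral {c..max c (min d t)} (\<lambda>s. f s (g s))" for g t
  proof -
    let ?h = "\<lambda>t. v + integral {c..max c (min d t)} (\<lambda>s. f s (g s))"
    have c0: "continuous_on {c..d} (\<lambda>t. integral {c..t} (\<lambda>s. f s (g s)))"
      using int by (rule indefinite_integral_continuous_1)
    have c: "continuous_on UNIV ?h"
      using cd by (intro continuous_intros continuous_on_compose2[OF c0]) auto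
    have "?h ` UNIV \<subseteq> (\<lambda>t. v + integral {c..t} (\<lambda>s. f s (g s))) ` {c..d}"
      using cd by auto
    moreover have "bounded ((\<lambda>t. v + integral {c..t} (\<lambda>s. f s (g s))) ` {c..d})"
      by (intro compact_imp_bounded compact_continuous_image continuous_intros c0) auto
    ultimately have "?h \<in> bcontfun" using c bounded_subset by (auto simp: bcontfun_def)
    then show ?thesis by (simp add: T_def Bcontfun_inverse)
  qed
  have mi: "m integrable_on {c..d}"
    using m_integrable cd by (auto simp: absolutely_integrable_on_def intro: integrable_subinterval_real)
  have "dist (T g) (T h) \<le> 1 / 2 * dist g h" for g h
  proof (rule dist_bound)
    fix t
    define u where "u = max c (min d t)"
    have u: "c \<le> u" "u \<le> d" using cd by (auto simp: u_def)
    have su: "{c..u} \<subseteq> {c..d}" using u by auto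
    have "dist (T g t) (T h t) = norm (integral {c..u} (\<lambda>s. f s (g s)) - integral {c..u} (\<lambda>s. f s (h s)))"
      unfolding T u_def[symmetric] by (simp add: dist_norm)
    also have "\<dots> = norm (integral {c..u} (\<lambda>s. f s (g s) - f s (h s)))"
      using integrable_subinterval_real[OF int su]
      by (subst Henstock_Kurzweil_Integration.integral_diff) auto
    also have "\<dots> \<le> integral {c..u} (\<lambda>s. m s * dist g h)"
    proof (rule integral_norm_bound_integral)
      show "(\<lambda>s. f s (g s) - f s (h s)) integrable_on {c..u}"
        by (intro integrable_diff integrable_subinterval_real[OF int su])
      show "(\<lambda>s. m s * dist g h) integrable_on {c..u}"
        by (intro integrable_on_mult_left integrable_subinterval_real[OF mi su])
      fix s assume s: "s \<in> {c..u}"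
      then have s': "s \<in> {a..b}" using cd u by auto
      have "norm (f s (g s) - f s (h s)) \<le> m s * norm (g s - h s)" by (rule lipschitz[OF s'])
      also have "\<dots> \<le> m s * dist g h"
        using dist_bounded[of g s h] m_nonneg[OF s'] by (intro mult_left_mono) (auto simp: dist_norm)
      finally show "norm (f s (g s) - f s (h s)) \<le> m s * dist g h" .
    qed
    also have "\<dots> = integral {c..u} m * dist g h" by simp
    also have "\<dots> \<le> integral {c..d} m * dist g h"
    proof (intro mult_right_mono integral_subset_le su mi integrable_subinterval_real[OF mi su])
    qed (use m_nonneg cd in auto)
    also have "\<dots> \<le> 1 / 2 * dist g h" by (rule mult_right_mono[OF short]) auto
    finally show "dist (T g t) (T h t) \<le> 1 / 2 * dist g h" .
  qed
  then have "\<exists>!g. T g = g" by (intro banach_fix_type[of "1/2"]) auto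
  then obtain g where g: "T g = g" by blast
  have "solves (apply_bcontfun g) c d v"
    unfolding solves_def
  proof (intro conjI ballI)
    fix t assume "t \<in> {c..d}"
    then have "max c (min d t) = t" by auto
    then show "g t = v + integral {c..t} (\<lambda>s. f s (g s))" using T[of g t] g by simp
  qed simp
  then show ?thesis by blast
qed

text \<open>Solvability for all initial values passes to the union of adjacent intervals and holds on all
  short intervals, hence on \<open>[a, b]\<close> by bisection.\<close>

theorem solution_exists:
  assumes "a \<le> b"
  shows "\<exists>y. solves y a b v"
proof -
  have "abs_continuous_on a b (\<lambda>t. integral {a..t} m)"
    by (rule abs_continuous_on_indefinite_integral[OF m_integrable])
  then obtain \<delta> where \<delta>: "\<delta> > 0"
    "\<And>x y. \<lbrakk>x \<in> {a..b}; y \<in> {a..b}; \<bar>x - y\<bar> < \<delta>\<rbrakk> \<Longrightarrow> norm (integral {a..x} m - integral {a..y} m) < 1 / 2"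
    using abs_continuous_on_imp_uniform[of a b _ "1/2"] by (metis half_gt_zero zero_less_one)
  have "a \<le> b \<longrightarrow> a \<le> a \<and> b \<le> b \<longrightarrow> (\<forall>v. \<exists>y. solves y a b v)"
  proof (rule Bolzano[of a b "\<lambda>c d. c \<le> d \<longrightarrow> a \<le> c \<and> d \<le> b \<longrightarrow> (\<forall>v. \<exists>y. solves y c d v)"])
    fix c x e
    assume IH: "c \<le> x \<longrightarrow> a \<le> c \<and> x \<le> b \<longrightarrow> (\<forall>v. \<exists>y. solves y c x v)"
      "x \<le> e \<longrightarrow> a \<le> x \<and> e \<le> b \<longrightarrow> (\<forall>v. \<exists>y. solves y x e v)" and cx: "c \<le> x" "x \<le> e"
    show "c \<le> e \<longrightarrow> a \<le> c \<and> e \<le> b \<longrightarrow> (\<forall>v. \<exists>y. solves y c e v)"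
    proof (intro impI allI)
      fix v assume ce: "a \<le> c \<and> e \<le> b"
      obtain y1 where y1: "solves y1 c x v" using IH(1) cx ce by force
      obtain y2 where "solves y2 x e (y1 x)" using IH(2) cx ce by force
      then show "\<exists>y. solves y c e v" using solves_join[OF y1] cx ce by blast
    qed
  next
    fix x
    show "\<exists>d>0. \<forall>c e. c \<le> x \<and> x \<le> e \<and> e - c < d \<longrightarrow> c \<le> e \<longrightarrow> a \<le> c \<and> e \<le> b \<longrightarrow> (\<forall>v. \<exists>y. solves y c e v)"
    proof (intro exI[of _ \<delta>] conjI allI impI)
      show "\<delta> > 0" by fact
      fix c e v assume ce: "c \<le> x \<and> x \<le> e \<and> e - c < \<delta>" "c \<le> e" "a \<le> c \<and> e \<le> b"
      have mi: "m integrable_on {a..e}"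
        using m_integrable ce by (auto simp: absolutely_integrable_on_def intro: integrable_subinterval_real)
      have "integral {a..c} m + integral {c..e} m = integral {a..e} m"
        using ce by (intro Henstock_Kurzweil_Integration.integral_combine[OF _ _ mi]) auto
      moreover have "\<bar>integral {a..e} m - integral {a..c} m\<bar> < 1 / 2" using \<delta>(2)[of e c] ce by auto
      ultimately have "integral {c..e} m \<le> 1 / 2" by linarith
      then show "\<exists>y. solves y c e v" using ce by (intro solves_short) auto
    qed
  qed fact
  then show ?thesis using assms by simp
qed

end

section \<open>The Hermitian inner product\<close>

lemma cdot_add_left: "cdot (x + y) z = cdot x z + cdot y z"
  by (simp add: cdot_def algebra_simps sum.distrib)
lemma cdot_add_right: "cdot x (y + z) = cdot x y + cdot x z"
  by (simp add: cdot_def algebra_simps sum.distrib)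
lemma cdot_scale_left: "cdot (c *s x) y = c * cdot x y"
  by (simp add: cdot_def sum_distrib_left algebra_simps)
lemma cdot_scale_right: "cdot x (c *s y) = cnj c * cdot x y"
  by (simp add: cdot_def sum_distrib_left algebra_simps)
lemma cdot_zero [simp]: "cdot 0 x = 0" "cdot x 0 = 0" by (simp_all add: cdot_def)
lemma cdot_minus_left: "cdot (- x) y = - cdot x y" by (simp add: cdot_def sum_negf)
lemma cdot_minus_right: "cdot x (- y) = - cdot x y" by (simp add: cdot_def sum_negf)
lemma cdot_diff_left: "cdot (x - y) z = cdot x z - cdot y z"
  by (simp add: cdot_def algebra_simps sum_subtractf)
lemma cdot_diff_right: "cdot x (y - z) = cdot x y - cdot x z"
  by (simp add: cdot_def algebra_simps sum_subtractf)
lemma cdot_sum_left: "cdot (\<Sum>i\<in>I. f i) y = (\<Sum>i\<in>I. cdot (f i) y)"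
  by (induction I rule: infinite_finite_induct) (simp_all add: cdot_add_left)
lemma cdot_commute: "cdot y x = cnj (cdot x y)"
  by (simp add: cdot_def mult.commute)
lemmas cdot_simps = cdot_add_left cdot_add_right cdot_scale_left cdot_scale_right cdot_minus_left
  cdot_minus_right cdot_diff_left cdot_diff_right

lemma cdot_self: "cdot x x = complex_of_real ((norm x)\<^sup>2)"
proof -
  have "(norm x)\<^sup>2 = (\<Sum>i\<in>UNIV. (cmod (x $ i))\<^sup>2)"
    by (simp add: norm_vec_def L2_set_def sum_nonneg)
  then show ?thesis by (simp add: cdot_def complex_norm_square flip: of_real_power)
qed

lemma Re_cdot: "Re (cdot x y) = x \<bullet> y"
  by (simp add: cdot_def inner_vec_def inner_complex_def)

lemma scaleR_eq_scale: "r *\<^sub>R (x :: complex ^ 'n) = complex_of_real r *s x"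
  by (simp add: vec_eq_iff scaleR_conv_of_real[where 'a = complex])

lemma cdot_eq_0_iff: "cdot x x = 0 \<longleftrightarrow> x = 0"
  by (simp add: cdot_self)

lemma norm_cscale: "norm (c *s (x :: complex ^ 'n::finite)) = cmod c * norm x"
  by (simp add: norm_vec_def norm_mult L2_set_right_distrib)

lemma norm_cdot_le: "cmod (cdot x y) \<le> norm x * norm y"
proof (cases "cdot x y = 0")
  case False
  define c where "c = cnj (cdot x y) / cmod (cdot x y)"
  have "cmod c = 1" using False by (simp add: c_def norm_divide)
  have "cnj (cdot x y) * cdot x y = complex_of_real (cmod (cdot x y)) * complex_of_real (cmod (cdot x y))"
    by (metis complex_norm_square mult.commute of_real_power power2_eq_square)
  then have "c * cdot x y = complex_of_real (cmod (cdot x y))" using False by (simp add: c_def)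
  then have "cmod (cdot x y) = Re (cdot (c *s x) y)" by (simp add: cdot_scale_left)
  also have "\<dots> \<le> norm (c *s x) * norm y" unfolding Re_cdot by (rule norm_cauchy_schwarz)
  finally show ?thesis using \<open>cmod c = 1\<close> by (simp add: norm_cscale)
qed simp

lemma bounded_bilinear_cdot: "bounded_bilinear (cdot :: complex ^ 'n::finite \<Rightarrow> _)"
proof
  show "\<exists>K. \<forall>a b. norm (cdot a (b :: complex ^ 'n)) \<le> norm a * norm b * K"
    by (rule exI[of _ 1]) (simp add: norm_cdot_le)
qed (simp_all add: cdot_simps scaleR_eq_scale scaleR_conv_of_real)

lemma bounded_linear_cscale: "bounded_linear (\<lambda>x :: complex ^ 'n::finite. c *s x)"
proof
  show "\<exists>K. \<forall>x::complex ^ 'n. norm (c *s x) \<le> norm x * K"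
    by (rule exI[of _ "cmod c"]) (simp add: norm_cscale)
qed (simp_all add: vec_eq_iff algebra_simps)

text \<open>The discriminant inequality for a nonnegative Hermitian form. For \<open>B = 0\<close> it says that the form
  has no linear part.\<close>

lemma quadratic_form_bound:
  fixes z :: complex
  assumes "\<And>c. 0 \<le> A + 2 * Re (cnj c * z) + (cmod c)\<^sup>2 * B" and "B \<ge> 0"
  shows "(cmod z)\<^sup>2 \<le> A * B"
proof (cases "B = 0")
  case False
  then have "B > 0" using assms by simp
  have e1: "Re (cnj (- z / of_real B) * z) = - (cmod z)\<^sup>2 / B"
  proof -
    have "Re (cnj (- z / of_real B) * z) = - (Re z * Re z + Im z * Im z) / B"
      by (simp add: add_divide_distrib diff_divide_distrib)
    then show ?thesis using cmod_power2[of z] by (simp add: power2_eq_square)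
  qed
  have e2: "(cmod (- z / of_real B))\<^sup>2 * B = (cmod z)\<^sup>2 / B"
    using \<open>B > 0\<close> by (simp add: norm_divide power_divide power2_eq_square)
  have "0 \<le> A + 2 * (- (cmod z)\<^sup>2 / B) + (cmod z)\<^sup>2 / B"
    using assms(1)[of "- z / of_real B"] unfolding e1 e2 .
  then show ?thesis using \<open>B > 0\<close> by (simp add: field_simps)
next
  case True
  have "z = 0"
  proof (rule ccontr)
    assume "z \<noteq> 0"
    define t where "t = (\<bar>A\<bar> + 1) / (cmod z)\<^sup>2"
    have "Re (cnj (- of_real t * z) * z) = - t * (Re z * Re z + Im z * Im z)"
      by (simp add: algebra_simps)
    also have "\<dots> = - t * (cmod z)\<^sup>2" unfolding cmod_power2 by (simp add: power2_eq_square)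
    also have "\<dots> = - (\<bar>A\<bar> + 1)" using \<open>z \<noteq> 0\<close> by (simp add: t_def)
    finally show False using assms(1)[of "- of_real t * z"] True by simp
  qed
  then show ?thesis using True by simp
qed

section \<open>Square-integrable functions\<close>

text \<open>Lebesgue measure on the open interval.\<close>

abbreviation (input) Leb :: "real \<Rightarrow> real \<Rightarrow> real measure" where
  "Leb a b \<equiv> lebesgue_on {a<..<b}"

text \<open>The inner product of \<open>L2\<close> and its quadratic form, on functions rather than on classes.\<close>

definition ip :: "real \<Rightarrow> real \<Rightarrow> (real \<Rightarrow> complex ^ 's) \<Rightarrow> (real \<Rightarrow> complex ^ 's::finite) \<Rightarrow> complex" where
  "ip a b f g = (LINT x|Leb a b. cdot (f x) (g x))"

definition sqnorm :: "real \<Rightarrow> real \<Rightarrow> (real \<Rightarrow> complex ^ 's::finite) \<Rightarrow> real" where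
  "sqnorm a b f = (LINT x|Leb a b. (norm (f x))\<^sup>2)"

lemma L2_fun_measurable: "f \<in> L2_fun a b \<Longrightarrow> f \<in> borel_measurable (Leb a b)"
  by (simp add: L2_fun_def)

lemma L2_fun_I:
  assumes f: "f \<in> borel_measurable (Leb a b)" and g: "integrable (Leb a b) g"
    and le: "AE x in Leb a b. (norm (f x))\<^sup>2 \<le> g x"
  shows "f \<in> L2_fun a b"
  unfolding L2_fun_def mem_Collect_eq
proof (intro conjI f Bochner_Integration.integrable_bound[OF g])
  show "AE x in Leb a b. norm ((norm (f x))\<^sup>2) \<le> norm (g x)" using le by eventually_elim auto
  have "norm \<in> borel_measurable (borel :: (complex ^ 'a) measure)" by simp
  from measurable_compose[OF f this] show "(\<lambda>x. (norm (f x))\<^sup>2) \<in> borel_measurable (Leb a b)"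
    by (intro borel_measurable_power)
qed

lemma L2_fun_add:
  fixes f g :: "real \<Rightarrow> complex ^ 's::finite"
  assumes "f \<in> L2_fun a b" "g \<in> L2_fun a b"
  shows "(\<lambda>x. f x + g x) \<in> L2_fun a b"
proof (rule L2_fun_I)
  show "(\<lambda>x. f x + g x) \<in> borel_measurable (Leb a b)" using assms by (intro borel_measurable_add L2_fun_measurable)
  show "integrable (Leb a b) (\<lambda>x. 2 * (norm (f x))\<^sup>2 + 2 * (norm (g x))\<^sup>2)"
    using assms by (auto simp: L2_fun_def)
  have "(norm (f x + g x))\<^sup>2 \<le> 2 * (norm (f x))\<^sup>2 + 2 * (norm (g x))\<^sup>2" for x
  proof -
    have "(norm (f x + g x))\<^sup>2 \<le> (norm (f x) + norm (g x))\<^sup>2" by (intro power_mono norm_triangle_ineq) simp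
    also have "\<dots> \<le> 2 * (norm (f x))\<^sup>2 + 2 * (norm (g x))\<^sup>2"
      using sum_squares_bound[of "norm (f x)" "norm (g x)"] by (simp add: power2_sum)
    finally show ?thesis .
  qed
  then show "AE x in Leb a b. (norm (f x + g x))\<^sup>2 \<le> 2 * (norm (f x))\<^sup>2 + 2 * (norm (g x))\<^sup>2" by simp
qed

lemma L2_fun_scale:
  fixes f :: "real \<Rightarrow> complex ^ 's::finite"
  assumes "f \<in> L2_fun a b"
  shows "(\<lambda>x. c *s f x) \<in> L2_fun a b"
proof (rule L2_fun_I)
  have "(\<lambda>x :: complex ^ 's. c *s x) \<in> borel_measurable borel"
    using bounded_linear_cscale by (intro borel_measurable_continuous_onI linear_continuous_on)
  then show "(\<lambda>x. c *s f x) \<in> borel_measurable (Leb a b)"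
    using measurable_compose[OF L2_fun_measurable[OF assms]] by blast
  show "integrable (Leb a b) (\<lambda>x. (cmod c)\<^sup>2 * (norm (f x))\<^sup>2)" using assms by (auto simp: L2_fun_def)
qed (simp add: norm_cscale power_mult_distrib)

lemma L2_fun_minus: "f \<in> L2_fun a b \<Longrightarrow> (\<lambda>x. - f x) \<in> L2_fun a b"
  using L2_fun_scale[of f a b "-1"] by simp

lemma L2_fun_diff:
  "f \<in> L2_fun a b \<Longrightarrow> g \<in> L2_fun a b \<Longrightarrow> (\<lambda>x. f x - g x) \<in> L2_fun a b"
  using L2_fun_add[OF _ L2_fun_minus] by fastforce

lemma L2_fun_0: "(\<lambda>x. 0) \<in> L2_fun a b"
  by (simp add: L2_fun_def)

lemma integrable_cdot:
  fixes f g :: "real \<Rightarrow> complex ^ 's::finite"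
  assumes f: "f \<in> L2_fun a b" and g: "g \<in> L2_fun a b"
  shows "integrable (Leb a b) (\<lambda>x. cdot (f x) (g x))"
proof (rule Bochner_Integration.integrable_bound)
  show "integrable (Leb a b) (\<lambda>x. (norm (f x))\<^sup>2 + (norm (g x))\<^sup>2)"
    using assms by (auto simp: L2_fun_def)
  show "(\<lambda>x. cdot (f x) (g x)) \<in> borel_measurable (Leb a b)"
  proof (rule borel_measurable_continuous_Pair[OF L2_fun_measurable[OF f] L2_fun_measurable[OF g]])
    show "continuous_on UNIV (\<lambda>z :: (complex ^ 's) \<times> (complex ^ 's). cdot (fst z) (snd z))"
      by (intro bounded_bilinear.continuous_on[OF bounded_bilinear_cdot] continuous_intros)
  qed
  have "cmod (cdot (f x) (g x)) \<le> (norm (f x))\<^sup>2 + (norm (g x))\<^sup>2" for x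
    using norm_cdot_le[of "f x" "g x"] sum_squares_bound[of "norm (f x)" "norm (g x)"]
      mult_nonneg_nonneg[OF norm_ge_zero norm_ge_zero, of "f x" "g x"] by linarith
  then show "AE x in Leb a b. norm (cdot (f x) (g x)) \<le> norm ((norm (f x))\<^sup>2 + (norm (g x))\<^sup>2)" by simp
qed

lemma ip_add_left: "\<lbrakk>f \<in> L2_fun a b; g \<in> L2_fun a b; h \<in> L2_fun a b\<rbrakk> \<Longrightarrow>
    ip a b (\<lambda>x. f x + g x) h = ip a b f h + ip a b g h"
  by (simp add: ip_def cdot_add_left integrable_cdot)
lemma ip_add_right: "\<lbrakk>f \<in> L2_fun a b; g \<in> L2_fun a b; h \<in> L2_fun a b\<rbrakk> \<Longrightarrow>
    ip a b h (\<lambda>x. f x + g x) = ip a b h f + ip a b h g"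
  by (simp add: ip_def cdot_add_right integrable_cdot)
lemma ip_diff_left: "\<lbrakk>f \<in> L2_fun a b; g \<in> L2_fun a b; h \<in> L2_fun a b\<rbrakk> \<Longrightarrow>
    ip a b (\<lambda>x. f x - g x) h = ip a b f h - ip a b g h"
  by (simp add: ip_def cdot_diff_left integrable_cdot)
lemma ip_diff_right: "\<lbrakk>f \<in> L2_fun a b; g \<in> L2_fun a b; h \<in> L2_fun a b\<rbrakk> \<Longrightarrow>
    ip a b h (\<lambda>x. f x - g x) = ip a b h f - ip a b h g"
  by (simp add: ip_def cdot_diff_right integrable_cdot)
lemma ip_scale_left: "ip a b (\<lambda>x. c *s f x) h = c * ip a b f h"
  by (simp add: ip_def cdot_scale_left)
lemma ip_scale_right: "ip a b h (\<lambda>x. c *s f x) = cnj c * ip a b h f"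
  by (simp add: ip_def cdot_scale_right)
lemma ip_commute: "ip a b g f = cnj (ip a b f g)"
  unfolding ip_def by (subst cdot_commute) (simp add: integral_cnj)
lemma ip_sum_left: "\<lbrakk>\<And>i. i \<in> I \<Longrightarrow> f i \<in> L2_fun a b; h \<in> L2_fun a b\<rbrakk> \<Longrightarrow>
    ip a b (\<lambda>x. \<Sum>i\<in>I. f i x) h = (\<Sum>i\<in>I. ip a b (f i) h)"
  unfolding ip_def cdot_sum_left by (intro Bochner_Integration.integral_sum) (simp add: integrable_cdot)

lemma ip_self: "ip a b f f = complex_of_real (sqnorm a b f)"
  unfolding ip_def sqnorm_def cdot_self by (rule integral_complex_of_real)

lemma sqnorm_nonneg: "sqnorm a b f \<ge> 0" by (simp add: sqnorm_def)

lemma sqnorm_0_imp_AE: "\<lbrakk>f \<in> L2_fun a b; sqnorm a b f = 0\<rbrakk> \<Longrightarrow> AE x in Leb a b. f x = 0"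
  unfolding sqnorm_def by (subst (asm) integral_nonneg_eq_0_iff_AE) (auto simp: L2_fun_def)

lemma ip_cong_AE:
  assumes "f \<in> L2_fun a b" "g \<in> L2_fun a b" "f' \<in> L2_fun a b" "g' \<in> L2_fun a b"
    "AE x in Leb a b. f x = f' x" "AE x in Leb a b. g x = g' x"
  shows "ip a b f g = ip a b f' g'"
  unfolding ip_def using assms
  by (intro integral_cong_AE borel_measurable_integrable integrable_cdot) auto

lemma sqnorm_add_scale:
  assumes "f \<in> L2_fun a b" "g \<in> L2_fun a b"
  shows "sqnorm a b (\<lambda>x. f x + c *s g x) = sqnorm a b f + 2 * Re (cnj c * ip a b f g) + (cmod c)\<^sup>2 * sqnorm a b g"
proof -
  have cg: "(\<lambda>x. c *s g x) \<in> L2_fun a b" by (rule L2_fun_scale[OF assms(2)])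
  have "ip a b (\<lambda>x. f x + c *s g x) (\<lambda>x. f x + c *s g x) =
    ip a b f f + cnj c * ip a b f g + c * ip a b g f + c * cnj c * ip a b g g"
    using assms cg L2_fun_add[OF assms(1) cg]
    by (simp add: ip_add_left ip_add_right ip_scale_left ip_scale_right algebra_simps)
  then have "Re (ip a b (\<lambda>x. f x + c *s g x) (\<lambda>x. f x + c *s g x)) =
    Re (ip a b f f) + Re (cnj c * ip a b f g) + Re (cnj (cnj c * ip a b f g)) + Re (c * cnj c * ip a b g g)"
    by (simp add: ip_commute[of a b g f])
  moreover have "Re (c * cnj c * ip a b g g) = (cmod c)\<^sup>2 * sqnorm a b g"
    by (simp add: ip_self complex_norm_square[symmetric] flip: of_real_power of_real_mult)
  ultimately show ?thesis by (simp add: ip_self)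
qed

lemma ip_Cauchy_Schwarz:
  assumes "f \<in> L2_fun a b" "g \<in> L2_fun a b"
  shows "(cmod (ip a b f g))\<^sup>2 \<le> sqnorm a b f * sqnorm a b g"
proof (rule quadratic_form_bound)
  show "0 \<le> sqnorm a b f + 2 * Re (cnj c * ip a b f g) + (cmod c)\<^sup>2 * sqnorm a b g" for c
    using sqnorm_nonneg[of a b "\<lambda>x. f x + c *s g x"] unfolding sqnorm_add_scale[OF assms] .
qed (rule sqnorm_nonneg)

lemma sqnorm_parallelogram:
  assumes f: "f \<in> L2_fun a b" and g: "g \<in> L2_fun a b"
  shows "sqnorm a b (\<lambda>x. f x - g x) = 2 * sqnorm a b f + 2 * sqnorm a b g - sqnorm a b (\<lambda>x. f x + g x)"
  using sqnorm_add_scale[OF assms, of 1] sqnorm_add_scale[OF assms, of "-1"] by simp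

lemma finite_measure_Leb: "finite_measure (Leb a b)"
  using emeasure_bounded_finite[of "{a<..<b}"]
  by (intro finite_measureI) (auto simp: emeasure_restrict_space)

lemma sqnorm_scale: "sqnorm a b (\<lambda>x. c *s f x) = (cmod c)\<^sup>2 * sqnorm a b f"
  by (simp add: sqnorm_def norm_cscale power_mult_distrib)

section \<open>Completeness and density\<close>

text \<open>The Riesz-Fischer theorem, for sequences with a geometric Cauchy rate. The rate makes the norms of
  consecutive differences summable almost everywhere; Fatou's lemma gives convergence in mean
  square.\<close>

lemma L2_fun_complete:
  fixes y :: "nat \<Rightarrow> real \<Rightarrow> complex ^ 's::finite"
  assumes y: "\<And>n. y n \<in> L2_fun a b"
    and cau: "\<And>n m. n \<le> m \<Longrightarrow> sqnorm a b (\<lambda>x. y n x - y m x) \<le> C / 4 ^ n"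
  obtains g where "g \<in> L2_fun a b" "\<And>n. sqnorm a b (\<lambda>x. y n x - g x) \<le> C / 4 ^ n"
proof -
  interpret finite_measure "Leb a b" by (rule finite_measure_Leb)
  have C: "C \<ge> 0" using cau[of 0 0] sqnorm_nonneg by (simp add: sqnorm_def)
  have yd: "(\<lambda>x. y n x - y m x) \<in> L2_fun a b" for n m by (intro L2_fun_diff y)
  define L where "L = measure (Leb a b) (space (Leb a b))"
  have "L \<ge> 0" by (simp add: L_def)
  let ?d = "\<lambda>n x. norm (y n x - y (Suc n) x)"
  have dm: "?d n \<in> borel_measurable (Leb a b)" for n
    by (rule measurable_compose[OF L2_fun_measurable[OF yd] borel_measurable_norm])
  have d: "(\<integral>\<^sup>+x. ennreal (?d n x) \<partial>Leb a b) \<le> ennreal ((C + L) * (1/2) ^ n)" for n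
  proof -
    have int: "integrable (Leb a b) (\<lambda>x. 2 ^ n * (?d n x)\<^sup>2 + (1/2) ^ n)"
      using yd[of n "Suc n"] by (intro Bochner_Integration.integrable_add integrable_mult_right) (auto simp: L2_fun_def)
    \<comment> \<open>This pointwise bound replaces the Cauchy-Schwarz inequality on the interval.\<close>
    have le: "?d n x \<le> 2 ^ n * (?d n x)\<^sup>2 + (1/2) ^ n" for x
    proof -
      let ?t = "?d n x"
      have "0 \<le> (2 ^ n * ?t - 1)\<^sup>2" by simp
      then have "2 * (2 ^ n * ?t) \<le> (2 ^ n * ?t)\<^sup>2 + 1" by (simp add: power2_diff)
      moreover have "0 \<le> 2 ^ n * ?t" by simp
      ultimately have "2 ^ n * ?t \<le> (2 ^ n * ?t)\<^sup>2 + 1" by linarith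
      also have "\<dots> = 2 ^ n * (2 ^ n * ?t\<^sup>2 + (1/2) ^ n)"
        by (simp add: power2_eq_square algebra_simps power_one_over)
      finally show ?thesis by (subst (asm) mult_le_cancel_left_pos) auto
    qed
    have "(\<integral>\<^sup>+x. ennreal (?d n x) \<partial>Leb a b) \<le> (\<integral>\<^sup>+x. ennreal (2 ^ n * (?d n x)\<^sup>2 + (1/2) ^ n) \<partial>Leb a b)"
      by (intro nn_integral_mono ennreal_leI le)
    also have "\<dots> = ennreal (LINT x|Leb a b. 2 ^ n * (?d n x)\<^sup>2 + (1/2) ^ n)"
      by (rule nn_integral_eq_integral[OF int]) simp
    also have "(LINT x|Leb a b. 2 ^ n * (?d n x)\<^sup>2 + (1/2) ^ n) = 2 ^ n * sqnorm a b (\<lambda>x. y n x - y (Suc n) x) + (1/2) ^ n * L"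
      unfolding sqnorm_def L_def using yd[of n "Suc n"]
      by (subst Bochner_Integration.integral_add) (auto simp: L2_fun_def)
    also have "\<dots> \<le> 2 ^ n * (C / 4 ^ n) + (1/2) ^ n * L"
      using cau[of n "Suc n"] by (intro add_right_mono mult_left_mono) auto
    also have "\<dots> = (C + L) * (1/2) ^ n"
      by (simp add: field_simps power_one_over flip: power_mult_distrib)
    finally show ?thesis by (simp add: ennreal_leI)
  qed
  have "(\<integral>\<^sup>+x. (\<Sum>n. ennreal (?d n x)) \<partial>Leb a b) = (\<Sum>n. \<integral>\<^sup>+x. ennreal (?d n x) \<partial>Leb a b)"
    using dm by (intro nn_integral_suminf) auto
  also have "\<dots> \<le> (\<Sum>n. ennreal ((C + L) * (1/2) ^ n))"
    by (intro suminf_le d) auto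
  also have "\<dots> = ennreal (\<Sum>n. (C + L) * (1/2) ^ n)"
    using C \<open>L \<ge> 0\<close> by (intro suminf_ennreal2 summable_mult summable_geometric) auto
  finally have "(\<integral>\<^sup>+x. (\<Sum>n. ennreal (?d n x)) \<partial>Leb a b) \<noteq> \<infinity>"
    by (metis ennreal_neq_top infinity_ennreal_def neq_top_trans)
  then have "AE x in Leb a b. (\<Sum>n. ennreal (?d n x)) \<noteq> \<infinity>"
    using dm by (intro nn_integral_PInf_AE) auto
  then have conv: "AE x in Leb a b. convergent (\<lambda>n. y n x)"
  proof eventually_elim
    fix x assume "(\<Sum>n. ennreal (?d n x)) \<noteq> \<infinity>"
    then have "summable (\<lambda>n. ?d n x)" by (intro summable_suminf_not_top) auto
    then have "summable (\<lambda>n. y n x - y (Suc n) x)" by (rule summable_norm_cancel)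
    then have "convergent (\<lambda>n. \<Sum>k<n. y k x - y (Suc k) x)" by (simp add: summable_iff_convergent)
    then have "convergent (\<lambda>n. y 0 x - (\<Sum>k<n. y k x - y (Suc k) x))"
      by (intro convergent_diff convergent_const)
    moreover have "(\<Sum>k<n. y k x - y (Suc k) x) = y 0 x - y n x" for n
      by (rule sum_lessThan_telescope'[of "\<lambda>k. y k x" n])
    ultimately show "convergent (\<lambda>n. y n x)" by (simp only:) simp
  qed
  define g where "g = (\<lambda>x. lim (\<lambda>n. y n x))"
  have gm: "g \<in> borel_measurable (Leb a b)"
    unfolding g_def using y by (intro borel_measurable_lim_metric L2_fun_measurable)
  have ygm: "(\<lambda>x. y n x - g x) \<in> borel_measurable (Leb a b)" for n
    by (intro borel_measurable_diff gm L2_fun_measurable[OF y])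
  have bd: "(\<integral>\<^sup>+x. ennreal ((norm (y n x - g x))\<^sup>2) \<partial>Leb a b) \<le> ennreal (C / 4 ^ n)" for n
  proof -
    have "(\<integral>\<^sup>+x. ennreal ((norm (y n x - g x))\<^sup>2) \<partial>Leb a b) =
      (\<integral>\<^sup>+x. liminf (\<lambda>m. ennreal ((norm (y n x - y m x))\<^sup>2)) \<partial>Leb a b)"
    proof (rule nn_integral_cong_AE, use conv in eventually_elim)
      fix x assume "convergent (\<lambda>n. y n x)"
      then have "(\<lambda>m. y m x) \<longlonglongrightarrow> g x" by (simp add: g_def convergent_LIMSEQ_iff)
      then have "(\<lambda>m. ennreal ((norm (y n x - y m x))\<^sup>2)) \<longlonglongrightarrow> ennreal ((norm (y n x - g x))\<^sup>2)"
        by (intro tendsto_intros)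
      then show "ennreal ((norm (y n x - g x))\<^sup>2) = liminf (\<lambda>m. ennreal ((norm (y n x - y m x))\<^sup>2))"
        by (intro lim_imp_Liminf[symmetric]) auto
    qed
    also have "\<dots> \<le> liminf (\<lambda>m. \<integral>\<^sup>+x. ennreal ((norm (y n x - y m x))\<^sup>2) \<partial>Leb a b)"
      by (intro nn_integral_liminf measurable_compose[OF _ measurable_ennreal] borel_measurable_power
        measurable_compose[OF L2_fun_measurable[OF yd] borel_measurable_norm])
    also have "\<dots> \<le> ennreal (C / 4 ^ n)"
    proof (rule Liminf_le)
      show "\<forall>\<^sub>F m in sequentially. (\<integral>\<^sup>+x. ennreal ((norm (y n x - y m x))\<^sup>2) \<partial>Leb a b) \<le> ennreal (C / 4 ^ n)"
      proof (rule eventually_sequentiallyI)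
        fix m assume "n \<le> m"
        have "(\<integral>\<^sup>+x. ennreal ((norm (y n x - y m x))\<^sup>2) \<partial>Leb a b) = ennreal (sqnorm a b (\<lambda>x. y n x - y m x))"
          unfolding sqnorm_def using yd[of n m] by (intro nn_integral_eq_integral) (auto simp: L2_fun_def)
        also have "\<dots> \<le> ennreal (C / 4 ^ n)" by (intro ennreal_leI cau \<open>n \<le> m\<close>)
        finally show "(\<integral>\<^sup>+x. ennreal ((norm (y n x - y m x))\<^sup>2) \<partial>Leb a b) \<le> ennreal (C / 4 ^ n)" .
      qed
    qed simp
    finally show ?thesis .
  qed
  have ygL: "(\<lambda>x. y n x - g x) \<in> L2_fun a b" for n
    unfolding L2_fun_def mem_Collect_eq
  proof (intro conjI ygm integrableI_bounded)
    show "(\<lambda>x. (norm (y n x - g x))\<^sup>2) \<in> borel_measurable (Leb a b)"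
      by (intro borel_measurable_power measurable_compose[OF ygm borel_measurable_norm])
    show "(\<integral>\<^sup>+x. ennreal (norm ((norm (y n x - g x))\<^sup>2)) \<partial>Leb a b) < \<infinity>"
      using le_less_trans[OF bd[of n] ennreal_less_top] by simp
  qed
  show ?thesis
  proof
    have "(\<lambda>x. y 0 x - (y 0 x - g x)) \<in> L2_fun a b" by (intro L2_fun_diff y ygL)
    then show "g \<in> L2_fun a b" by simp
    fix n
    have "ennreal (sqnorm a b (\<lambda>x. y n x - g x)) \<le> ennreal (C / 4 ^ n)"
      using bd[of n] unfolding sqnorm_def
      by (subst nn_integral_eq_integral[symmetric]) (use ygL[of n] in \<open>auto simp: L2_fun_def\<close>)
    then show "sqnorm a b (\<lambda>x. y n x - g x) \<le> C / 4 ^ n" using C by (simp add: ennreal_le_iff)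
  qed
qed

text \<open>A minimizing sequence for the distance from \<^term>\<open>f\<close> to \<^term>\<open>D\<close> is a Cauchy sequence by the
  parallelogram identity; the difference between \<^term>\<open>f\<close> and its limit is orthogonal to \<^term>\<open>D\<close>.\<close>

lemma L2_dense_if_orthogonal_trivial:
  fixes D :: "(real \<Rightarrow> complex ^ 's::finite) set"
  assumes D: "D \<subseteq> L2_fun a b" and D0: "(\<lambda>_. 0) \<in> D"
    and Dadd: "\<And>f g c. \<lbrakk>f \<in> D; g \<in> D\<rbrakk> \<Longrightarrow> (\<lambda>x. f x + c *s g x) \<in> D"
    and orth: "\<And>h. \<lbrakk>h \<in> L2_fun a b; \<And>y. y \<in> D \<Longrightarrow> ip a b y h = 0\<rbrakk> \<Longrightarrow> AE x in Leb a b. h x = 0"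
    and f: "f \<in> L2_fun a b" and "\<epsilon> > 0"
  obtains y where "y \<in> D" "sqnorm a b (\<lambda>x. f x - y x) < \<epsilon>"
proof -
  define S where "S = (\<lambda>y. sqnorm a b (\<lambda>x. f x - y x)) ` D"
  define d where "d = Inf S"
  have bdd: "bdd_below S" unfolding S_def by (rule bdd_belowI2[of _ 0]) (rule sqnorm_nonneg)
  have ne: "S \<noteq> {}" using D0 by (auto simp: S_def)
  have dle: "d \<le> sqnorm a b (\<lambda>x. f x - y x)" if "y \<in> D" for y
    unfolding d_def using that bdd by (intro cInf_lower) (auto simp: S_def)
  have "\<exists>y. y \<in> D \<and> sqnorm a b (\<lambda>x. f x - y x) < d + 1 / 4 ^ n" for n :: nat
  proof -
    have "\<exists>s\<in>S. s < d + 1 / 4 ^ n"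
      using cInf_less_iff[OF ne bdd, of "d + 1 / 4 ^ n"] by (simp add: d_def)
    then show ?thesis by (auto simp: S_def)
  qed
  then obtain y where yD: "\<And>n::nat. y n \<in> D" and yd: "\<And>n. sqnorm a b (\<lambda>x. f x - y n x) < d + 1 / 4 ^ n"
    by metis
  have yL: "y n \<in> L2_fun a b" for n using yD D by auto
  have fy: "(\<lambda>x. f x - y n x) \<in> L2_fun a b" for n by (intro L2_fun_diff f yL)
  have cau: "sqnorm a b (\<lambda>x. y n x - y m x) \<le> 4 / 4 ^ n" if "n \<le> m" for n m
  proof -
    let ?w = "\<lambda>x. (0 + (1/2) *s y n x) + (1/2) *s y m x"
    have "?w \<in> D" using Dadd[OF Dadd[OF D0 yD] yD, of "1/2" n "1/2" m] by simp
    then have "d \<le> sqnorm a b (\<lambda>x. f x - ?w x)" by (rule dle)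
    moreover have "(\<lambda>x. (f x - y n x) + (f x - y m x)) = (\<lambda>x. 2 *s (f x - ?w x))"
      by (auto simp: vec_eq_iff algebra_simps)
    ultimately have 1: "4 * d \<le> sqnorm a b (\<lambda>x. (f x - y n x) + (f x - y m x))"
      by (simp only: sqnorm_scale) simp
    have "sqnorm a b (\<lambda>x. y n x - y m x) = sqnorm a b (\<lambda>x. (f x - y m x) - (f x - y n x))" by (simp add: sqnorm_def)
    also have "\<dots> = 2 * sqnorm a b (\<lambda>x. f x - y m x) + 2 * sqnorm a b (\<lambda>x. f x - y n x) -
       sqnorm a b (\<lambda>x. (f x - y m x) + (f x - y n x))" by (rule sqnorm_parallelogram[OF fy fy])
    also have "\<dots> \<le> 2 * (d + 1 / 4 ^ m) + 2 * (d + 1 / 4 ^ n) - 4 * d"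
      using yd[of n] yd[of m] 1 by (simp add: add.commute)
    also have "\<dots> = 2 / 4 ^ m + 2 / 4 ^ n" by simp
    also have "\<dots> \<le> 2 / 4 ^ n + 2 / 4 ^ n"
      using that by (intro add_right_mono divide_left_mono power_increasing) auto
    finally show ?thesis by simp
  qed
  obtain g where g: "g \<in> L2_fun a b" "\<And>n. sqnorm a b (\<lambda>x. y n x - g x) \<le> 4 / 4 ^ n"
    using L2_fun_complete[OF yL cau] by blast
  have fg: "(\<lambda>x. f x - g x) \<in> L2_fun a b" by (intro L2_fun_diff f g)
  have lim: "(\<lambda>n. K / 4 ^ n) \<longlonglongrightarrow> 0" for K :: real
    using tendsto_mult_right_zero[OF LIMSEQ_power_zero[of "1/4::real"], of K] by (simp add: power_one_over)
  have sq0: "z \<longlonglongrightarrow> 0" if "(\<lambda>n. (cmod (z n))\<^sup>2) \<longlonglongrightarrow> 0" for z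
    using tendsto_real_sqrt[OF that] by (intro tendsto_norm_zero_cancel[of z]) simp
  have "ip a b z (\<lambda>x. f x - g x) = 0" if z: "z \<in> D" for z
  proof -
    have zL: "z \<in> L2_fun a b" using z D by auto
    have ygn: "(\<lambda>x. y n x - g x) \<in> L2_fun a b" for n by (intro L2_fun_diff yL g)
    have 1: "(cmod (ip a b (\<lambda>x. f x - y n x) z))\<^sup>2 \<le> (1 / 4 ^ n) * sqnorm a b z" for n
    proof (rule quadratic_form_bound)
      fix c
      have "(\<lambda>x. y n x + (- c) *s z x) \<in> D" by (rule Dadd[OF yD z])
      then have "d \<le> sqnorm a b (\<lambda>x. f x - (y n x + (- c) *s z x))" by (rule dle)
      also have "(\<lambda>x. f x - (y n x + (- c) *s z x)) = (\<lambda>x. (f x - y n x) + c *s z x)"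
        by (auto simp: vec_eq_iff algebra_simps)
      also have "sqnorm a b \<dots> = sqnorm a b (\<lambda>x. f x - y n x) + 2 * Re (cnj c * ip a b (\<lambda>x. f x - y n x) z)
          + (cmod c)\<^sup>2 * sqnorm a b z" by (rule sqnorm_add_scale[OF fy zL])
      finally show "0 \<le> 1 / 4 ^ n + 2 * Re (cnj c * ip a b (\<lambda>x. f x - y n x) z) + (cmod c)\<^sup>2 * sqnorm a b z"
        using yd[of n] by linarith
    qed (rule sqnorm_nonneg)
    have 2: "(cmod (ip a b (\<lambda>x. y n x - g x) z))\<^sup>2 \<le> (4 / 4 ^ n) * sqnorm a b z" for n
      using ip_Cauchy_Schwarz[OF ygn zL, of n] mult_right_mono[OF g(2) sqnorm_nonneg, of n a b z] by linarith
    have "(\<lambda>n. (cmod (ip a b (\<lambda>x. f x - y n x) z))\<^sup>2) \<longlonglongrightarrow> 0"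
      by (rule tendsto_sandwich[OF _ _ tendsto_const lim[of "sqnorm a b z"]]) (use 1 in auto)
    then have l1: "(\<lambda>n. ip a b (\<lambda>x. f x - y n x) z) \<longlonglongrightarrow> 0"
      by (rule sq0)
    have "(\<lambda>n. (cmod (ip a b (\<lambda>x. y n x - g x) z))\<^sup>2) \<longlonglongrightarrow> 0"
      by (rule tendsto_sandwich[OF _ _ tendsto_const lim[of "4 * sqnorm a b z"]]) (use 2 in auto)
    then have l2: "(\<lambda>n. ip a b (\<lambda>x. y n x - g x) z) \<longlonglongrightarrow> 0"
      by (rule sq0)
    have "ip a b (\<lambda>x. f x - g x) z = ip a b (\<lambda>x. f x - y n x) z + ip a b (\<lambda>x. y n x - g x) z" for n
      using ip_add_left[OF fy ygn zL, of n n] by simp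
    moreover have "(\<lambda>n. ip a b (\<lambda>x. f x - y n x) z + ip a b (\<lambda>x. y n x - g x) z) \<longlonglongrightarrow> 0 + 0"
      by (intro tendsto_add l1 l2)
    ultimately have "ip a b (\<lambda>x. f x - g x) z = 0"
      by (simp add: LIMSEQ_const_iff)
    then show ?thesis using ip_commute[of a b z "\<lambda>x. f x - g x"] by simp
  qed
  then have AE: "AE x in Leb a b. f x - g x = 0" by (intro orth fg)
  obtain n :: nat where n: "4 / 4 ^ n < \<epsilon>"
    using order_tendstoD(2)[OF lim[of 4] \<open>\<epsilon> > 0\<close>] by (auto simp: eventually_sequentially)
  have "sqnorm a b (\<lambda>x. f x - y n x) = sqnorm a b (\<lambda>x. y n x - g x)"
    unfolding sqnorm_def
  proof (rule integral_cong_AE)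
    show "AE x in Leb a b. (norm (f x - y n x))\<^sup>2 = (norm (y n x - g x))\<^sup>2"
      using AE by eventually_elim (auto simp: norm_minus_commute)
    show "(\<lambda>x. (norm (f x - y n x))\<^sup>2) \<in> borel_measurable (Leb a b)"
      "(\<lambda>x. (norm (y n x - g x))\<^sup>2) \<in> borel_measurable (Leb a b)"
      using fy[of n] L2_fun_diff[OF yL g(1), of n] by (auto simp: L2_fun_def)
  qed
  then show ?thesis using that[OF yD, of n] g(2)[of n] n by simp
qed

section \<open>The Hilbert space in terms of representatives\<close>

lemma L2_fun_cong_AE:
  assumes f: "f \<in> L2_fun a b" and ae: "AE x in Leb a b. f x = g x"
  shows "g \<in> L2_fun a b"
proof -
  have "(\<lambda>x. if x \<in> {a<..<b} then f x else 0) \<in> borel_measurable lebesgue"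
    by (intro borel_measurable_if_I L2_fun_measurable f) simp
  moreover have "AE x in lebesgue. (if x \<in> {a<..<b} then f x else 0) = (if x \<in> {a<..<b} then g x else 0)"
    using ae by (subst (asm) AE_restrict_space_iff) auto
  ultimately have "(\<lambda>x. if x \<in> {a<..<b} then g x else 0) \<in> borel_measurable lebesgue"
    by (rule borel_measurable_AE)
  then have gm: "g \<in> borel_measurable (Leb a b)" by (rule borel_measurable_if_D)
  show ?thesis
  proof (rule L2_fun_I[OF gm])
    show "integrable (Leb a b) (\<lambda>x. (norm (f x))\<^sup>2)" using f by (simp add: L2_fun_def)
    show "AE x in Leb a b. (norm (g x))\<^sup>2 \<le> (norm (f x))\<^sup>2" using ae by eventually_elim simp
  qed
qed

lemma equiv_L2_eq: "equiv (L2_fun a b) (L2_eq a b)"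
proof (rule equivI)
  show "L2_eq a b \<subseteq> L2_fun a b \<times> L2_fun a b" by (auto simp: L2_eq_def)
  show "refl_on (L2_fun a b) (L2_eq a b)" by (rule refl_onI) (auto simp: L2_eq_def)
  show "sym (L2_eq a b)" by (rule symI) (auto simp: L2_eq_def elim: eventually_mono)
  show "trans (L2_eq a b)"
  proof (rule transI)
    fix f g h
    assume "(f, g) \<in> L2_eq a b" "(g, h) \<in> L2_eq a b"
    then have "f \<in> L2_fun a b" "h \<in> L2_fun a b" "AE x in Leb a b. f x = g x" "AE x in Leb a b. g x = h x"
      by (auto simp: L2_eq_def)
    moreover from this(3,4) have "AE x in Leb a b. f x = h x" by eventually_elim simp
    ultimately show "(f, h) \<in> L2_eq a b" by (simp add: L2_eq_def)
  qed
qed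

lemma L2_class_in_L2: "f \<in> L2_fun a b \<Longrightarrow> L2_class a b f \<in> L2 a b"
  by (simp add: L2_class_def L2_def quotientI)

lemma L2_class_eq_iff:
  "\<lbrakk>f \<in> L2_fun a b; g \<in> L2_fun a b\<rbrakk> \<Longrightarrow> L2_class a b f = L2_class a b g \<longleftrightarrow> (AE x in Leb a b. f x = g x)"
  unfolding L2_class_def using eq_equiv_class_iff[OF equiv_L2_eq, of f a b g] by (auto simp: L2_eq_def)

lemma L2_rep_props:
  assumes "u \<in> L2 a b"
  shows "L2_rep u \<in> L2_fun a b" "L2_class a b (L2_rep u) = u"
proof -
  obtain f where f: "f \<in> L2_fun a b" "u = L2_eq a b `` {f}" using assms unfolding L2_def by (elim quotientE)
  then have "f \<in> u" by (auto simp: L2_eq_def)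
  then have r: "L2_rep u \<in> u" unfolding L2_rep_def by (rule someI[where P = "\<lambda>f. f \<in> u"])
  then have "(f, L2_rep u) \<in> L2_eq a b" using f by auto
  then show "L2_rep u \<in> L2_fun a b" "L2_class a b (L2_rep u) = u"
    using equiv_class_eq[OF equiv_L2_eq] f by (auto simp: L2_eq_def L2_class_def)
qed

lemma L2_cases:
  assumes "u \<in> L2 a b"
  obtains f where "f \<in> L2_fun a b" "u = L2_class a b f"
  using L2_rep_props[OF assms] by metis

lemma L2_rep_class:
  assumes "f \<in> L2_fun a b"
  shows "L2_rep (L2_class a b f) \<in> L2_fun a b" "AE x in Leb a b. L2_rep (L2_class a b f) x = f x"
  using L2_rep_props[OF L2_class_in_L2[OF assms]] L2_class_eq_iff[OF _ assms] by auto

lemma L2_inner_class: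
  "\<lbrakk>f \<in> L2_fun a b; g \<in> L2_fun a b\<rbrakk> \<Longrightarrow> L2_inner a b (L2_class a b f) (L2_class a b g) = ip a b f g"
  unfolding L2_inner_def ip_def[symmetric]
  by (rule ip_cong_AE) (simp_all add: L2_rep_class)

lemma L2_add_class:
  assumes "f \<in> L2_fun a b" "g \<in> L2_fun a b"
  shows "L2_add a b (L2_class a b f) (L2_class a b g) = L2_class a b (\<lambda>x. f x + g x)"
  unfolding L2_add_def
proof (subst L2_class_eq_iff)
  show "AE x in Leb a b. L2_rep (L2_class a b f) x + L2_rep (L2_class a b g) x = f x + g x"
    using L2_rep_class(2)[OF assms(1)] L2_rep_class(2)[OF assms(2)] by eventually_elim simp
qed (intro L2_fun_add L2_rep_class assms)+

lemma L2_scale_class: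
  assumes "f \<in> L2_fun a b"
  shows "L2_scale a b c (L2_class a b f) = L2_class a b (\<lambda>x. c *s f x)"
  unfolding L2_scale_def
proof (subst L2_class_eq_iff)
  show "AE x in Leb a b. c *s L2_rep (L2_class a b f) x = c *s f x"
    using L2_rep_class(2)[OF assms] by eventually_elim simp
qed (intro L2_fun_scale L2_rep_class assms)+

lemma L2_norm_class: "f \<in> L2_fun a b \<Longrightarrow> L2_norm a b (L2_class a b f) = sqrt (sqnorm a b f)"
  by (simp add: L2_norm_def L2_inner_class ip_self)

section \<open>Dissipative extensions of symmetric operators\<close>

text \<open>Dissipative operators for \<open>\<sigma> = 1\<close> and accumulative ones for \<open>\<sigma> = - 1\<close>.\<close>

definition sdissipative :: "real \<Rightarrow> real \<Rightarrow> real \<Rightarrow> ('s::finite) l2_op \<Rightarrow> bool" where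
  "sdissipative \<sigma> a b T \<longleftrightarrow> linear_operator a b T \<and> densely_defined a b T \<and>
     (\<forall>(u, v)\<in>T. \<sigma> * Im (L2_inner a b v u) \<ge> 0)"

lemma sdissipative_1: "sdissipative 1 a b T \<longleftrightarrow> dissipative a b T"
  by (simp add: sdissipative_def dissipative_def)
lemma sdissipative_m1: "sdissipative (-1) a b T \<longleftrightarrow> accumulative a b T"
  by (simp add: sdissipative_def accumulative_def)

lemma linear_operatorD:
  assumes "linear_operator a b T"
  shows "T \<subseteq> L2 a b \<times> L2 a b" "single_valued T"
    "\<And>f g f' g' c. \<lbrakk>f \<in> L2_fun a b; g \<in> L2_fun a b; f' \<in> L2_fun a b; g' \<in> L2_fun a b;
       (L2_class a b f, L2_class a b g) \<in> T; (L2_class a b f', L2_class a b g') \<in> T\<rbrakk> \<Longrightarrow>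
      (L2_class a b (\<lambda>x. f x + c *s f' x), L2_class a b (\<lambda>x. g x + c *s g' x)) \<in> T"
proof -
  show "T \<subseteq> L2 a b \<times> L2 a b" "single_valued T" using assms by (auto simp: linear_operator_def)
  fix f g f' g' c
  assume L: "f \<in> L2_fun a b" "g \<in> L2_fun a b" "f' \<in> L2_fun a b" "g' \<in> L2_fun a b"
    and T: "(L2_class a b f, L2_class a b g) \<in> T" "(L2_class a b f', L2_class a b g') \<in> T"
  have "(L2_scale a b c (L2_class a b f'), L2_scale a b c (L2_class a b g')) \<in> T"
    using assms T(2) unfolding linear_operator_def by blast
  then have "(L2_add a b (L2_class a b f) (L2_scale a b c (L2_class a b f')),
     L2_add a b (L2_class a b g) (L2_scale a b c (L2_class a b g'))) \<in> T"
    using assms T(1) unfolding linear_operator_def by blast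
  then show "(L2_class a b (\<lambda>x. f x + c *s f' x), L2_class a b (\<lambda>x. g x + c *s g' x)) \<in> T"
    using L by (simp add: L2_add_class L2_scale_class L2_fun_scale)
qed

text \<open>If \<open>(u, v)\<close> belongs to the dissipative extension and \<open>(u', v')\<close> to the symmetric operator, then the
  dissipativity inequality at \<open>u + c u'\<close> is affine in \<open>c\<close>, because its quadratic part vanishes. Hence
  the linear part vanishes too, which is the defining equation of the adjoint.\<close>

lemma sdissipative_extension_subset_adjoint:
  assumes T': "sdissipative \<sigma> a b T'" and sub: "T \<subseteq> T'" and \<sigma>: "\<sigma> \<noteq> 0"
    and sym: "\<And>u v. (u, v) \<in> T \<Longrightarrow> Im (L2_inner a b v u) = 0"
  shows "T' \<subseteq> L2_adjoint a b T"
proof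
  fix uv assume uv: "uv \<in> T'"
  have lin: "linear_operator a b T'" using T' by (simp add: sdissipative_def)
  note sub' = linear_operatorD(1)[OF lin]
  obtain f g where fg: "f \<in> L2_fun a b" "g \<in> L2_fun a b" "uv = (L2_class a b f, L2_class a b g)"
  proof -
    obtain u v where "uv = (u, v)" "u \<in> L2 a b" "v \<in> L2 a b" using uv sub' by blast
    then show ?thesis using that by (elim L2_cases) blast
  qed
  have "L2_inner a b v' (L2_class a b f) = L2_inner a b u' (L2_class a b g)" if T: "(u', v') \<in> T" for u' v'
  proof -
    obtain f' g' where fg': "f' \<in> L2_fun a b" "g' \<in> L2_fun a b" "u' = L2_class a b f'" "v' = L2_class a b g'"
    proof -
      have "u' \<in> L2 a b" "v' \<in> L2 a b" using T sub sub' by auto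
      then show ?thesis using that by (elim L2_cases) blast
    qed
    define z where "z = ip a b g f' - ip a b f g'"
    have "0 \<le> \<sigma> * Im (ip a b g f) + 2 * Re (cnj c * (- \<i> * of_real \<sigma> * z / 2)) + (cmod c)\<^sup>2 * 0" for c
    proof -
      have "(L2_class a b (\<lambda>x. f x + c *s f' x), L2_class a b (\<lambda>x. g x + c *s g' x)) \<in> T'"
        using linear_operatorD(3)[OF lin fg(1,2) fg'(1,2)] uv T sub unfolding fg(3) fg'(3,4) by blast
      then have "0 \<le> \<sigma> * Im (L2_inner a b (L2_class a b (\<lambda>x. g x + c *s g' x)) (L2_class a b (\<lambda>x. f x + c *s f' x)))"
        using T' unfolding sdissipative_def by blast
      also have "L2_inner a b (L2_class a b (\<lambda>x. g x + c *s g' x)) (L2_class a b (\<lambda>x. f x + c *s f' x))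
        = ip a b (\<lambda>x. g x + c *s g' x) (\<lambda>x. f x + c *s f' x)"
        using fg fg' by (intro L2_inner_class L2_fun_add L2_fun_scale)
      also have "\<dots> = ip a b g f + cnj c * ip a b g f' + c * ip a b g' f + (c * cnj c) * ip a b g' f'"
        using fg fg' by (simp add: ip_add_left ip_add_right ip_scale_left ip_scale_right L2_fun_add L2_fun_scale algebra_simps)
      also have "Im \<dots> = Im (ip a b g f) + Im (cnj c * ip a b g f') + Im (c * ip a b g' f) + Im ((c * cnj c) * ip a b g' f')"
        by (simp only: plus_complex.sel)
      also have "Im (c * ip a b g' f) = - Im (cnj c * ip a b f g')"
        by (subst ip_commute) (simp add: algebra_simps)
      also have "Im ((c * cnj c) * ip a b g' f') = 0"
        using sym[OF T] fg' by (simp add: L2_inner_class complex_mult_cnj)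
      finally show ?thesis by (simp add: z_def algebra_simps add_divide_distrib diff_divide_distrib)
    qed
    then have "(cmod (- \<i> * of_real \<sigma> * z / 2))\<^sup>2 \<le> (\<sigma> * Im (ip a b g f)) * 0"
      by (rule quadratic_form_bound) simp
    then have "z = 0" using \<sigma> by simp
    then have "ip a b f g' = ip a b g f'" by (simp add: z_def)
    then have "ip a b g' f = ip a b f' g" by (metis ip_commute)
    then show ?thesis using fg fg' by (simp add: L2_inner_class)
  qed
  then show "uv \<in> L2_adjoint a b T"
    using uv sub' by (auto simp: L2_adjoint_def fg(3))
qed

section \<open>Contractions of finite-dimensional spaces\<close>

lemma clinear_op_bounded_linear:
  fixes K :: "complex ^ 'n::finite \<Rightarrow> complex ^ 'n"
  assumes "clinear_op K"
  shows "bounded_linear K"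
proof -
  interpret Vector_Spaces.linear "(*s)" "(*s)" K by fact
  have "linear K" by (rule linearI) (simp_all add: add scale scaleR_eq_scale)
  then show ?thesis by (simp add: linear_conv_bounded_linear)
qed

lemma contracting_norm_le:
  "contracting K \<Longrightarrow> norm (K x) \<le> norm (x :: complex ^ 'n::finite)"
  using onorm[OF clinear_op_bounded_linear, of K x] mult_right_mono[of "onorm K" 1 "norm x"]
  by (force simp: contracting_def)

lemma contractingI:
  fixes K :: "complex ^ 'n::finite \<Rightarrow> complex ^ 'n"
  assumes "clinear_op K" "\<And>x. norm (K x) \<le> norm x"
  shows "contracting K"
  using assms onorm_le[of K 1] by (simp add: contracting_def)

lemma clinear_opI:
  fixes K :: "complex ^ 'n::finite \<Rightarrow> complex ^ 'm::finite"
  assumes "\<And>x y c. K (x + c *s y) = K x + c *s K y"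
  shows "Vector_Spaces.linear (*s) (*s) K"
proof -
  have 0: "K 0 = 0" using assms[of 0 "-1" 0] by (simp add: vec_eq_iff)
  have "K (x + y) = K x + K y" for x y using assms[of x 1 y] by simp
  moreover have "K (c *s x) = c *s K x" for c x using assms[of 0 c x] 0 by simp
  ultimately show ?thesis by unfold_locales
qed

text \<open>A norm-decreasing linear relation is the graph of a contraction on a subspace; composing it with
  the orthogonal projection onto the subspace gives a contraction of the whole space.\<close>

lemma contraction_extension:
  fixes R :: "((complex ^ 'n::finite) \<times> (complex ^ 'n)) set"
  assumes R0: "(0, 0) \<in> R" and Radd: "\<And>x y x' y' c. \<lbrakk>(x, y) \<in> R; (x', y') \<in> R\<rbrakk> \<Longrightarrow> (x + c *s x', y + c *s y') \<in> R"
    and Rle: "\<And>x y. (x, y) \<in> R \<Longrightarrow> norm y \<le> norm x"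
  obtains K where "contracting K" "\<And>x y. (x, y) \<in> R \<Longrightarrow> K x = y"
proof -
  define S where "S = Domain R"
  have Sadd: "x + c *s x' \<in> S" if "x \<in> S" "x' \<in> S" for x x' c
    using that Radd unfolding S_def by blast
  have S0: "0 \<in> S" using R0 by (auto simp: S_def)
  have "subspace S"
    using Sadd[of _ _ 1] Sadd[OF S0] S0 by (intro subspaceI) (auto simp: scaleR_eq_scale)
  then have span: "span S = S" by (simp add: span_eq_iff)
  have dec: "\<exists>s q y. x = s + q \<and> (s, y) \<in> R \<and> (\<forall>w\<in>S. cdot w q = 0)" for x
  proof -
    obtain s q where sq: "s \<in> S" "\<And>w. w \<in> S \<Longrightarrow> orthogonal q w" "x = s + q"
      using orthogonal_subspace_decomp_exists[of S x] unfolding span by blast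
    have "cdot w q = 0" if "w \<in> S" for w
    proof (rule complex_eqI)
      show "Re (cdot w q) = Re 0" using sq(2)[OF that] by (simp add: Re_cdot orthogonal_def inner_commute[of q])
      have "\<i> *s w \<in> S" using Sadd[OF S0 that, of \<i>] by simp
      then have "Re (cdot (\<i> *s w) q) = 0" using sq(2)[of "\<i> *s w"] by (simp add: Re_cdot orthogonal_def inner_commute[of q])
      then show "Im (cdot w q) = Im 0" by (simp add: cdot_scale_left)
    qed
    then show ?thesis using sq by (auto simp: S_def)
  qed
  \<comment> \<open>\<open>K x\<close> is the partner of the orthogonal projection \<open>s\<close> of \<open>x\<close> to the domain of the relation.\<close>
  define K where "K = (\<lambda>x. SOME y. \<exists>s q. x = s + q \<and> (s, y) \<in> R \<and> (\<forall>w\<in>S. cdot w q = 0))"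
  have Kex: "\<exists>s q. x = s + q \<and> (s, K x) \<in> R \<and> (\<forall>w\<in>S. cdot w q = 0)" for x
    unfolding K_def by (rule someI_ex) (use dec in blast)
  have zero: "y = 0" if "s + q = 0" "(s, y) \<in> R" "\<forall>w\<in>S. cdot w q = 0" for s q y
  proof -
    have "s \<in> S" using that by (auto simp: S_def)
    then have "cdot s (s + q) = cdot s s" unfolding cdot_add_right using that(3) by simp
    then have "s = 0" unfolding that(1) by (simp add: cdot_self)
    then show ?thesis using Rle[OF that(2)] by simp
  qed
  have Kuniq: "K x = y" if 1: "x = s + q" "(s, y) \<in> R" "\<forall>w\<in>S. cdot w q = 0" for x s q y
  proof -
    obtain s' q' where 2: "x = s' + q'" "(s', K x) \<in> R" "\<forall>w\<in>S. cdot w q' = 0" using Kex by blast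
    have "K x + (-1) *s y = 0"
    proof (rule zero)
      show "(s' + (-1) *s s, K x + (-1) *s y) \<in> R" by (rule Radd[OF 2(2) 1(2)])
      show "(s' + (-1) *s s) + (q' - q) = 0" using 1(1) 2(1) by (simp add: algebra_simps)
      show "\<forall>w\<in>S. cdot w (q' - q) = 0" using 1(3) 2(3) by (simp add: cdot_diff_right)
    qed
    then show ?thesis by simp
  qed
  show ?thesis
  proof
    show "K x = y" if "(x, y) \<in> R" for x y by (rule Kuniq[of x x 0]) (use that in auto)
    show "contracting K"
    proof (rule contractingI)
      show "clinear_op K"
      proof (rule clinear_opI)
        fix x y c
        obtain s q where 1: "x = s + q" "(s, K x) \<in> R" "\<forall>w\<in>S. cdot w q = 0" using Kex by blast
        obtain s' q' where 2: "y = s' + q'" "(s', K y) \<in> R" "\<forall>w\<in>S. cdot w q' = 0" using Kex by blast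
        show "K (x + c *s y) = K x + c *s K y"
        proof (rule Kuniq[of _ "s + c *s s'" "q + c *s q'"])
          show "x + c *s y = s + c *s s' + (q + c *s q')"
            unfolding 1(1) 2(1) by (simp add: vec_eq_iff algebra_simps)
          show "(s + c *s s', K x + c *s K y) \<in> R" by (rule Radd[OF 1(2) 2(2)])
          show "\<forall>w\<in>S. cdot w (q + c *s q') = 0" using 1(3) 2(3) by (simp add: cdot_simps)
        qed
      qed
      fix x
      obtain s q where 1: "x = s + q" "(s, K x) \<in> R" "\<forall>w\<in>S. cdot w q = 0" using Kex by blast
      have "s \<in> S" using 1 by (auto simp: S_def)
      then have "orthogonal s q" using 1(3) Re_cdot[of s q] by (simp add: orthogonal_def)
      then have "(norm x)\<^sup>2 = (norm s)\<^sup>2 + (norm q)\<^sup>2" unfolding 1(1) by (rule norm_add_Pythagorean)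
      then have "norm s \<le> norm x" by (simp add: power2_le_imp_le)
      then show "norm (K x) \<le> norm x" using Rle[OF 1(2)] by simp
    qed
  qed
qed

section \<open>Hermitian matrices\<close>

text \<open>The conjugate transpose, that is, the adjoint matrix for \<^term>\<open>cdot\<close>.\<close>

definition ctranspose :: "complex ^ 'n ^ 'm \<Rightarrow> complex ^ 'm ^ 'n" where
  "ctranspose A = (\<chi> i j. cnj (A $ j $ i))"

lemma hermitian_iff: "hermitian A \<longleftrightarrow> ctranspose A = A"
  unfolding hermitian_def ctranspose_def vec_eq_iff vec_lambda_beta by metis

lemma ctranspose_mult: "ctranspose (A ** B) = ctranspose B ** ctranspose A"
  by (simp add: ctranspose_def matrix_matrix_mult_def vec_eq_iff mult.commute)

lemma ctranspose_mat1: "ctranspose (mat 1) = mat 1"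
  by (auto simp: ctranspose_def mat_def vec_eq_iff)

lemma cdot_matrix: "cdot (A *v x) y = cdot x (ctranspose A *v y)"
proof -
  have "cdot (A *v x) y = (\<Sum>i\<in>UNIV. \<Sum>j\<in>UNIV. A $ i $ j * x $ j * cnj (y $ i))"
    by (simp add: cdot_def matrix_vector_mult_def sum_distrib_right)
  also have "\<dots> = (\<Sum>j\<in>UNIV. \<Sum>i\<in>UNIV. A $ i $ j * x $ j * cnj (y $ i))" by (rule sum.swap)
  also have "\<dots> = cdot x (ctranspose A *v y)"
    by (simp add: cdot_def matrix_vector_mult_def ctranspose_def sum_distrib_left algebra_simps)
  finally show ?thesis .
qed

lemma matrix_inv_props:
  assumes "invertible A"
  shows "A ** matrix_inv A = mat 1" "matrix_inv A ** A = mat 1"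
proof -
  have "\<exists>A'. A ** A' = mat 1 \<and> A' ** A = mat 1" using assms by (simp add: invertible_def)
  from someI_ex[OF this] show "A ** matrix_inv A = mat 1" "matrix_inv A ** A = mat 1"
    by (auto simp: matrix_inv_def)
qed

lemma ctranspose_matrix_inv:
  fixes A :: "complex ^ 'n::finite ^ 'n"
  assumes "hermitian A" "invertible A"
  shows "ctranspose (matrix_inv A) = matrix_inv A"
proof -
  have "ctranspose (matrix_inv A) ** A = mat 1"
    using ctranspose_mult[of A "matrix_inv A"] matrix_inv_props[OF assms(2)] assms(1)
    by (simp add: hermitian_iff ctranspose_mat1)
  then have "ctranspose (matrix_inv A) ** A ** matrix_inv A = matrix_inv A" by simp
  then show ?thesis using matrix_inv_props[OF assms(2)] by (simp add: matrix_mul_assoc[symmetric])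
qed

lemma bilinear_matrix_vector: "bilinear (\<lambda>x (A :: complex ^ 'n::finite ^ 'm::finite). A *v x)"
  unfolding bilinear_def linear_iff
  by (auto simp: matrix_vector_mult_def vec_eq_iff algebra_simps sum.distrib scaleR_sum_right)

lemma matrix_vector_norm_bound:
  obtains C where "C > 0" "\<And>(A :: complex ^ 'n::finite ^ 'm::finite) x. norm (A *v x) \<le> C * norm A * norm x"
proof -
  obtain C where "C > 0" "\<And>x (A :: complex ^ 'n ^ 'm). norm (A *v x) \<le> C * norm x * norm A"
    using bilinear_bounded_pos[OF bilinear_matrix_vector] by metis
  then show ?thesis using that[of C] by (simp add: mult_ac)
qed

section \<open>Integrals over the open and the closed interval\<close>

lemma integrable_Leb_iff:
  fixes h :: "real \<Rightarrow> 'a::euclidean_space"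
  shows "integrable (Leb a b) h \<longleftrightarrow> h absolutely_integrable_on {a..b}"
proof -
  have "integrable (Leb a b) h \<longleftrightarrow> h absolutely_integrable_on {a<..<b}"
    by (simp add: integrable_restrict_space set_integrable_def)
  also have "\<dots> \<longleftrightarrow> h absolutely_integrable_on {a..b}"
    by (rule absolutely_integrable_spike_set_eq) (auto intro: negligible_subset[of "{a, b}"])
  finally show ?thesis .
qed

lemma LINT_Leb:
  fixes h :: "real \<Rightarrow> 'a::euclidean_space"
  assumes "integrable (Leb a b) h"
  shows "(LINT x|Leb a b. h x) = integral {a..b} h"
proof -
  have "h absolutely_integrable_on {a<..<b}"
    using assms by (simp add: integrable_restrict_space set_integrable_def)
  then have "(LINT x:{a<..<b}|lebesgue. h x) = integral {a<..<b} h" by (rule set_lebesgue_integral_eq_integral)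
  then show ?thesis
    by (simp add: integral_restrict_space set_lebesgue_integral_def integral_open_interval_real)
qed

lemma AE_Leb_imp_integral_eq:
  fixes g h :: "real \<Rightarrow> 'a::euclidean_space"
  assumes g: "g absolutely_integrable_on {a..b}" and h: "integrable (Leb a b) h" and ae: "AE x in Leb a b. g x = h x"
  shows "integral {a..b} g = (LINT x|Leb a b. h x)"
  using LINT_Leb[of a b g] integral_cong_AE[OF _ _ ae] g h
  by (auto simp: integrable_Leb_iff[symmetric])

lemma L2_fun_imp_integrable:
  fixes f :: "real \<Rightarrow> complex ^ 's::finite"
  assumes f: "f \<in> L2_fun a b" shows "integrable (Leb a b) f"
proof (rule Bochner_Integration.integrable_bound)
  interpret finite_measure "Leb a b" by (rule finite_measure_Leb)
  show "integrable (Leb a b) (\<lambda>x. 1 + (norm (f x))\<^sup>2)" using f by (auto simp: L2_fun_def)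
  show "f \<in> borel_measurable (Leb a b)" by (rule L2_fun_measurable[OF f])
  have "norm (f x) \<le> 1 + (norm (f x))\<^sup>2" for x
    using sum_squares_bound[of 1 "norm (f x)"] norm_ge_zero[of "f x"] by (simp only: power2_eq_square)
  then show "AE x in Leb a b. norm (f x) \<le> norm (1 + (norm (f x))\<^sup>2)" by simp
qed

lemma continuous_imp_L2_fun:
  fixes f :: "real \<Rightarrow> complex ^ 's::finite"
  assumes f: "continuous_on {a..b} f" shows "f \<in> L2_fun a b"
proof -
  interpret finite_measure "Leb a b" by (rule finite_measure_Leb)
  have "bounded (f ` {a..b})" by (intro compact_imp_bounded compact_continuous_image f) simp
  then obtain B where "\<forall>v\<in>f ` {a..b}. norm v \<le> B" unfolding bounded_iff by blast
  then have B: "norm (f x) \<le> B" if "x \<in> {a..b}" for x using that by blast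
  show ?thesis
  proof (rule L2_fun_I)
    show "f \<in> borel_measurable (Leb a b)"
      by (rule continuous_imp_measurable_on_sets_lebesgue) (auto intro: continuous_on_subset[OF f])
    show "integrable (Leb a b) (\<lambda>x. B\<^sup>2)" by simp
    show "AE x in Leb a b. (norm (f x))\<^sup>2 \<le> B\<^sup>2"
      by (rule AE_I2) (auto intro!: power_mono B simp: space_restrict_space)
  qed
qed

text \<open>Continuous functions that agree almost everywhere agree at the endpoints as well; this makes
  boundary values functions of the equivalence class.\<close>

lemma AE_continuous_eq:
  fixes f g :: "real \<Rightarrow> 'a::euclidean_space"
  assumes f: "continuous_on {a..b} f" and g: "continuous_on {a..b} g" and ae: "AE x in Leb a b. f x = g x"
    and x: "x \<in> {a..b}" and "a < b"
  shows "f x = g x"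
proof -
  have "AE x in lebesgue. x \<in> {a<..<b} \<longrightarrow> f x = g x"
    using ae by (subst (asm) AE_restrict_space_iff) auto
  then have neg: "negligible {x \<in> {a<..<b}. f x \<noteq> g x}"
    unfolding negligible_iff_null_sets completion.AE_iff_null_sets
    by (auto intro: negligible_subset simp flip: negligible_iff_null_sets)
  have dense: "x \<in> closure {x \<in> {a<..<b}. f x = g x}"
    unfolding closure_approachable
  proof (intro allI impI)
    fix e :: real assume "e > 0"
    define c d where "c = max a (x - e)" and "d = min b (x + e)"
    have "c < d" using x \<open>a < b\<close> \<open>e > 0\<close> by (auto simp: c_def d_def)
    have "\<not> negligible {c<..<d}"
      using \<open>c < d\<close> by (auto simp: negligible_iff_measure dest: arg_cong[where f = "\<lambda>x. x"])
    then obtain z where "z \<in> {c<..<d}" "z \<notin> {x \<in> {a<..<b}. f x \<noteq> g x}"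
      using neg negligible_subset by blast
    then show "\<exists>y\<in>{x \<in> {a<..<b}. f x = g x}. dist y x < e"
      by (intro bexI[of _ z]) (auto simp: c_def d_def dist_real_def)
  qed
  have "closed {x \<in> {a..b}. f x = g x}" 
    using continuous_closed_preimage_constant[of "{a..b}" "\<lambda>x. f x - g x" 0] f g
    by (simp add: continuous_on_diff)
  then have "closure {x \<in> {a<..<b}. f x = g x} \<subseteq> {x \<in> {a..b}. f x = g x}"
    by (intro closure_minimal) auto
  then show ?thesis using dense by auto
qed

section \<open>The maximal operator\<close>

text \<open>The regular matrix Sturm-Liouville expression. The four integrable functions are the
  coefficients of the first-order system for a function and its quasi-derivative.\<close>

locale coefficients =
  fixes a b :: real and p Q :: "real \<Rightarrow> complex ^ 's ^ ('s::finite)"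
  assumes ab: "a < b"
    and hermitian_p: "\<And>x. x \<in> {a<..<b} \<Longrightarrow> hermitian (p x)"
    and hermitian_Q: "\<And>x. x \<in> {a<..<b} \<Longrightarrow> hermitian (Q x)"
    and invertible_p: "AE x in Leb a b. invertible (p x)"
    and integrable_R: "integrable (Leb a b) (\<lambda>x. matrix_inv (p x))"
      "integrable (Leb a b) (\<lambda>x. matrix_inv (p x) ** Q x)"
      "integrable (Leb a b) (\<lambda>x. Q x ** matrix_inv (p x))"
      "integrable (Leb a b) (\<lambda>x. Q x ** matrix_inv (p x) ** Q x)"
begin

text \<open>\<open>R\<close> is the inverse of \<open>p\<close>, \<open>MD\<close> is the domain of the maximal operator (as a set of functions),
  \<open>D1\<close> and \<open>D2\<close> are the quasi-derivatives.\<close>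

abbreviation "R x \<equiv> matrix_inv (p x)"
abbreviation "MD \<equiv> max_domain a b p Q"
abbreviation "D1 \<equiv> qderiv1 a b p Q"
abbreviation "D2 \<equiv> qderiv2 a b p Q"

text \<open>The equation \<open>D2 y = w\<close> as a first-order system for \<open>y\<close> and its quasi-derivative \<open>u\<close>. Unlike the
  quasi-derivatives themselves, which involve a choice, this relation is visibly linear and depends
  only on values on \<open>[a, b]\<close>.\<close>

definition qsol :: "(real \<Rightarrow> complex ^ 's) \<Rightarrow> (real \<Rightarrow> complex ^ 's) \<Rightarrow> (real \<Rightarrow> complex ^ 's) \<Rightarrow> bool" where
  "qsol y u w \<longleftrightarrow> abs_continuous_on a b y \<and> abs_continuous_on a b u \<and>
    (AE x in Leb a b.
      (y has_vector_derivative (R x *v u x + (R x ** Q x) *v y x)) (at x) \<and>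
      (u has_vector_derivative (w x - (Q x ** R x) *v u x - (Q x ** R x ** Q x) *v y x)) (at x))"

lemma AE_interior: "AE x in Leb a b. x \<in> {a<..<b}"
  by (rule AE_I2) (simp add: space_restrict_space)

lemma abs_continuous_AE_derivative:
  fixes f :: "real \<Rightarrow> 'e::euclidean_space"
  assumes "abs_continuous_on a b f"
  shows "AE x in Leb a b. (f has_vector_derivative vector_derivative f (at x)) (at x)"
proof -
  obtain g where g: "g absolutely_integrable_on {a..b}" "\<And>x. x \<in> {a..b} \<Longrightarrow> f x = f a + integral {a..x} g"
    using abs_continuous_on_is_integral[OF assms] ab by (metis less_imp_le)
  have "AE x in Leb a b. (f has_vector_derivative g x) (at x)"
    by (rule is_integral_derivative(2)[OF g(1)]) (rule g(2))
  then show ?thesis by eventually_elim (simp add: vector_derivative_at)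
qed

lemma max_domain_qsol:
  assumes y: "y \<in> MD"
  shows "qsol y (D1 y) (D2 y)" "D2 y \<in> L2_fun a b" "y \<in> L2_fun a b" "has_qderiv1 a b p Q y (D1 y)"
proof -
  show "D2 y \<in> L2_fun a b" "y \<in> L2_fun a b" using y by (auto simp: max_domain_def)
  have "\<exists>u. has_qderiv1 a b p Q y u" using y by (auto simp: max_domain_def)
  then show h: "has_qderiv1 a b p Q y (D1 y)" unfolding qderiv1_def by (rule someI_ex)
  have yac: "abs_continuous_on a b y" using y by (auto simp: max_domain_def)
  have uac: "abs_continuous_on a b (D1 y)" using h by (simp add: has_qderiv1_def)
  have ae: "AE x in Leb a b. D1 y x = p x *v vector_derivative y (at x) - Q x *v y x"
    using h by (simp add: has_qderiv1_def)
  show "qsol y (D1 y) (D2 y)"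
    unfolding qsol_def
  proof (intro conjI yac uac)
    show "AE x in Leb a b. (y has_vector_derivative (R x *v D1 y x + (R x ** Q x) *v y x)) (at x) \<and>
      (D1 y has_vector_derivative (D2 y x - (Q x ** R x) *v D1 y x - (Q x ** R x ** Q x) *v y x)) (at x)"
      using abs_continuous_AE_derivative[OF yac] abs_continuous_AE_derivative[OF uac] ae invertible_p
    proof eventually_elim
      case (elim x)
      have "R x *v D1 y x + (R x ** Q x) *v y x = R x *v (D1 y x + Q x *v y x)"
        by (simp add: matrix_vector_right_distrib matrix_vector_mul_assoc)
      also have "\<dots> = vector_derivative y (at x)"
        using elim(3) matrix_inv_props[OF elim(4)] by (simp add: matrix_vector_mul_assoc)
      finally show ?case using elim(1,2) by (simp add: qderiv2_def)
    qed
  qed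
qed

lemma qsol_max_domain:
  assumes s: "qsol y u w" and w: "w \<in> L2_fun a b"
  shows "y \<in> MD" "\<And>x. x \<in> {a..b} \<Longrightarrow> D1 y x = u x" "AE x in Leb a b. D2 y x = w x"
proof -
  have yac: "abs_continuous_on a b y" and uac: "abs_continuous_on a b u" using s by (auto simp: qsol_def)
  have h: "has_qderiv1 a b p Q y u"
    unfolding has_qderiv1_def
  proof (intro conjI uac)
    show "AE x in Leb a b. u x = p x *v vector_derivative y (at x) - Q x *v y x"
      using s[unfolded qsol_def, THEN conjunct2, THEN conjunct2] invertible_p
    proof eventually_elim
      case (elim x)
      have "p x *v vector_derivative y (at x) = p x *v (R x *v u x + (R x ** Q x) *v y x)"
        using vector_derivative_at[OF conjunct1[OF elim(1)]] by simp
      also have "\<dots> = u x + Q x *v y x"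
        using matrix_inv_props[OF elim(2)]
        by (simp add: matrix_vector_right_distrib matrix_vector_mul_assoc matrix_mul_assoc)
      finally show ?case by simp
    qed
  qed
  then have "has_qderiv1 a b p Q y (D1 y)" unfolding qderiv1_def by (rule someI[of "has_qderiv1 a b p Q y"])
  then have h': "abs_continuous_on a b (D1 y)" "AE x in Leb a b. D1 y x = p x *v vector_derivative y (at x) - Q x *v y x"
    by (auto simp: has_qderiv1_def)
  have "AE x in Leb a b. D1 y x = u x"
    using h'(2) h[unfolded has_qderiv1_def, THEN conjunct2] by eventually_elim simp
  then show eq: "\<And>x. x \<in> {a..b} \<Longrightarrow> D1 y x = u x"
    using AE_continuous_eq[OF abs_continuous_on_imp_continuous_on[OF h'(1)] abs_continuous_on_imp_continuous_on[OF uac]] ab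
    by blast
  show ae: "AE x in Leb a b. D2 y x = w x"
    using s[unfolded qsol_def, THEN conjunct2, THEN conjunct2] AE_interior
  proof eventually_elim
    case (elim x)
    have "(D1 y has_vector_derivative (w x - (Q x ** R x) *v u x - (Q x ** R x ** Q x) *v y x)) (at x)"
      by (rule has_vector_derivative_transform_within_open[of u _ x "{a<..<b}"]) (use elim eq in auto)
    then show ?case using eq[of x] elim(2) by (simp add: qderiv2_def vector_derivative_at)
  qed
  have "AE x in Leb a b. w x = D2 y x" using ae by eventually_elim simp
  then have "D2 y \<in> L2_fun a b" by (rule L2_fun_cong_AE[OF w])
  then show "y \<in> MD"
    using yac h continuous_imp_L2_fun[OF abs_continuous_on_imp_continuous_on[OF yac]]
    by (auto simp: max_domain_def)
qed

lemma qsol_cong: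
  assumes s: "qsol y u w" and eq: "\<And>x. x \<in> {a..b} \<Longrightarrow> y x = y' x"
  shows "qsol y' u w"
  unfolding qsol_def
proof (intro conjI)
  show "abs_continuous_on a b y'" using s eq by (auto simp: qsol_def intro: abs_continuous_on_cong)
  show "abs_continuous_on a b u" using s by (simp add: qsol_def)
  show "AE x in Leb a b. (y' has_vector_derivative (R x *v u x + (R x ** Q x) *v y' x)) (at x) \<and>
      (u has_vector_derivative (w x - (Q x ** R x) *v u x - (Q x ** R x ** Q x) *v y' x)) (at x)"
    using s[unfolded qsol_def, THEN conjunct2, THEN conjunct2] AE_interior
  proof eventually_elim
    case (elim x)
    have "(y' has_vector_derivative (R x *v u x + (R x ** Q x) *v y x)) (at x)"
      by (rule has_vector_derivative_transform_within_open[of y _ x "{a<..<b}"]) (use elim eq in auto)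
    then show ?case using elim eq[of x] by auto
  qed
qed

text \<open>The boundary values and the image under the maximal operator depend only on the equivalence
  class.\<close>

lemma max_domain_AE_eq:
  assumes y: "y \<in> MD" and y': "y' \<in> MD" and ae: "AE x in Leb a b. y x = y' x"
  shows "\<And>x. x \<in> {a..b} \<Longrightarrow> y' x = y x" "\<And>x. x \<in> {a..b} \<Longrightarrow> D1 y' x = D1 y x" "AE x in Leb a b. D2 y' x = D2 y x"
proof -
  have c: "continuous_on {a..b} y" "continuous_on {a..b} y'"
    using y y' by (auto simp: max_domain_def abs_continuous_on_imp_continuous_on)
  show eq: "\<And>x. x \<in> {a..b} \<Longrightarrow> y' x = y x" using AE_continuous_eq[OF c ae] ab by metis
  have "qsol y' (D1 y) (D2 y)" by (rule qsol_cong[OF max_domain_qsol(1)[OF y]]) (simp add: eq)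
  from qsol_max_domain(2,3)[OF this max_domain_qsol(2)[OF y]]
  show "\<And>x. x \<in> {a..b} \<Longrightarrow> D1 y' x = D1 y x" "AE x in Leb a b. D2 y' x = D2 y x" by auto
qed

lemma qsol_add_scale:
  assumes s: "qsol y u w" and s': "qsol y' u' w'"
  shows "qsol (\<lambda>x. y x + c *s y' x) (\<lambda>x. u x + c *s u' x) (\<lambda>x. w x + c *s w' x)"
proof -
  have ac: "abs_continuous_on a b (\<lambda>x. f x + c *s g x)"
    if "abs_continuous_on a b f" "abs_continuous_on a b g" for f g :: "real \<Rightarrow> complex ^ 's"
  proof (rule abs_continuous_on_bound[OF that, of "1 + cmod c"])
    fix x y
    have "norm (f x + c *s g x - (f y + c *s g y)) = norm ((f x - f y) + c *s (g x - g y))"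
      by (simp add: algebra_simps vec.scale_right_diff_distrib)
    also have "\<dots> \<le> norm (f x - f y) + cmod c * norm (g x - g y)"
      by (metis norm_cscale norm_triangle_ineq)
    also have "\<dots> \<le> (1 + cmod c) * (norm (f x - f y) + norm (g x - g y))"
      by (simp add: algebra_simps)
    finally show "norm (f x + c *s g x - (f y + c *s g y)) \<le> (1 + cmod c) * (norm (f x - f y) + norm (g x - g y))" .
  qed simp
  have der: "((\<lambda>x. f x + c *s g x) has_vector_derivative (f' + c *s g')) (at x)"
    if "(f has_vector_derivative f') (at x)" "(g has_vector_derivative g') (at x)"
    for f g :: "real \<Rightarrow> complex ^ 's" and f' g' x
    by (intro has_vector_derivative_add that bounded_linear.has_vector_derivative[OF bounded_linear_cscale])
  have mv: "A *v (v + c *s v') = A *v v + c *s (A *v v')" for A :: "complex ^ 's ^ 's" and v v'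
    by (simp add: matrix_vector_right_distrib vec.scale)
  show ?thesis
    unfolding qsol_def
  proof (intro conjI ac)
    show "AE x in Leb a b.
        ((\<lambda>x. y x + c *s y' x) has_vector_derivative
          (R x *v (u x + c *s u' x) + (R x ** Q x) *v (y x + c *s y' x))) (at x) \<and>
        ((\<lambda>x. u x + c *s u' x) has_vector_derivative
          (w x + c *s w' x - (Q x ** R x) *v (u x + c *s u' x) - (Q x ** R x ** Q x) *v (y x + c *s y' x))) (at x)"
      using s[unfolded qsol_def, THEN conjunct2, THEN conjunct2] s'[unfolded qsol_def, THEN conjunct2, THEN conjunct2]
    proof eventually_elim
      case (elim x)
      have "((\<lambda>x. y x + c *s y' x) has_vector_derivative
        ((R x *v u x + (R x ** Q x) *v y x) + c *s (R x *v u' x + (R x ** Q x) *v y' x))) (at x)"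
        using elim by (intro der) auto
      moreover have "((\<lambda>x. u x + c *s u' x) has_vector_derivative
        ((w x - (Q x ** R x) *v u x - (Q x ** R x ** Q x) *v y x) +
          c *s (w' x - (Q x ** R x) *v u' x - (Q x ** R x ** Q x) *v y' x))) (at x)"
        using elim by (intro der) auto
      ultimately show ?case
        unfolding mv by (simp add: algebra_simps vec.scale_right_distrib vec.scale_right_diff_distrib)
    qed
  qed (use s s' in \<open>auto simp: qsol_def\<close>)
qed

lemma max_domain_add_scale:
  assumes y: "y \<in> MD" and z: "z \<in> MD"
  shows "(\<lambda>x. y x + c *s z x) \<in> MD"
    "\<And>x. x \<in> {a..b} \<Longrightarrow> D1 (\<lambda>x. y x + c *s z x) x = D1 y x + c *s D1 z x"
    "AE x in Leb a b. D2 (\<lambda>x. y x + c *s z x) x = D2 y x + c *s D2 z x"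
proof -
  have "(\<lambda>x. D2 y x + c *s D2 z x) \<in> L2_fun a b"
    by (intro L2_fun_add L2_fun_scale max_domain_qsol y z)
  from qsol_max_domain[OF qsol_add_scale[OF max_domain_qsol(1)[OF y] max_domain_qsol(1)[OF z]] this]
  show "(\<lambda>x. y x + c *s z x) \<in> MD"
    "\<And>x. x \<in> {a..b} \<Longrightarrow> D1 (\<lambda>x. y x + c *s z x) x = D1 y x + c *s D1 z x"
    "AE x in Leb a b. D2 (\<lambda>x. y x + c *s z x) x = D2 y x + c *s D2 z x" by auto
qed

lemma max_domain_0: "(\<lambda>_. 0) \<in> MD" "\<And>x. x \<in> {a..b} \<Longrightarrow> D1 (\<lambda>_. 0) x = 0" "AE x in Leb a b. D2 (\<lambda>_. 0) x = 0"
proof -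
  have "abs_continuous_on a b (\<lambda>_. 0 :: complex ^ 's)" by (auto simp: abs_continuous_on_def intro: exI[of _ 1])
  then have "qsol (\<lambda>_. 0) (\<lambda>_. 0) (\<lambda>_. 0)" by (simp add: qsol_def)
  from qsol_max_domain[OF this L2_fun_0] show "(\<lambda>_. 0) \<in> MD" "\<And>x. x \<in> {a..b} \<Longrightarrow> D1 (\<lambda>_. 0) x = 0" "AE x in Leb a b. D2 (\<lambda>_. 0) x = 0" by auto
qed

end

section \<open>Initial value problems and Green's formula\<close>

lemma norm_fst_diff_le: "norm (fst x - fst y) \<le> norm (x - y)"
  by (metis fst_diff norm_fst_le prod.collapse)

lemma norm_snd_diff_le: "norm (snd x - snd y) \<le> norm (x - y)"
  by (metis snd_diff norm_snd_le prod.collapse)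

context coefficients begin

lemma initial_value_problem:
  assumes g: "g \<in> L2_fun a b"
  obtains y where "y \<in> MD" "y a = v" "D1 y a = v'" "AE x in Leb a b. D2 y x = g x"
proof -
  obtain C where C: "C > 0" "\<And>(A :: complex ^ 's ^ 's) x. norm (A *v x) \<le> C * norm A * norm x"
    using matrix_vector_norm_bound by metis
  define f where "f = (\<lambda>t (z :: (complex ^ 's) \<times> (complex ^ 's)).
    (R t *v snd z + (R t ** Q t) *v fst z, g t - (Q t ** R t) *v snd z - (Q t ** R t ** Q t) *v fst z))"
  define m where "m = (\<lambda>t. C * (norm (R t) + norm (R t ** Q t) + norm (Q t ** R t) + norm (Q t ** R t ** Q t)))"
  note int = integrable_R[unfolded integrable_Leb_iff]
  have mv: "(\<lambda>t. A t *v y t) absolutely_integrable_on {a..b}"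
    if "A absolutely_integrable_on {a..b}" "continuous_on {a..b} y" for A :: "real \<Rightarrow> complex ^ 's ^ 's" and y
  proof (rule absolutely_integrable_bounded_measurable_product[OF bilinear_matrix_vector _ _ _ that(1)])
    show "y \<in> borel_measurable (lebesgue_on {a..b})"
      by (rule continuous_imp_measurable_on_sets_lebesgue[OF that(2)]) simp
    show "bounded (y ` {a..b})" by (intro compact_imp_bounded compact_continuous_image that(2)) simp
  qed simp
  interpret caratheodory a b f m
  proof
    fix y :: "real \<Rightarrow> (complex ^ 's) \<times> (complex ^ 's)" assume y: "continuous_on {a..b} y"
    have c: "continuous_on {a..b} (\<lambda>t. fst (y t))" "continuous_on {a..b} (\<lambda>t. snd (y t))"
      using y by (auto intro: continuous_on_fst continuous_on_snd)
    have gi: "g absolutely_integrable_on {a..b}"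
      using L2_fun_imp_integrable[OF g] by (simp add: integrable_Leb_iff)
    let ?h1 = "\<lambda>t. R t *v snd (y t) + (R t ** Q t) *v fst (y t)"
    let ?h2 = "\<lambda>t. g t - (Q t ** R t) *v snd (y t) - (Q t ** R t ** Q t) *v fst (y t)"
    have h: "?h1 absolutely_integrable_on {a..b}" "?h2 absolutely_integrable_on {a..b}"
      by (intro set_integral_add set_integral_diff mv int c gi)+
    have "(\<lambda>v :: complex ^ 's. (v, 0 :: complex ^ 's)) \<circ> ?h1 absolutely_integrable_on {a..b}"
      "(\<lambda>v :: complex ^ 's. (0 :: complex ^ 's, v)) \<circ> ?h2 absolutely_integrable_on {a..b}"
      by (intro absolutely_integrable_linear[OF h(1)] absolutely_integrable_linear[OF h(2)]
          bounded_linear_Pair bounded_linear_ident bounded_linear_zero)+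
    from set_integral_add(1)[OF this]
    show "(\<lambda>t. f t (y t)) absolutely_integrable_on {a..b}"
      by (simp add: f_def o_def)
  next
    have n: "(\<lambda>t. norm (A t)) absolutely_integrable_on {a..b}" if "A absolutely_integrable_on {a..b}"
      for A :: "real \<Rightarrow> complex ^ 's ^ 's" by (rule absolutely_integrable_norm[OF that, unfolded o_def])
    show "m absolutely_integrable_on {a..b}"
      unfolding m_def by (intro set_integrable_mult_right set_integral_add n int)
  next
    fix t
    show "0 \<le> m t" using C(1) by (simp add: m_def)
    fix v w :: "(complex ^ 's) \<times> (complex ^ 's)"
    define d1 d2 where "d1 = fst v - fst w" and "d2 = snd v - snd w"
    have n: "norm d1 \<le> norm (v - w)" "norm d2 \<le> norm (v - w)"
      unfolding d1_def d2_def by (rule norm_fst_diff_le) (rule norm_snd_diff_le)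
    have b: "norm (A *v d1) \<le> C * norm A * norm (v - w)" "norm (A *v d2) \<le> C * norm A * norm (v - w)"
      for A :: "complex ^ 's ^ 's"
      using C n by (auto intro!: order_trans[OF C(2)] mult_left_mono)
    have "f t v - f t w = (R t *v d2 + (R t ** Q t) *v d1, - ((Q t ** R t) *v d2) - (Q t ** R t ** Q t) *v d1)"
      unfolding f_def d1_def d2_def by (simp add: matrix_vector_mult_diff_distrib algebra_simps)
    then have "norm (f t v - f t w) \<le> norm (R t *v d2 + (R t ** Q t) *v d1) +
       norm (- ((Q t ** R t) *v d2) - (Q t ** R t ** Q t) *v d1)"
      using norm_Pair_le by metis
    also have "\<dots> \<le> (norm (R t *v d2) + norm ((R t ** Q t) *v d1)) + (norm ((Q t ** R t) *v d2) + norm ((Q t ** R t ** Q t) *v d1))"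
      by (intro add_mono norm_triangle_ineq order_trans[OF norm_triangle_ineq4]) simp_all
    also have "\<dots> \<le> (C * norm (R t) * norm (v - w) + C * norm (R t ** Q t) * norm (v - w)) +
        (C * norm (Q t ** R t) * norm (v - w) + C * norm (Q t ** R t ** Q t) * norm (v - w))"
      by (intro add_mono b)
    also have "\<dots> = m t * norm (v - w)" by (simp add: m_def algebra_simps)
    finally show "norm (f t v - f t w) \<le> m t * norm (v - w)" .
  qed
  obtain Y where Y: "continuous_on {a..b} Y" "\<And>t. t \<in> {a..b} \<Longrightarrow> Y t = (v, v') + integral {a..t} (\<lambda>s. f s (Y s))"
    using solution_exists[of "(v, v')"] ab unfolding solves_def by auto
  have Ya: "Y a = (v, v')" using Y(2)[of a] ab by simp
  have Y': "Y t = Y a + integral {a..t} (\<lambda>s. f s (Y s))" if "t \<in> {a..b}" for t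
    using Y(2)[OF that] Ya by simp
  have ac: "abs_continuous_on a b Y" and der: "AE t in Leb a b. (Y has_vector_derivative f t (Y t)) (at t)"
    using is_integral_derivative[OF integrable_rhs[OF Y(1)]] Y' by blast+
  let ?y = "\<lambda>t. fst (Y t)" and ?u = "\<lambda>t. snd (Y t)"
  have "qsol ?y ?u g"
    unfolding qsol_def
  proof (intro conjI)
    have le: "norm (fst x - fst y) \<le> 1 * (norm (x - y) + norm (x - y))"
        "norm (snd x - snd y) \<le> 1 * (norm (x - y) + norm (x - y))"
      for x y :: "(complex ^ 's) \<times> (complex ^ 's)"
      by (rule order_trans[OF norm_fst_diff_le], simp) (rule order_trans[OF norm_snd_diff_le], simp)
    show "abs_continuous_on a b ?y" "abs_continuous_on a b ?u"
      by (rule abs_continuous_on_bound[OF ac ac, of 1]; simp only: zero_le_one le)+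
    show "AE t in Leb a b. (?y has_vector_derivative (R t *v ?u t + (R t ** Q t) *v ?y t)) (at t) \<and>
      (?u has_vector_derivative (g t - (Q t ** R t) *v ?u t - (Q t ** R t ** Q t) *v ?y t)) (at t)"
      using der
    proof eventually_elim
      case (elim t)
      from bounded_linear.has_vector_derivative[OF bounded_linear_fst elim]
        bounded_linear.has_vector_derivative[OF bounded_linear_snd elim]
      show ?case by (simp add: f_def)
    qed
  qed
  from qsol_max_domain[OF this g] show ?thesis
    using that[of ?y] Ya ab by auto
qed

text \<open>The derivative of the boundary form \<open>\<phi>\<close> is the integrand of the left-hand side almost everywhere,
  by the product rule and the Hermitian symmetry of the coefficients; \<open>\<phi>\<close> is absolutely continuous.\<close>

lemma green:
  assumes y: "y \<in> MD" and z: "z \<in> MD"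
  shows "ip a b y (D2 z) - ip a b (D2 y) z =
    cdot (y b) (D1 z b) - cdot (D1 y b) (z b) - (cdot (y a) (D1 z a) - cdot (D1 y a) (z a))"
proof -
  note ys = max_domain_qsol[OF y] and zs = max_domain_qsol[OF z]
  define \<phi> where "\<phi> = (\<lambda>x. cdot (y x) (D1 z x) - cdot (D1 y x) (z x))"
  define h where "h = (\<lambda>x. cdot (y x) (D2 z x) - cdot (D2 y x) (z x))"
  have hint: "integrable (Leb a b) h"
    unfolding h_def by (intro Bochner_Integration.integrable_diff integrable_cdot ys zs)
  have acdot: "abs_continuous_on a b (\<lambda>x. cdot (f x) (g x))"
    if f: "abs_continuous_on a b f" and g: "abs_continuous_on a b g" for f g :: "real \<Rightarrow> complex ^ 's"
  proof -
    have bd: "\<exists>B\<ge>0. \<forall>x\<in>{a..b}. norm (f x) \<le> B" if "abs_continuous_on a b f" for f :: "real \<Rightarrow> complex ^ 's"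
    proof -
      have "bounded (f ` {a..b})"
        by (intro compact_imp_bounded compact_continuous_image abs_continuous_on_imp_continuous_on that) simp
      then show ?thesis unfolding bounded_pos by (metis imageI less_imp_le)
    qed
    obtain B1 B2 where B: "B1 \<ge> 0" "\<forall>x\<in>{a..b}. norm (f x) \<le> B1" "B2 \<ge> 0" "\<forall>x\<in>{a..b}. norm (g x) \<le> B2"
      using bd[OF f] bd[OF g] by blast
    show ?thesis
    proof (rule abs_continuous_on_bound[OF f g, of "B1 + B2"])
      fix s t assume st: "s \<in> {a..b}" "t \<in> {a..b}"
      have "cdot (f s) (g s) - cdot (f t) (g t) = cdot (f s) (g s - g t) + cdot (f s - f t) (g t)"
        by (simp add: cdot_simps)
      then have "norm (cdot (f s) (g s) - cdot (f t) (g t)) \<le> norm (f s) * norm (g s - g t) + norm (f s - f t) * norm (g t)"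
        by (metis norm_triangle_mono norm_cdot_le)
      also have "\<dots> \<le> B1 * norm (g s - g t) + norm (f s - f t) * B2"
        using B st by (intro add_mono mult_right_mono mult_left_mono) auto
      also have "\<dots> \<le> (B1 + B2) * (norm (f s - f t) + norm (g s - g t))"
        using B by (simp add: algebra_simps)
      finally show "norm (cdot (f s) (g s) - cdot (f t) (g t)) \<le> (B1 + B2) * (norm (f s - f t) + norm (g s - g t))" .
    qed (use B in simp)
  qed
  have \<phi>ac: "abs_continuous_on a b \<phi>"
  proof (rule abs_continuous_on_bound[of a b "\<lambda>x. cdot (y x) (D1 z x)" "\<lambda>x. cdot (D1 y x) (z x)" 1])
    fix s t
    have "\<phi> s - \<phi> t = (cdot (y s) (D1 z s) - cdot (y t) (D1 z t)) - (cdot (D1 y s) (z s) - cdot (D1 y t) (z t))"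
      by (simp add: \<phi>_def)
    then show "norm (\<phi> s - \<phi> t) \<le> 1 * (norm (cdot (y s) (D1 z s) - cdot (y t) (D1 z t)) + norm (cdot (D1 y s) (z s) - cdot (D1 y t) (z t)))"
      unfolding mult_1 by (metis norm_triangle_ineq4)
  qed (use ys zs in \<open>auto simp: qsol_def intro!: acdot\<close>)
  have \<phi>der: "AE x in Leb a b. (\<phi> has_vector_derivative h x) (at x)"
    using ys(1)[unfolded qsol_def, THEN conjunct2, THEN conjunct2] zs(1)[unfolded qsol_def, THEN conjunct2, THEN conjunct2]
      invertible_p AE_interior
  proof eventually_elim
    case (elim x)
    have Rh: "ctranspose (R x) = R x" and Qh: "ctranspose (Q x) = Q x"
      using ctranspose_matrix_inv elim hermitian_p hermitian_Q by (auto simp: hermitian_iff)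
    have adj: "cdot (R x *v v) w = cdot v (R x *v w)" "cdot ((R x ** Q x) *v v) w = cdot v ((Q x ** R x) *v w)"
      "cdot ((Q x ** R x) *v v) w = cdot v ((R x ** Q x) *v w)"
      "cdot ((Q x ** R x ** Q x) *v v) w = cdot v ((Q x ** R x ** Q x) *v w)" for v w
      by (simp_all add: cdot_matrix ctranspose_mult Rh Qh matrix_mul_assoc)
    have "(\<phi> has_vector_derivative
      (cdot (y x) (D2 z x - (Q x ** R x) *v D1 z x - (Q x ** R x ** Q x) *v z x) + cdot (R x *v D1 y x + (R x ** Q x) *v y x) (D1 z x)) -
      (cdot (D1 y x) (R x *v D1 z x + (R x ** Q x) *v z x) + cdot (D2 y x - (Q x ** R x) *v D1 y x - (Q x ** R x ** Q x) *v y x) (z x))) (at x)"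
      unfolding \<phi>_def using elim
      by (intro has_vector_derivative_diff bounded_bilinear.has_vector_derivative[OF bounded_bilinear_cdot]) auto
    then show ?case unfolding h_def by (simp add: cdot_simps adj)
  qed
  obtain g where g: "g absolutely_integrable_on {a..b}" "\<And>x. x \<in> {a..b} \<Longrightarrow> \<phi> x = \<phi> a + integral {a..x} g"
    using abs_continuous_on_is_integral[OF \<phi>ac] ab by (metis less_imp_le)
  have gder: "AE x in Leb a b. (\<phi> has_vector_derivative g x) (at x)"
    by (rule is_integral_derivative(2)[OF g(1)]) (rule g(2))
  have "AE x in Leb a b. g x = h x"
    using gder \<phi>der by eventually_elim (rule vector_derivative_unique_at)
  then have "integral {a..b} g = (LINT x|Leb a b. h x)" by (rule AE_Leb_imp_integral_eq[OF g(1) hint])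
  also have "\<dots> = ip a b y (D2 z) - ip a b (D2 y) z"
    unfolding h_def ip_def by (intro Bochner_Integration.integral_diff integrable_cdot ys zs)
  finally show ?thesis using g(2)[of b] ab by (simp add: \<phi>_def algebra_simps)
qed

end

section \<open>Boundary values\<close>

lemma vec_join_add_scale:
  "vec_join u v + c *s vec_join u' v' = vec_join (u + c *s u') (v + c *s v')"
  by (auto simp: vec_join_def vec_eq_iff split: sum.splits)

lemma vec_join_eq_iff: "vec_join u v = vec_join u' v' \<longleftrightarrow> u = u' \<and> v = v'"
  by (auto simp: vec_join_def vec_eq_iff split: sum.splits)

lemma vec_join_cases: obtains u v where "x = vec_join u v"
proof
  show "x = vec_join (\<chi> i. x $ Inl i) (\<chi> i. x $ Inr i)"
    by (auto simp: vec_join_def vec_eq_iff split: sum.splits)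
qed

lemma vec_join_0: "vec_join 0 0 = 0"
  by (auto simp: vec_join_def vec_eq_iff split: sum.splits)

lemma cdot_vec_join:
  "cdot (vec_join u v) (vec_join u' v') = cdot u u' + cdot v (v' :: complex ^ 's::finite)"
  unfolding cdot_def by (subst UNIV_Plus_UNIV[symmetric], subst sum.Plus) (auto simp: vec_join_def)

lemma ip_sum_right: "\<lbrakk>\<And>i. i \<in> I \<Longrightarrow> f i \<in> L2_fun a b; h \<in> L2_fun a b\<rbrakk> \<Longrightarrow>
    ip a b h (\<lambda>x. \<Sum>i\<in>I. f i x) = (\<Sum>i\<in>I. ip a b h (f i))"
  by (subst (1 2) ip_commute) (simp add: ip_sum_left)

context coefficients begin

text \<open>The Cauchy data of a function at the two endpoints.\<close>

definition data_a :: "(real \<Rightarrow> complex ^ 's) \<Rightarrow> complex ^ ('s + 's)" where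
  "data_a y = vec_join (y a) (D1 y a)"

definition data_b :: "(real \<Rightarrow> complex ^ 's) \<Rightarrow> complex ^ ('s + 's)" where
  "data_b y = vec_join (y b) (D1 y b)"

lemma data_add_scale:
  assumes "y \<in> MD" "z \<in> MD"
  shows "data_a (\<lambda>x. y x + c *s z x) = data_a y + c *s data_a z"
    "data_b (\<lambda>x. y x + c *s z x) = data_b y + c *s data_b z"
  using max_domain_add_scale(2)[OF assms] ab by (simp_all add: data_a_def data_b_def vec_join_add_scale)

lemma ivp_data:
  assumes "g \<in> L2_fun a b"
  shows "\<exists>y. y \<in> MD \<and> data_a y = c \<and> (AE x in Leb a b. D2 y x = g x)"
proof -
  obtain v v' where "c = vec_join v v'" by (rule vec_join_cases)
  then show ?thesis using initial_value_problem[OF assms, of v v'] by (metis data_a_def)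
qed

text \<open>A fundamental system of solutions of the homogeneous equation, normalized at \<^term>\<open>a\<close>.\<close>

definition fund_sol :: "'s + 's \<Rightarrow> real \<Rightarrow> complex ^ 's" where
  "fund_sol k = (SOME y. y \<in> MD \<and> data_a y = axis k 1 \<and> (AE x in Leb a b. D2 y x = 0))"

lemma fund_sol: "fund_sol k \<in> MD" "data_a (fund_sol k) = axis k 1" "AE x in Leb a b. D2 (fund_sol k) x = 0"
proof -
  note ex = someI_ex[OF ivp_data[OF L2_fun_0, of "axis k 1"], folded fund_sol_def]
  show "fund_sol k \<in> MD" "data_a (fund_sol k) = axis k 1" "AE x in Leb a b. D2 (fund_sol k) x = 0"
    using ex by blast+
qed

text \<open>The solution of the homogeneous equation with Cauchy data \<^term>\<open>c\<close> at \<^term>\<open>a\<close>.\<close>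

definition hom_sol :: "complex ^ ('s + 's) \<Rightarrow> real \<Rightarrow> complex ^ 's" where
  "hom_sol c x = (\<Sum>k\<in>UNIV. c $ k *s fund_sol k x)"

lemma hom_sol_partial:
  "finite I \<Longrightarrow> (\<lambda>x. \<Sum>k\<in>I. c $ k *s fund_sol k x) \<in> MD \<and>
    data_a (\<lambda>x. \<Sum>k\<in>I. c $ k *s fund_sol k x) = (\<Sum>k\<in>I. c $ k *s axis k 1) \<and>
    (AE x in Leb a b. D2 (\<lambda>x. \<Sum>k\<in>I. c $ k *s fund_sol k x) x = 0)"
proof (induction I rule: finite_induct)
  case empty
  show ?case using max_domain_0 ab by (simp add: data_a_def vec_join_0)
next
  case (insert k I)
  let ?s = "\<lambda>x. \<Sum>k\<in>I. c $ k *s fund_sol k x"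
  have s: "?s \<in> MD" "data_a ?s = (\<Sum>k\<in>I. c $ k *s axis k 1)" "AE x in Leb a b. D2 ?s x = 0" using insert by auto
  have eq: "(\<lambda>x. \<Sum>k\<in>insert k I. c $ k *s fund_sol k x) = (\<lambda>x. ?s x + c $ k *s fund_sol k x)"
    using insert by (simp add: add.commute)
  show ?case
    unfolding eq
  proof (intro conjI)
    show "(\<lambda>x. ?s x + c $ k *s fund_sol k x) \<in> MD" by (intro max_domain_add_scale s fund_sol)
    show "data_a (\<lambda>x. ?s x + c $ k *s fund_sol k x) = (\<Sum>k\<in>insert k I. c $ k *s axis k 1)"
      unfolding data_add_scale(1)[OF s(1) fund_sol(1)] s(2) fund_sol(2) using insert by (simp add: add.commute)
    show "AE x in Leb a b. D2 (\<lambda>x. ?s x + c $ k *s fund_sol k x) x = 0"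
      using max_domain_add_scale(3)[OF s(1) fund_sol(1), of "c $ k" k] s(3) fund_sol(3)[of k] by eventually_elim simp
  qed
qed

lemma hom_sol: "hom_sol c \<in> MD" "data_a (hom_sol c) = c" "AE x in Leb a b. D2 (hom_sol c) x = 0"
proof -
  have *: "hom_sol c = (\<lambda>x. \<Sum>k\<in>UNIV. c $ k *s fund_sol k x)" by (simp add: hom_sol_def fun_eq_iff)
  show "hom_sol c \<in> MD" "data_a (hom_sol c) = c" "AE x in Leb a b. D2 (hom_sol c) x = 0"
    using hom_sol_partial[of UNIV c] unfolding * by (simp_all add: basis_expansion)
qed

lemma hom_sol_add_scale: "hom_sol (c + t *s d) = (\<lambda>x. hom_sol c x + t *s hom_sol d x)"
  by (simp add: hom_sol_def fun_eq_iff vec.scale_sum_right sum.distrib[symmetric] vec.scale_left_distrib)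

lemma MD_L2: "y \<in> MD \<Longrightarrow> y \<in> L2_fun a b" "y \<in> MD \<Longrightarrow> D2 y \<in> L2_fun a b"
  by (rule max_domain_qsol, assumption)+

lemma ip_zero_AE:
  assumes "f \<in> L2_fun a b" "g \<in> L2_fun a b" "AE x in Leb a b. g x = 0"
  shows "ip a b f g = 0" "ip a b g f = 0"
  using ip_cong_AE[OF assms(1,2,1) L2_fun_0 _ assms(3)] ip_cong_AE[OF assms(2,1) L2_fun_0 assms(1) assms(3)]
  by (simp_all add: ip_def)

text \<open>By Green's formula the nondegenerate boundary form of two homogeneous solutions is the same at both
  endpoints. Hence a homogeneous solution with zero data at \<^term>\<open>b\<close> is zero, and the linear map from
  data at \<^term>\<open>a\<close> to data at \<^term>\<open>b\<close> is bijective; no initial value problem has to be solved from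
  the right.\<close>

lemma data_b_hom_sol_surj: obtains c where "data_b (hom_sol c) = v"
proof -
  let ?M = "\<lambda>c. data_b (hom_sol c)"
  have lin: "Vector_Spaces.linear (*s) (*s) ?M"
    by (rule clinear_opI) (simp add: hom_sol_add_scale data_add_scale hom_sol)
  have inj0: "c = 0" if c: "?M c = 0" for c
  proof -
    let ?y = "hom_sol c"
    have yb: "?y b = 0" "D1 ?y b = 0"
      using c vec_join_eq_iff[of "?y b" "D1 ?y b" 0 0] by (auto simp: data_b_def vec_join_0)
    \<comment> \<open>With this choice the boundary form at \<open>a\<close> is a sum of squares.\<close>
    define z where "z = hom_sol (vec_join (D1 ?y a) (- ?y a))"
    have za: "z a = D1 ?y a" "D1 z a = - ?y a"
      using hom_sol(2)[of "vec_join (D1 ?y a) (- ?y a)"] by (auto simp: z_def data_a_def vec_join_eq_iff)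
    have zM: "z \<in> MD" "AE x in Leb a b. D2 z x = 0" using hom_sol by (auto simp: z_def)
    have "ip a b ?y (D2 z) - ip a b (D2 ?y) z = cdot (?y a) (?y a) + cdot (D1 ?y a) (D1 ?y a)"
      using green[OF hom_sol(1) zM(1), of c] by (simp add: yb za cdot_minus_right)
    moreover have "ip a b ?y (D2 z) = 0" "ip a b (D2 ?y) z = 0"
      by (intro ip_zero_AE MD_L2 hom_sol zM)+
    ultimately have "complex_of_real ((norm (?y a))\<^sup>2 + (norm (D1 ?y a))\<^sup>2) = 0" by (simp add: cdot_self)
    then have "(norm (?y a))\<^sup>2 + (norm (D1 ?y a))\<^sup>2 = 0" by (simp only: of_real_eq_0_iff)
    then have "?y a = 0" "D1 ?y a = 0" by (auto simp: sum_power2_eq_zero_iff)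
    then show "c = 0" using hom_sol(2)[of c] by (simp add: data_a_def vec_join_0)
  qed
  have "inj ?M" using vec.linear_inj_iff_eq_0[OF lin] inj0 by blast
  then have "surj ?M" by (rule vec.linear_inj_imp_surj[OF lin])
  then obtain c where "v = ?M c" by (rule surjE)
  then show ?thesis by (intro that[of c]) simp
qed

text \<open>The Gram matrix of the fundamental system is invertible: a homogeneous solution in its kernel is
  orthogonal to itself.\<close>

lemma hom_sol_ip_surj: obtains c where "\<And>d. ip a b (hom_sol c) (hom_sol d) = (\<Sum>k\<in>UNIV. cnj (d $ k) * t $ k)"
proof -
  let ?G = "\<lambda>c. (\<chi> k. ip a b (hom_sol c) (fund_sol k)) :: complex ^ ('s + 's)"
  have fL: "fund_sol k \<in> L2_fun a b" "hom_sol c \<in> L2_fun a b" for k c by (intro MD_L2 fund_sol hom_sol)+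
  have lin: "Vector_Spaces.linear (*s) (*s) ?G"
    by (rule clinear_opI)
      (simp add: hom_sol_add_scale vec_eq_iff ip_add_left ip_scale_left L2_fun_scale fL)
  have exp: "ip a b (hom_sol c) (hom_sol d) = (\<Sum>k\<in>UNIV. cnj (d $ k) * ?G c $ k)" for c d
  proof -
    have "hom_sol d = (\<lambda>x. \<Sum>k\<in>UNIV. d $ k *s fund_sol k x)" by (simp add: hom_sol_def fun_eq_iff)
    then show ?thesis using fL by (simp add: ip_sum_right L2_fun_scale ip_scale_right)
  qed
  have inj0: "c = 0" if "?G c = 0" for c
  proof -
    have "ip a b (hom_sol c) (hom_sol c) = 0" unfolding exp that by simp
    then have "sqnorm a b (hom_sol c) = 0" by (simp add: ip_self)
    then have "AE x in Leb a b. hom_sol c x = 0" by (intro sqnorm_0_imp_AE fL)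
    then have "AE x in Leb a b. (\<lambda>_. 0) x = hom_sol c x" by eventually_elim simp
    from max_domain_AE_eq(1,2)[OF max_domain_0(1) hom_sol(1) this]
    have "data_a (hom_sol c) = 0" using max_domain_0(2)[of a] ab by (simp add: data_a_def vec_join_0)
    then show "c = 0" by (simp add: hom_sol)
  qed
  have "inj ?G" using vec.linear_inj_iff_eq_0[OF lin] inj0 by blast
  then have "surj ?G" by (rule vec.linear_inj_imp_surj[OF lin])
  then obtain c where t: "t = ?G c" by (rule surjE)
  show ?thesis
  proof (rule that[of c])
    show "ip a b (hom_sol c) (hom_sol d) = (\<Sum>k\<in>UNIV. cnj (d $ k) * t $ k)" for d
      unfolding t by (rule exp)
  qed
qed

lemma cdot_eq_imp_eq: "(\<And>v. cdot x v = cdot y v) \<Longrightarrow> x = y"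
  using cdot_self[of "x - y"] by (simp add: cdot_diff_left)

text \<open>Among the solutions of \<open>D2 y = h\<close> with zero data at \<^term>\<open>a\<close>, where \<open>h\<close> is a homogeneous solution,
  every value of the data at \<^term>\<open>b\<close> occurs: by Green's formula these data are determined by the inner
  products of \<open>h\<close> with the fundamental system, and the Gram matrix is invertible.\<close>

lemma boundary_control:
  obtains y where "y \<in> MD" "data_a y = 0" "data_b y = v"
proof -
  obtain \<beta> \<beta>' where v: "v = vec_join \<beta> \<beta>'" by (rule vec_join_cases)
  define t :: "complex ^ ('s + 's)" where "t = (\<chi> k. cdot \<beta>' (fund_sol k b) - cdot \<beta> (D1 (fund_sol k) b))"
  obtain c where c: "\<And>d. ip a b (hom_sol c) (hom_sol d) = (\<Sum>k\<in>UNIV. cnj (d $ k) * t $ k)"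
    using hom_sol_ip_surj[of t] by blast
  have hL: "hom_sol c \<in> L2_fun a b" for c by (intro MD_L2 hom_sol)
  obtain y where y: "y \<in> MD" "data_a y = 0" "AE x in Leb a b. D2 y x = hom_sol c x" using ivp_data[OF hL] by blast
  have ya: "y a = 0" "D1 y a = 0"
    using y(2) vec_join_eq_iff[of "y a" "D1 y a" 0 0] by (auto simp: data_a_def vec_join_0)
  have pair: "cdot \<beta>' (hom_sol d b) - cdot \<beta> (D1 (hom_sol d) b) = cdot (D1 y b) (hom_sol d b) - cdot (y b) (D1 (hom_sol d) b)" for d
  proof -
    have "ip a b y (D2 (hom_sol d)) - ip a b (D2 y) (hom_sol d) = cdot (y b) (D1 (hom_sol d) b) - cdot (D1 y b) (hom_sol d b)"
      using green[OF y(1) hom_sol(1)] by (simp add: ya)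
    moreover have "ip a b y (D2 (hom_sol d)) = 0"
      by (intro ip_zero_AE MD_L2 y hom_sol)
    moreover have "ip a b (D2 y) (hom_sol d) = ip a b (hom_sol c) (hom_sol d)"
      by (rule ip_cong_AE) (use y(3) in \<open>auto intro: MD_L2 y hL\<close>)
    ultimately have 1: "ip a b (hom_sol c) (hom_sol d) = cdot (D1 y b) (hom_sol d b) - cdot (y b) (D1 (hom_sol d) b)"
      by (simp add: minus_equation_iff[of "ip a b (hom_sol c) (hom_sol d)"])
    have 2: "data_b (hom_sol d) = (\<Sum>k\<in>UNIV. d $ k *s data_b (fund_sol k))"
    proof -
      have lin: "Vector_Spaces.linear (*s) (*s) (\<lambda>c. data_b (hom_sol c))"
        by (rule clinear_opI) (simp add: hom_sol_add_scale data_add_scale hom_sol)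
      have "hom_sol (axis k 1) = fund_sol k" for k
        by (rule ext) (simp add: hom_sol_def axis_def if_distrib[of "\<lambda>x. x *s _"] cong: if_cong)
      then show ?thesis
        using vec.linear_sum[OF lin, of "\<lambda>k. d $ k *s axis k 1" UNIV]
        by (simp add: basis_expansion vec.linear_scale[OF lin])
    qed
    have "hom_sol d b = (\<Sum>k\<in>UNIV. d $ k *s fund_sol k b)" by (simp add: hom_sol_def)
    moreover have "D1 (hom_sol d) b = (\<Sum>k\<in>UNIV. d $ k *s D1 (fund_sol k) b)"
    proof -
      have "D1 (hom_sol d) b $ i = (\<Sum>k\<in>UNIV. d $ k *s D1 (fund_sol k) b) $ i" for i
        using arg_cong[OF 2, of "\<lambda>v. v $ Inr i"] by (simp add: data_b_def vec_join_def sum_component)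
      then show ?thesis by (simp add: vec_eq_iff)
    qed
    ultimately have "cdot \<beta>' (hom_sol d b) - cdot \<beta> (D1 (hom_sol d) b) = (\<Sum>k\<in>UNIV. cnj (d $ k) * t $ k)"
      by (subst (1 2) cdot_commute)
        (simp add: cdot_sum_left cdot_scale_left t_def sum_subtractf algebra_simps, simp add: cdot_commute[of \<beta>] cdot_commute[of \<beta>'])
    then show ?thesis using 1 c by simp
  qed
  have "vec_join (- \<beta>) \<beta>' = vec_join (- y b) (D1 y b)"
  proof (rule cdot_eq_imp_eq)
    fix w :: "complex ^ ('s + 's)"
    obtain w1 w2 where w: "w = vec_join w1 w2" by (rule vec_join_cases)
    obtain d where "data_b (hom_sol d) = vec_join w2 w1" by (rule data_b_hom_sol_surj)
    then have "hom_sol d b = w2" "D1 (hom_sol d) b = w1" by (auto simp: data_b_def vec_join_eq_iff)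
    then show "cdot (vec_join (- \<beta>) \<beta>') w = cdot (vec_join (- y b) (D1 y b)) w"
      using pair[of d] by (simp add: w cdot_vec_join cdot_minus_left algebra_simps)
  qed
  then have "data_b y = v" by (simp add: data_b_def v vec_join_eq_iff)
  then show ?thesis using that y by blast
qed

lemma Gamma_surj:
  obtains y where "y \<in> MD" "Gamma1 a b p Q y = \<alpha>" "Gamma2 a b y = \<beta>"
proof -
  obtain \<alpha>1 \<alpha>2 where \<alpha>: "\<alpha> = vec_join \<alpha>1 \<alpha>2" by (rule vec_join_cases)
  obtain \<beta>1 \<beta>2 where \<beta>: "\<beta> = vec_join \<beta>1 \<beta>2" by (rule vec_join_cases)
  let ?h = "hom_sol (vec_join \<beta>1 \<alpha>1)"
  obtain z where z: "z \<in> MD" "data_a z = 0" "data_b z = vec_join \<beta>2 (- \<alpha>2) - data_b ?h" by (rule boundary_control)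
  let ?y = "\<lambda>x. ?h x + 1 *s z x"
  have y: "?y \<in> MD" by (intro max_domain_add_scale hom_sol z)
  have "data_a ?y = vec_join \<beta>1 \<alpha>1" "data_b ?y = vec_join \<beta>2 (- \<alpha>2)"
    by (simp_all only: data_add_scale[OF hom_sol(1) z(1)] z hom_sol) simp_all
  then have "Gamma1 a b p Q ?y = \<alpha>" "Gamma2 a b ?y = \<beta>"
    unfolding data_a_def data_b_def vec_join_eq_iff Gamma1_def Gamma2_def \<alpha> \<beta> by auto
  then show ?thesis using that y by blast
qed

text \<open>The domain of the minimal operator.\<close>

definition min_dom :: "(real \<Rightarrow> complex ^ 's) set" where
  "min_dom = {y \<in> MD. data_a y = 0 \<and> data_b y = 0}"

text \<open>The adjoint of the minimal operator is contained in the maximal operator. If \<open>w0\<close> is any solution of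
  \<open>D2 w0 = - z\<close>, then \<open>w - w0\<close> is orthogonal to the range of the minimal operator. By Green's formula
  this range contains the orthogonal complement of the homogeneous solutions, so that \<open>w - w0\<close> is a
  homogeneous solution.\<close>

lemma min_adjoint:
  assumes w: "w \<in> L2_fun a b" and z: "z \<in> L2_fun a b"
    and adj: "\<And>y. y \<in> min_dom \<Longrightarrow> ip a b (D2 y) w = - ip a b y z"
  obtains y where "y \<in> MD" "AE x in Leb a b. y x = w x" "AE x in Leb a b. D2 y x = - z x"
proof -
  have mz: "(\<lambda>x. - z x) \<in> L2_fun a b" by (rule L2_fun_minus[OF z])
  obtain w0 where w0: "w0 \<in> MD" "AE x in Leb a b. D2 w0 x = - z x" using ivp_data[OF mz] by blast
  define h where "h = (\<lambda>x. w x - w0 x)"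
  have hL: "h \<in> L2_fun a b" unfolding h_def by (intro L2_fun_diff w MD_L2 w0)
  have sL: "hom_sol c \<in> L2_fun a b" for c by (intro MD_L2 hom_sol)
  \<comment> \<open>A right-hand side \<open>f\<close> orthogonal to all homogeneous solutions is attained on \<open>min_dom\<close>.\<close>
  have orth: "ip a b f h = 0" if f: "f \<in> L2_fun a b" and fo: "\<And>d. ip a b f (hom_sol d) = 0" for f
  proof -
    obtain y where y: "y \<in> MD" "data_a y = 0" "AE x in Leb a b. D2 y x = f x" using ivp_data[OF f] by blast
    have ya: "y a = 0" "D1 y a = 0"
      using y(2) vec_join_eq_iff[of "y a" "D1 y a" 0 0] by (auto simp: data_a_def vec_join_0)
    have "vec_join (y b) (- D1 y b) = 0"
    proof (rule cdot_eq_imp_eq)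
      fix v :: "complex ^ ('s + 's)"
      obtain v1 v2 where v: "v = vec_join v1 v2" by (rule vec_join_cases)
      obtain d where "data_b (hom_sol d) = vec_join v2 v1" by (rule data_b_hom_sol_surj)
      then have d: "hom_sol d b = v2" "D1 (hom_sol d) b = v1" by (auto simp: data_b_def vec_join_eq_iff)
      have "ip a b y (D2 (hom_sol d)) - ip a b (D2 y) (hom_sol d) = cdot (y b) v1 - cdot (D1 y b) v2"
        using green[OF y(1) hom_sol(1)] by (simp add: ya d)
      moreover have "ip a b y (D2 (hom_sol d)) = 0"
        by (intro ip_zero_AE MD_L2 y hom_sol)
      moreover have "ip a b (D2 y) (hom_sol d) = ip a b f (hom_sol d)"
        by (rule ip_cong_AE) (use y(3) in \<open>auto intro: MD_L2 y sL f\<close>)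
      ultimately have "cdot (y b) v1 - cdot (D1 y b) v2 = 0" using fo by simp
      then show "cdot (vec_join (y b) (- D1 y b)) v = cdot 0 v"
        by (simp add: v cdot_vec_join cdot_minus_left)
    qed
    then have yb: "y b = 0" "D1 y b = 0"
      using vec_join_eq_iff[of "y b" "- D1 y b" 0 0] by (auto simp: vec_join_0)
    then have "y \<in> min_dom" using y by (simp add: min_dom_def data_b_def vec_join_0)
    then have "ip a b (D2 y) w = - ip a b y z" by (rule adj)
    moreover have "ip a b y (D2 w0) - ip a b (D2 y) w0 = 0"
      using green[OF y(1) w0(1)] by (simp add: ya yb)
    moreover have "ip a b y (D2 w0) = ip a b y (\<lambda>x. - z x)"
      by (rule ip_cong_AE) (use w0 in \<open>auto intro: MD_L2 y mz\<close>)
    moreover have "ip a b y (\<lambda>x. - z x) = - ip a b y z"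
      using ip_scale_right[of a b y "-1" z] by simp
    ultimately have "ip a b (D2 y) h = 0"
      unfolding h_def using w w0 y by (simp add: ip_diff_right MD_L2)
    moreover have "ip a b (D2 y) h = ip a b f h"
      by (rule ip_cong_AE) (use y(3) in \<open>auto intro: MD_L2 y hL f\<close>)
    ultimately show ?thesis by simp
  qed
  obtain c where c: "\<And>d. ip a b (hom_sol c) (hom_sol d) = (\<Sum>k\<in>UNIV. cnj (d $ k) * (\<chi> k. ip a b h (fund_sol k)) $ k)"
    using hom_sol_ip_surj[of "\<chi> k. ip a b h (fund_sol k)"] by blast
  have hd: "ip a b h (hom_sol d) = ip a b (hom_sol c) (hom_sol d)" for d
  proof -
    have "hom_sol d = (\<lambda>x. \<Sum>k\<in>UNIV. d $ k *s fund_sol k x)" by (simp add: hom_sol_def fun_eq_iff)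
    then have "ip a b h (hom_sol d) = (\<Sum>k\<in>UNIV. cnj (d $ k) * ip a b h (fund_sol k))"
      using hL MD_L2(1)[OF fund_sol(1)] by (simp add: ip_sum_right L2_fun_scale ip_scale_right)
    then show ?thesis by (simp add: c)
  qed
  let ?f = "\<lambda>x. h x - hom_sol c x"
  have fL: "?f \<in> L2_fun a b" by (intro L2_fun_diff hL sL)
  have fo: "ip a b ?f (hom_sol d) = 0" for d
    by (simp add: ip_diff_left hL sL hd)
  have "ip a b ?f ?f = ip a b ?f h - ip a b ?f (hom_sol c)" by (rule ip_diff_right[OF hL sL fL])
  also have "\<dots> = 0" using orth[OF fL fo] fo by simp
  finally have "sqnorm a b ?f = 0" by (simp add: ip_self)
  then have fae: "AE x in Leb a b. ?f x = 0" by (rule sqnorm_0_imp_AE[OF fL])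
  show ?thesis
  proof (rule that[of "\<lambda>x. w0 x + 1 *s hom_sol c x"])
    show "(\<lambda>x. w0 x + 1 *s hom_sol c x) \<in> MD" by (intro max_domain_add_scale w0 hom_sol)
    show "AE x in Leb a b. w0 x + 1 *s hom_sol c x = w x"
      using fae by eventually_elim (simp add: h_def algebra_simps)
    show "AE x in Leb a b. D2 (\<lambda>x. w0 x + 1 *s hom_sol c x) x = - z x"
      using max_domain_add_scale(3)[OF w0(1) hom_sol(1), of 1 c] hom_sol(3)[of c] w0(2) by eventually_elim simp
  qed
qed

text \<open>A function orthogonal to the minimal domain is \<open>- D2 y\<close> for a representative \<open>y\<close> of zero, by
  \<open>min_adjoint\<close>.\<close>

lemma min_dom_dense:
  assumes f: "f \<in> L2_fun a b" and "\<epsilon> > 0"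
  obtains y where "y \<in> min_dom" "sqnorm a b (\<lambda>x. f x - y x) < \<epsilon>"
proof (rule L2_dense_if_orthogonal_trivial[of min_dom a b, OF _ _ _ _ f \<open>\<epsilon> > 0\<close>])
  show "min_dom \<subseteq> L2_fun a b" by (auto simp: min_dom_def MD_L2)
  show "(\<lambda>_. 0) \<in> min_dom"
    using max_domain_0 ab by (simp add: min_dom_def data_a_def data_b_def vec_join_0)
  show "(\<lambda>x. f x + c *s g x) \<in> min_dom" if "f \<in> min_dom" "g \<in> min_dom" for f g c
    using that by (auto simp: min_dom_def data_add_scale intro: max_domain_add_scale)
  show "AE x in Leb a b. h x = 0" if h: "h \<in> L2_fun a b" and o: "\<And>y. y \<in> min_dom \<Longrightarrow> ip a b y h = 0" for h
  proof -
    have *: "ip a b (D2 y) (\<lambda>_. 0) = - ip a b y h" if "y \<in> min_dom" for y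
      using o[OF that] by (simp add: ip_def)
    obtain y where y: "y \<in> MD" "AE x in Leb a b. y x = 0" "AE x in Leb a b. D2 y x = - h x"
      by (rule min_adjoint[OF L2_fun_0 h *])
    have "AE x in Leb a b. (\<lambda>_. 0) x = y x" using y(2) by eventually_elim simp
    from max_domain_AE_eq(3)[OF max_domain_0(1) y(1) this] max_domain_0(3) y(3)
    show ?thesis by eventually_elim simp
  qed
qed (use that in blast)

end

section \<open>The maximal and the minimal operator as graphs\<close>

context coefficients begin

text \<open>\<open>G1\<close> and \<open>G2\<close> are the boundary maps, \<open>lop\<close> is the differential expression, and \<open>cl\<close> forms
  equivalence classes.\<close>

abbreviation "G1 \<equiv> Gamma1 a b p Q"
abbreviation "G2 \<equiv> Gamma2 a b"
abbreviation "lop y \<equiv> (\<lambda>x. - D2 y x)"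
abbreviation "cl \<equiv> L2_class a b"

text \<open>The point of the graph of the maximal operator that belongs to \<^term>\<open>y\<close>.\<close>

definition graph_pt :: "(real \<Rightarrow> complex ^ 's) \<Rightarrow> 's l2 \<times> 's l2" where
  "graph_pt y = (cl y, cl (lop y))"

lemma restr_max_op_eq: "restr_max_op a b p Q P = {graph_pt y | y. y \<in> MD \<and> P y}"
  by (simp add: restr_max_op_def graph_pt_def)

lemma lop_L2: "y \<in> MD \<Longrightarrow> lop y \<in> L2_fun a b"
  by (intro L2_fun_minus MD_L2)

lemma graph_pt_eq_imp:
  assumes y: "y \<in> MD" "y' \<in> MD" and eq: "cl y = cl y'"
  shows "graph_pt y = graph_pt y'" "G1 y = G1 y'" "G2 y = G2 y'"
proof -
  have ae: "AE x in Leb a b. y x = y' x" using eq y by (simp add: L2_class_eq_iff MD_L2)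
  note m = max_domain_AE_eq[OF y ae]
  show "G1 y = G1 y'" "G2 y = G2 y'" using m ab by (simp_all add: Gamma1_def Gamma2_def)
  have "AE x in Leb a b. lop y x = lop y' x" using m(3) by eventually_elim simp
  then have "cl (lop y) = cl (lop y')" using y by (simp add: L2_class_eq_iff lop_L2)
  then show "graph_pt y = graph_pt y'" using eq by (simp add: graph_pt_def)
qed

lemma G_add_scale:
  assumes "y \<in> MD" "z \<in> MD"
  shows "G1 (\<lambda>x. y x + c *s z x) = G1 y + c *s G1 z" "G2 (\<lambda>x. y x + c *s z x) = G2 y + c *s G2 z"
  using max_domain_add_scale(2)[OF assms] ab
  by (simp_all add: Gamma1_def Gamma2_def vec_join_add_scale vec.scale_minus_right algebra_simps)

lemma G_0: "G1 (\<lambda>_. 0) = 0" "G2 (\<lambda>_. 0) = 0"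
  using max_domain_0(2) ab by (simp_all add: Gamma1_def Gamma2_def vec_join_0)

lemma graph_pt_add_scale:
  assumes "y \<in> MD" "z \<in> MD"
  shows "graph_pt (\<lambda>x. y x + c *s z x) = (cl (\<lambda>x. y x + c *s z x), cl (\<lambda>x. lop y x + c *s lop z x))"
proof -
  have "AE x in Leb a b. lop (\<lambda>x. y x + c *s z x) x = lop y x + c *s lop z x"
    using max_domain_add_scale(3)[OF assms, of c] by eventually_elim (simp add: vec.scale_minus_right)
  then have "cl (lop (\<lambda>x. y x + c *s z x)) = cl (\<lambda>x. lop y x + c *s lop z x)"
    by (rule L2_class_eq_iff[THEN iffD2, rotated 2])
      (intro lop_L2 max_domain_add_scale assms L2_fun_add L2_fun_scale)+
  then show ?thesis by (simp add: graph_pt_def)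
qed

lemma graph_pt_add_scale_mem:
  assumes "linear_operator a b T" "y \<in> MD" "z \<in> MD" "graph_pt y \<in> T" "graph_pt z \<in> T"
  shows "graph_pt (\<lambda>x. y x + c *s z x) \<in> T"
  unfolding graph_pt_add_scale[OF assms(2,3)]
  using assms by (intro linear_operatorD(3)[OF assms(1)]) (auto simp: graph_pt_def MD_L2 lop_L2)

lemma graph_pt_0: "graph_pt (\<lambda>_. 0) = (cl (\<lambda>_. 0), cl (\<lambda>_. 0))"
proof -
  have "AE x in Leb a b. lop (\<lambda>_. 0) x = 0" using max_domain_0(3) by eventually_elim simp
  then have "cl (lop (\<lambda>_. 0)) = cl (\<lambda>_. 0)"
    by (subst L2_class_eq_iff) (auto intro: lop_L2 max_domain_0 L2_fun_0)
  then show ?thesis by (simp add: graph_pt_def)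
qed

lemma linear_operator_restr:
  assumes P0: "P (\<lambda>_. 0)" and Padd: "\<And>y z c. \<lbrakk>y \<in> MD; z \<in> MD; P y; P z\<rbrakk> \<Longrightarrow> P (\<lambda>x. y x + c *s z x)"
  shows "linear_operator a b (restr_max_op a b p Q P)"
proof -
  let ?T = "restr_max_op a b p Q P"
  have memI: "graph_pt y \<in> ?T" if "y \<in> MD" "P y" for y using that by (auto simp: restr_max_op_eq)
  have "?T \<subseteq> L2 a b \<times> L2 a b"
    by (auto simp: restr_max_op_eq graph_pt_def intro!: L2_class_in_L2 MD_L2 lop_L2)
  moreover have "single_valued ?T"
    unfolding single_valued_def using graph_pt_eq_imp(1) by (auto simp: restr_max_op_eq graph_pt_def)
  moreover have "(cl (\<lambda>_. 0), cl (\<lambda>_. 0)) \<in> ?T" using memI[OF max_domain_0(1) P0] by (simp add: graph_pt_0)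
  moreover have "(L2_add a b u u', L2_add a b v v') \<in> ?T" if uv: "(u, v) \<in> ?T" "(u', v') \<in> ?T" for u v u' v'
  proof -
    obtain y y' where y: "y \<in> MD" "P y" "(u, v) = graph_pt y" "y' \<in> MD" "P y'" "(u', v') = graph_pt y'"
      using uv by (auto simp: restr_max_op_eq)
    have "graph_pt (\<lambda>x. y x + 1 *s y' x) \<in> ?T" by (intro memI Padd max_domain_add_scale y)
    then show ?thesis using y by (simp only: graph_pt_add_scale) (simp add: graph_pt_def L2_add_class MD_L2 lop_L2)
  qed
  moreover have "(L2_scale a b c u, L2_scale a b c v) \<in> ?T" if uv: "(u, v) \<in> ?T" for u v c
  proof -
    obtain y where y: "y \<in> MD" "P y" "(u, v) = graph_pt y" using uv by (auto simp: restr_max_op_eq)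
    have "graph_pt (\<lambda>x. 0 + c *s y x) \<in> ?T" by (intro memI Padd[OF max_domain_0(1)] max_domain_add_scale max_domain_0 P0 y)
    moreover have "graph_pt (\<lambda>x. 0 + c *s y x) = (cl (\<lambda>x. 0 + c *s y x), cl (\<lambda>x. c *s lop y x))"
    proof -
      have "AE x in Leb a b. lop (\<lambda>_. 0) x + c *s lop y x = c *s lop y x"
        using max_domain_0(3) by eventually_elim simp
      then have "cl (\<lambda>x. lop (\<lambda>_. 0) x + c *s lop y x) = cl (\<lambda>x. c *s lop y x)"
        by (rule L2_class_eq_iff[THEN iffD2, rotated 2])
          (intro lop_L2 max_domain_0 y L2_fun_add L2_fun_scale)+
      then show ?thesis by (simp only: graph_pt_add_scale[OF max_domain_0(1) y(1)])
    qed
    ultimately show ?thesis using y by (simp add: graph_pt_def L2_scale_class MD_L2 lop_L2)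
  qed
  ultimately show ?thesis unfolding linear_operator_def by blast
qed

lemma L_min_eq: "L_min a b p Q = {graph_pt y | y. y \<in> min_dom}"
  by (auto simp: L_min_def restr_max_op_eq min_dom_def data_a_def data_b_def vec_join_0
     vec_join_eq_iff[where u' = 0 and v' = 0, unfolded vec_join_0])

lemma min_dom_G: "y \<in> min_dom \<longleftrightarrow> y \<in> MD \<and> G1 y = 0 \<and> G2 y = 0"
  by (auto simp: min_dom_def data_a_def data_b_def Gamma1_def Gamma2_def
     vec_join_eq_iff[where u' = 0 and v' = 0, unfolded vec_join_0])

lemma green_G:
  assumes "y \<in> MD" "z \<in> MD"
  shows "ip a b (lop y) z - ip a b y (lop z) = cdot (G1 y) (G2 z) - cdot (G2 y) (G1 z)"
proof -
  have "ip a b (lop y) z = - ip a b (D2 y) z" using ip_scale_left[of a b "-1" "D2 y" z] by simp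
  moreover have "ip a b y (lop z) = - ip a b y (D2 z)" using ip_scale_right[of a b y "-1" "D2 z"] by simp
  ultimately show ?thesis
    using green[OF assms] by (simp add: Gamma1_def Gamma2_def cdot_vec_join cdot_minus_left cdot_minus_right algebra_simps)
qed

lemma densely_defined_extension:
  assumes "L_min a b p Q \<subseteq> T"
  shows "densely_defined a b T"
  unfolding densely_defined_def
proof (intro ballI allI impI)
  fix u :: "'s l2" and \<epsilon> :: real assume u: "u \<in> L2 a b" and "\<epsilon> > 0"
  obtain f where f: "f \<in> L2_fun a b" "u = cl f" by (rule L2_cases[OF u])
  have "\<epsilon>\<^sup>2 > 0" using \<open>\<epsilon> > 0\<close> by simp
  obtain y where y: "y \<in> min_dom" "sqnorm a b (\<lambda>x. f x - y x) < \<epsilon>\<^sup>2" by (rule min_dom_dense[OF f(1) \<open>\<epsilon>\<^sup>2 > 0\<close>])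
  have yL: "y \<in> L2_fun a b" using y by (auto simp: min_dom_def MD_L2)
  have "graph_pt y \<in> T" using y assms by (auto simp: L_min_eq)
  then have "cl y \<in> Domain T" by (auto simp: graph_pt_def)
  moreover have "L2_norm a b (L2_add a b u (L2_scale a b (-1) (cl y))) = sqrt (sqnorm a b (\<lambda>x. f x - y x))"
    using f yL by (simp add: L2_scale_class L2_add_class L2_fun_scale L2_norm_class L2_fun_add L2_fun_minus L2_fun_diff)
  moreover have "sqrt (sqnorm a b (\<lambda>x. f x - y x)) < \<epsilon>" using y(2) \<open>\<epsilon> > 0\<close> by (simp add: real_less_lsqrt sqnorm_nonneg)
  ultimately show "\<exists>v\<in>Domain T. L2_norm a b (L2_add a b u (L2_scale a b (- 1) v)) < \<epsilon>" by force
qed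

lemma inner_graph_pt:
  "y \<in> MD \<Longrightarrow> z \<in> MD \<Longrightarrow> L2_inner a b (snd (graph_pt y)) (fst (graph_pt z)) = ip a b (lop y) z"
  "y \<in> MD \<Longrightarrow> z \<in> MD \<Longrightarrow> L2_inner a b (fst (graph_pt y)) (snd (graph_pt z)) = ip a b y (lop z)"
  by (simp_all add: graph_pt_def L2_inner_class MD_L2 lop_L2)

lemma L_min_symmetric:
  assumes "(u, v) \<in> L_min a b p Q"
  shows "Im (L2_inner a b v u) = 0"
proof -
  obtain y where y: "y \<in> min_dom" "(u, v) = graph_pt y" using assms by (auto simp: L_min_eq)
  then have yM: "y \<in> MD" "G1 y = 0" "G2 y = 0" by (auto simp: min_dom_G)
  have "ip a b (lop y) y = ip a b y (lop y)" using green_G[OF yM(1) yM(1)] yM by simp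
  then have "ip a b (lop y) y = cnj (ip a b (lop y) y)" by (metis ip_commute)
  then have "Im (ip a b (lop y) y) = 0" by (simp add: complex_eq_iff)
  then show ?thesis using inner_graph_pt(1)[OF yM(1) yM(1)] y(2)[symmetric] by simp
qed

lemma L_min_adjoint_subset:
  assumes "uv \<in> L2_adjoint a b (L_min a b p Q)"
  obtains y where "y \<in> MD" "uv = graph_pt y"
proof -
  obtain u v where uv: "uv = (u, v)" "u \<in> L2 a b" "v \<in> L2 a b" using assms by (auto simp: L2_adjoint_def)
  obtain f where f: "f \<in> L2_fun a b" "u = cl f" by (rule L2_cases[OF uv(2)])
  obtain g where g: "g \<in> L2_fun a b" "v = cl g" by (rule L2_cases[OF uv(3)])
  have *: "ip a b (D2 y) f = - ip a b y g" if "y \<in> min_dom" for y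
  proof -
    have y: "y \<in> MD" using that by (simp add: min_dom_def)
    have "graph_pt y \<in> L_min a b p Q" using that by (auto simp: L_min_eq)
    then have "L2_inner a b (cl (lop y)) u = L2_inner a b (cl y) v"
      using assms unfolding uv L2_adjoint_def graph_pt_def by blast
    then have "ip a b (lop y) f = ip a b y g" using f g y by (simp add: L2_inner_class MD_L2 lop_L2)
    moreover have "ip a b (lop y) f = - ip a b (D2 y) f" using ip_scale_left[of a b "-1" "D2 y" f] by simp
    ultimately show ?thesis by (simp add: minus_equation_iff[of "ip a b (D2 y) f"])
  qed
  obtain y where y: "y \<in> MD" "AE x in Leb a b. y x = f x" "AE x in Leb a b. D2 y x = - g x"
    by (rule min_adjoint[OF f(1) g(1) *])
  have "AE x in Leb a b. lop y x = g x" using y(3) by eventually_elim simp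
  then have "graph_pt y = uv"
    using y f g by (simp add: graph_pt_def uv L2_class_eq_iff MD_L2 lop_L2)
  then show ?thesis using that y by blast
qed

text \<open>Every dissipative or accumulative extension of the minimal operator is a restriction of the maximal
  operator.\<close>

lemma extension_in_max:
  assumes "sdissipative \<sigma> a b T" "L_min a b p Q \<subseteq> T" "\<sigma> \<noteq> 0" "uv \<in> T"
  obtains y where "y \<in> MD" "uv = graph_pt y"
  using sdissipative_extension_subset_adjoint[OF assms(1-3) L_min_symmetric] assms(4)
  by (meson L_min_adjoint_subset subsetD that)

end

section \<open>Boundary conditions and maximal dissipative extensions\<close>

text \<open>The sign treats the two families of boundary conditions at once: \<open>\<sigma> = 1\<close> gives the dissipative and
  \<open>\<sigma> = - 1\<close> the accumulative extensions.\<close>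

locale signed_coefficients = coefficients a b p Q for a b p and Q :: "real \<Rightarrow> complex ^ 's ^ ('s::finite)" +
  fixes \<sigma> :: real
  assumes sigma_square: "\<sigma> * \<sigma> = 1"
begin

text \<open>The Cayley transform of the boundary values. The boundary condition of \<^term>\<open>K\<close> says that \<^term>\<open>K\<close>
  maps \<open>xi y\<close> to \<open>eta y\<close>.\<close>

definition xi :: "(real \<Rightarrow> complex ^ 's) \<Rightarrow> complex ^ ('s + 's)" where
  "xi y = G1 y + (of_real \<sigma> * \<i>) *s G2 y"

definition eta :: "(real \<Rightarrow> complex ^ 's) \<Rightarrow> complex ^ ('s + 's)" where
  "eta y = G1 y - (of_real \<sigma> * \<i>) *s G2 y"

text \<open>The restriction of the maximal operator by the boundary condition of \<^term>\<open>K\<close>.\<close>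

definition boundary_op :: "(complex ^ ('s + 's) \<Rightarrow> complex ^ ('s + 's)) \<Rightarrow> 's l2_op" where
  "boundary_op K = restr_max_op a b p Q (\<lambda>y. (K (G1 y) - G1 y) + (of_real \<sigma> * \<i>) *s (K (G2 y) + G2 y) = 0)"

lemma sigma_nonzero: "\<sigma> \<noteq> 0" using sigma_square by auto

lemma xi_eta_add_scale:
  assumes "y \<in> MD" "z \<in> MD"
  shows "xi (\<lambda>x. y x + c *s z x) = xi y + c *s xi z" "eta (\<lambda>x. y x + c *s z x) = eta y + c *s eta z"
  by (simp_all add: xi_def eta_def G_add_scale[OF assms] vec_eq_iff algebra_simps)

lemma xi_eta_0: "xi (\<lambda>_. 0) = 0" "eta (\<lambda>_. 0) = 0"
  by (simp_all add: xi_def eta_def G_0)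

lemma xi_eta_surj: obtains y where "y \<in> MD" "xi y = \<xi>" "eta y = \<eta>"
proof -
  obtain y where y: "y \<in> MD" "G1 y = (1/2) *s (\<xi> + \<eta>)" "G2 y = (- of_real \<sigma> * \<i> / 2) *s (\<xi> - \<eta>)"
    by (rule Gamma_surj)
  have "complex_of_real \<sigma> * complex_of_real \<sigma> = 1" by (simp flip: of_real_mult add: sigma_square)
  then have s: "(of_real \<sigma> * \<i>) *s G2 y = (1/2) *s (\<xi> - \<eta>)"
    unfolding y(3) vec.scale_scale by (simp add: algebra_simps)
  have "xi y = \<xi>" "eta y = \<eta>" unfolding xi_def eta_def s y(2) by (simp_all add: vec_eq_iff field_simps)
  then show ?thesis using that y by blast
qed

lemma boundary_op_cond_iff:
  assumes "clinear_op K"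
  shows "(K (G1 y) - G1 y) + (of_real \<sigma> * \<i>) *s (K (G2 y) + G2 y) = 0 \<longleftrightarrow> K (xi y) = eta y"
proof -
  have "K (xi y) = K (G1 y) + (of_real \<sigma> * \<i>) *s K (G2 y)"
    unfolding xi_def by (simp add: vec.linear_add[OF assms] vec.linear_scale[OF assms])
  then have "(K (G1 y) - G1 y) + (of_real \<sigma> * \<i>) *s (K (G2 y) + G2 y) = K (xi y) - eta y"
    unfolding eta_def by (simp add: vec.scale_right_distrib algebra_simps)
  then show ?thesis by simp
qed

lemma boundary_op_eq:
  assumes "clinear_op K"
  shows "boundary_op K = {graph_pt y | y. y \<in> MD \<and> K (xi y) = eta y}"
  unfolding boundary_op_def restr_max_op_eq boundary_op_cond_iff[OF assms] ..

lemma xi_eta_cong: "\<lbrakk>y \<in> MD; y' \<in> MD; graph_pt y = graph_pt y'\<rbrakk> \<Longrightarrow> xi y = xi y' \<and> eta y = eta y'"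
  using graph_pt_eq_imp(2,3)[of y y'] by (simp add: xi_def eta_def graph_pt_def)

lemma graph_pt_mem_boundary_op_iff:
  assumes "clinear_op K" "y \<in> MD"
  shows "graph_pt y \<in> boundary_op K \<longleftrightarrow> K (xi y) = eta y"
proof
  assume "graph_pt y \<in> boundary_op K"
  then obtain y' where y': "graph_pt y = graph_pt y'" "y' \<in> MD" "K (xi y') = eta y'" unfolding boundary_op_eq[OF assms(1)] by blast
  then show "K (xi y) = eta y" using xi_eta_cong[OF assms(2) y'(2,1)] by simp
next
  assume "K (xi y) = eta y"
  then show "graph_pt y \<in> boundary_op K" using assms(2) unfolding boundary_op_eq[OF assms(1)] by blast
qed

text \<open>In the transformed boundary values the boundary form is a difference of two inner products. So
  dissipativity means that \<open>eta y\<close> is no longer than \<open>xi y\<close>, and symmetry that inner products are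
  preserved.\<close>

lemma green_xi_eta:
  assumes "y \<in> MD" "z \<in> MD"
  shows "ip a b (lop y) z - ip a b y (lop z) = (of_real \<sigma> * \<i> / 2) * (cdot (xi y) (xi z) - cdot (eta y) (eta z))"
proof -
  have ss: "complex_of_real \<sigma> * complex_of_real \<sigma> = 1" by (simp flip: of_real_mult add: sigma_square)
  have D: "cdot (xi y) (xi z) - cdot (eta y) (eta z) =
    - 2 * of_real \<sigma> * \<i> * (cdot (G1 y) (G2 z) - cdot (G2 y) (G1 z))"
    unfolding xi_def eta_def by (simp add: cdot_simps algebra_simps)
  have "(of_real \<sigma> * \<i> / 2) * (cdot (xi y) (xi z) - cdot (eta y) (eta z)) =
    (complex_of_real \<sigma> * complex_of_real \<sigma>) * (cdot (G1 y) (G2 z) - cdot (G2 y) (G1 z))"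
    unfolding D by (simp add: algebra_simps)
  then show ?thesis using green_G[OF assms] ss by simp
qed

lemma sigma_Im:
  assumes y: "y \<in> MD"
  shows "\<sigma> * Im (ip a b (lop y) y) = ((norm (xi y))\<^sup>2 - (norm (eta y))\<^sup>2) / 4"
proof -
  have "ip a b (lop y) y - cnj (ip a b (lop y) y) =
    (of_real \<sigma> * \<i> / 2) * (of_real ((norm (xi y))\<^sup>2) - of_real ((norm (eta y))\<^sup>2))"
    using green_xi_eta[OF y y] by (simp add: cdot_self ip_commute[of a b "lop y" y])
  then have "2 * Im (ip a b (lop y) y) = \<sigma> / 2 * ((norm (xi y))\<^sup>2 - (norm (eta y))\<^sup>2)"
    by (simp add: complex_eq_iff)
  then have "\<sigma> * (2 * Im (ip a b (lop y) y)) = (\<sigma> * \<sigma>) / 2 * ((norm (xi y))\<^sup>2 - (norm (eta y))\<^sup>2)" by simp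
  then show ?thesis using sigma_square by simp
qed

lemma L_min_subset_boundary_op:
  assumes "clinear_op K" shows "L_min a b p Q \<subseteq> boundary_op K"
  using vec.linear_0[OF assms] by (auto simp: L_min_eq min_dom_G boundary_op_eq[OF assms] xi_def eta_def)

lemma linear_operator_boundary_op:
  assumes "clinear_op K" shows "linear_operator a b (boundary_op K)"
  unfolding boundary_op_def boundary_op_cond_iff[OF assms]
  by (rule linear_operator_restr)
    (simp_all add: xi_eta_0 xi_eta_add_scale vec.linear_0[OF assms] vec.linear_add[OF assms] vec.linear_scale[OF assms])

lemma sdissipative_boundary_op:
  assumes "contracting K" shows "sdissipative \<sigma> a b (boundary_op K)"
proof -
  have lin: "clinear_op K" using assms by (simp add: contracting_def)
  have "0 \<le> \<sigma> * Im (L2_inner a b v u)" if uv: "(u, v) \<in> boundary_op K" for u v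
  proof -
    obtain y where y: "y \<in> MD" "K (xi y) = eta y" "(u, v) = graph_pt y" using uv by (auto simp: boundary_op_eq[OF lin])
    have "L2_inner a b v u = ip a b (lop y) y" using inner_graph_pt(1)[OF y(1) y(1)] y(3)[symmetric] by simp
    moreover have le: "(norm (eta y))\<^sup>2 \<le> (norm (xi y))\<^sup>2"
      using contracting_norm_le[OF assms, of "xi y"] y(2) by (intro power_mono) auto
    moreover have "0 \<le> \<sigma> * Im (ip a b (lop y) y)" unfolding sigma_Im[OF y(1)] using le by simp
    ultimately show ?thesis by simp
  qed
  then show ?thesis unfolding sdissipative_def
    using linear_operator_boundary_op[OF lin] densely_defined_extension[OF L_min_subset_boundary_op[OF lin]] by blast
qed

text \<open>Maximal dissipative or maximal accumulative operators, according to the sign.\<close>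

definition smaximal :: "'s l2_op \<Rightarrow> bool" where
  "smaximal T \<longleftrightarrow> sdissipative \<sigma> a b T \<and> (\<forall>T'. sdissipative \<sigma> a b T' \<and> T \<subseteq> T' \<longrightarrow> T' = T)"

lemma sdissipative_norm_le:
  assumes "sdissipative \<sigma> a b T" "y \<in> MD" "graph_pt y \<in> T"
  shows "norm (eta y) \<le> norm (xi y)"
proof -
  have "0 \<le> \<sigma> * Im (L2_inner a b (snd (graph_pt y)) (fst (graph_pt y)))"
    using assms(1,3) unfolding sdissipative_def by (metis (mono_tags, lifting) case_prodD prod.collapse)
  then have "(norm (eta y))\<^sup>2 \<le> (norm (xi y))\<^sup>2" using inner_graph_pt(1)[OF assms(2,2)] sigma_Im[OF assms(2)] by simp
  then show ?thesis by (rule power2_le_imp_le) simp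
qed

text \<open>If \<open>y\<close> belongs to a dissipative extension, then so does \<open>y - z\<close>, where \<open>z\<close> satisfies the boundary
  condition and \<open>xi z = xi y\<close>. Since \<open>xi (y - z) = 0\<close>, also \<open>eta (y - z) = 0\<close>.\<close>

lemma smaximal_boundary_op:
  assumes K: "contracting K" shows "smaximal (boundary_op K)"
  unfolding smaximal_def
proof (intro conjI sdissipative_boundary_op[OF K] allI impI)
  have lin: "clinear_op K" using K by (simp add: contracting_def)
  fix T' assume T': "sdissipative \<sigma> a b T' \<and> boundary_op K \<subseteq> T'"
  then have sd: "sdissipative \<sigma> a b T'" and sub: "boundary_op K \<subseteq> T'" by auto
  have linT: "linear_operator a b T'" using sd by (simp add: sdissipative_def)
  have min: "L_min a b p Q \<subseteq> T'" using L_min_subset_boundary_op[OF lin] sub by blast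
  have "T' \<subseteq> boundary_op K"
  proof
    fix uv assume uv: "uv \<in> T'"
    obtain y where y: "y \<in> MD" "uv = graph_pt y" by (rule extension_in_max[OF sd min sigma_nonzero uv])
    obtain z where z: "z \<in> MD" "xi z = xi y" "eta z = K (xi y)" by (rule xi_eta_surj)
    have "graph_pt z \<in> boundary_op K" using z graph_pt_mem_boundary_op_iff[OF lin] by simp
    then have "graph_pt (\<lambda>x. y x + (-1) *s z x) \<in> T'" using sub uv y z by (intro graph_pt_add_scale_mem[OF linT]) auto
    from sdissipative_norm_le[OF sd max_domain_add_scale(1)[OF y(1) z(1)] this]
    have "eta y = K (xi y)" using xi_eta_add_scale[OF y(1) z(1), of "-1"] z by simp
    then show "uv \<in> boundary_op K" using y graph_pt_mem_boundary_op_iff[OF lin] by simp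
  qed
  then show "T' = boundary_op K" using sub by blast
qed

text \<open>The pairs \<open>(xi y, eta y)\<close> of a dissipative extension form a norm-decreasing relation. Any
  contraction \<^term>\<open>K\<close> extending it gives a dissipative extension of \<^term>\<open>T\<close>, which is \<^term>\<open>T\<close> by
  maximality.\<close>

lemma smaximal_extension_is_boundary_op:
  assumes min: "L_min a b p Q \<subseteq> T" and max: "smaximal T"
  obtains K where "contracting K" "T = boundary_op K"
proof -
  have sd: "sdissipative \<sigma> a b T" using max by (simp add: smaximal_def)
  then have linT: "linear_operator a b T" by (simp add: sdissipative_def)
  define Rel where "Rel = {(xi y, eta y) | y. y \<in> MD \<and> graph_pt y \<in> T}"
  have "graph_pt (\<lambda>_. 0) \<in> T" using linT by (simp add: graph_pt_0 linear_operator_def)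
  then have R0: "(0, 0) \<in> Rel" using max_domain_0(1) xi_eta_0 unfolding Rel_def by force
  have Radd: "(s + c *s s', t + c *s t') \<in> Rel" if st: "(s, t) \<in> Rel" "(s', t') \<in> Rel" for s t s' t' c
  proof -
    obtain y z where yz: "y \<in> MD" "graph_pt y \<in> T" "s = xi y" "t = eta y" "z \<in> MD" "graph_pt z \<in> T" "s' = xi z" "t' = eta z"
      using st by (auto simp: Rel_def)
    show ?thesis unfolding Rel_def mem_Collect_eq
      using yz graph_pt_add_scale_mem[OF linT yz(1,5,2,6), of c] max_domain_add_scale(1)[OF yz(1,5), of c]
        xi_eta_add_scale[OF yz(1,5), of c] by (intro exI[of _ "\<lambda>x. y x + c *s z x"]) auto
  qed
  have Rle: "norm t \<le> norm s" if "(s, t) \<in> Rel" for s t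
    using that sdissipative_norm_le[OF sd] by (auto simp: Rel_def)
  obtain K where K: "contracting K" "\<And>s t. (s, t) \<in> Rel \<Longrightarrow> K s = t"
    using contraction_extension[OF R0 Radd Rle] by blast
  have lin: "clinear_op K" using K(1) by (simp add: contracting_def)
  have "T \<subseteq> boundary_op K"
  proof
    fix uv assume uv: "uv \<in> T"
    obtain y where y: "y \<in> MD" "uv = graph_pt y" by (rule extension_in_max[OF sd min sigma_nonzero uv])
    have "(xi y, eta y) \<in> Rel" using y uv by (auto simp: Rel_def)
    then show "uv \<in> boundary_op K" using K(2) y graph_pt_mem_boundary_op_iff[OF lin] by simp
  qed
  then have "boundary_op K = T" using max sdissipative_boundary_op[OF K(1)] by (simp add: smaximal_def)
  then show ?thesis using that K(1) by blast
qed

text \<open>Symmetry of the operator is preservation of inner products by \<open>K\<close>. If \<open>K\<close> is also surjective, the adjoint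
  is given by the same boundary condition.\<close>

lemma self_adjoint_boundary_op_iff:
  assumes lin: "clinear_op K"
  shows "self_adjoint a b (boundary_op K) \<longleftrightarrow> unitary_op K"
proof
  have green': "ip a b (lop y) z = ip a b y (lop z) \<longleftrightarrow> cdot (xi y) (xi z) = cdot (eta y) (eta z)"
    if "y \<in> MD" "z \<in> MD" for y z
    using green_xi_eta[OF that] sigma_nonzero
    by (metis (no_types, lifting) complex_i_not_zero divide_eq_0_iff eq_iff_diff_eq_0 mult_eq_0_iff of_real_eq_0_iff zero_neq_numeral)
  {
    assume sa: "self_adjoint a b (boundary_op K)"
    have iso: "cdot (K s) (K t) = cdot s t" for s t
    proof -
      obtain y where y: "y \<in> MD" "xi y = s" "eta y = K s" by (rule xi_eta_surj)
      obtain z where z: "z \<in> MD" "xi z = t" "eta z = K t" by (rule xi_eta_surj)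
      have "graph_pt y \<in> boundary_op K" "graph_pt z \<in> boundary_op K" using y z graph_pt_mem_boundary_op_iff[OF lin] by auto
      then have "graph_pt z \<in> L2_adjoint a b (boundary_op K)" "graph_pt y \<in> boundary_op K" using sa by (auto simp: self_adjoint_def)
      then have "L2_inner a b (snd (graph_pt y)) (fst (graph_pt z)) = L2_inner a b (fst (graph_pt y)) (snd (graph_pt z))"
        unfolding L2_adjoint_def by (auto simp: case_prod_unfold)
      then show ?thesis using green'[OF y(1) z(1)] y z by (simp add: inner_graph_pt)
    qed
    have "s = 0" if "K s = 0" for s using iso[of s s] that cdot_eq_0_iff[of s] by simp
    then have "inj K" using vec.linear_inj_iff_eq_0[OF lin] by blast
    then have "surj K" by (rule vec.linear_inj_imp_surj[OF lin])
    then show "unitary_op K" using lin iso by (simp add: unitary_op_def)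
  }
  {
    assume u: "unitary_op K"
    have "L2_adjoint a b (boundary_op K) = boundary_op K"
    proof
      show "L2_adjoint a b (boundary_op K) \<subseteq> boundary_op K"
      proof
        fix uv assume uv: "uv \<in> L2_adjoint a b (boundary_op K)"
        then have "uv \<in> L2_adjoint a b (L_min a b p Q)"
          using L_min_subset_boundary_op[OF lin] unfolding L2_adjoint_def by blast
        then obtain z where z: "z \<in> MD" "uv = graph_pt z" by (rule L_min_adjoint_subset)
        have "cdot (K s) (eta z) = cdot (K s) (K (xi z))" for s
        proof -
          obtain y where y: "y \<in> MD" "xi y = s" "eta y = K s" by (rule xi_eta_surj)
          have "graph_pt y \<in> boundary_op K" using y graph_pt_mem_boundary_op_iff[OF lin] by auto
          then have "L2_inner a b (snd (graph_pt y)) (fst (graph_pt z)) = L2_inner a b (fst (graph_pt y)) (snd (graph_pt z))"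
            using uv unfolding z L2_adjoint_def by (auto simp: case_prod_unfold)
          then have "cdot s (xi z) = cdot (K s) (eta z)" using green'[OF y(1) z(1)] y z by (simp add: inner_graph_pt)
          then show ?thesis using u by (simp add: unitary_op_def)
        qed
        moreover obtain s where "K s = eta z - K (xi z)" using u unfolding unitary_op_def by (metis surjD)
        ultimately have "cdot (K s) (K s) = 0" by (metis cdot_diff_right right_minus_eq)
        then have "K (xi z) = eta z" using \<open>K s = eta z - K (xi z)\<close> by (simp add: cdot_eq_0_iff)
        then show "uv \<in> boundary_op K" using z graph_pt_mem_boundary_op_iff[OF lin] by simp
      qed
      show "boundary_op K \<subseteq> L2_adjoint a b (boundary_op K)"
      proof
        fix uv assume "uv \<in> boundary_op K"
        then obtain z where z: "z \<in> MD" "uv = graph_pt z" "K (xi z) = eta z" by (auto simp: boundary_op_eq[OF lin])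
        have "L2_inner a b v (fst (graph_pt z)) = L2_inner a b u (snd (graph_pt z))" if uv': "(u, v) \<in> boundary_op K" for u v
        proof -
          obtain y where y: "y \<in> MD" "(u, v) = graph_pt y" "K (xi y) = eta y" using uv' by (auto simp: boundary_op_eq[OF lin])
          have "cdot (xi y) (xi z) = cdot (eta y) (eta z)"
            using u y(3)[symmetric] z(3)[symmetric] by (simp add: unitary_op_def)
          then show ?thesis using green'[OF y(1) z(1)] inner_graph_pt[OF y(1) z(1)] y(2)[symmetric] by simp
        qed
        moreover have "fst (graph_pt z) \<in> L2 a b" "snd (graph_pt z) \<in> L2 a b"
          using z by (auto simp: graph_pt_def intro: L2_class_in_L2 MD_L2 lop_L2)
        ultimately show "uv \<in> L2_adjoint a b (boundary_op K)" unfolding z(2) L2_adjoint_def by (auto simp: case_prod_unfold)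
      qed
    qed
    then show "self_adjoint a b (boundary_op K)"
      using linear_operator_boundary_op[OF lin] densely_defined_extension[OF L_min_subset_boundary_op[OF lin]]
      by (simp add: self_adjoint_def)
  }
qed

lemma boundary_op_inj:
  assumes K: "clinear_op K" and K': "clinear_op K'" and eq: "boundary_op K = boundary_op K'"
  shows "K = K'"
proof
  fix s
  obtain y where y: "y \<in> MD" "xi y = s" "eta y = K s" by (rule xi_eta_surj)
  then have "graph_pt y \<in> boundary_op K" using graph_pt_mem_boundary_op_iff[OF K] by simp
  then show "K s = K' s" using eq graph_pt_mem_boundary_op_iff[OF K' y(1)] y by simp
qed

text \<open>A dissipative extension of a self-adjoint operator is contained in its adjoint.\<close>

lemma self_adjoint_smaximal:
  assumes min: "L_min a b p Q \<subseteq> T" and sa: "self_adjoint a b T"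
  shows "smaximal T"
proof -
  have im: "Im (L2_inner a b v u) = 0" if "(u, v) \<in> T" for u v
  proof -
    have "(u, v) \<in> L2_adjoint a b T" using sa that by (simp add: self_adjoint_def)
    then have eq: "L2_inner a b v u = L2_inner a b u v" using that by (auto simp: L2_adjoint_def)
    have uv: "u \<in> L2 a b" "v \<in> L2 a b" using \<open>(u, v) \<in> L2_adjoint a b T\<close> by (auto simp: L2_adjoint_def)
    obtain f g where "f \<in> L2_fun a b" "u = cl f" "g \<in> L2_fun a b" "v = cl g"
      using L2_cases[OF uv(1)] L2_cases[OF uv(2)] by metis
    then have "ip a b g f = cnj (ip a b g f)" using eq ip_commute[of a b f g] by (simp add: L2_inner_class)
    then have "Im (ip a b g f) = 0" by (simp add: complex_eq_iff)
    then show ?thesis using \<open>f \<in> _\<close> \<open>g \<in> _\<close> \<open>u = _\<close> \<open>v = _\<close> by (simp add: L2_inner_class)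
  qed
  have "sdissipative \<sigma> a b T" using sa im by (auto simp: sdissipative_def self_adjoint_def)
  moreover have "T' = T" if "sdissipative \<sigma> a b T'" "T \<subseteq> T'" for T'
  proof -
    have "T' \<subseteq> L2_adjoint a b T"
      by (rule sdissipative_extension_subset_adjoint[OF that sigma_nonzero im])
    then show ?thesis using sa that by (auto simp: self_adjoint_def)
  qed
  ultimately show ?thesis by (simp add: smaximal_def)
qed

theorem boundary_op_bij_contracting:
  "bij_betw boundary_op {K. contracting K} {T. L_min a b p Q \<subseteq> T \<and> smaximal T}"
  unfolding bij_betw_def
proof
  show "inj_on boundary_op {K. contracting K}" by (rule inj_onI) (auto intro: boundary_op_inj simp: contracting_def)
  have "boundary_op K \<in> {T. L_min a b p Q \<subseteq> T \<and> smaximal T}" if "contracting K" for K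
    using that smaximal_boundary_op[OF that] L_min_subset_boundary_op[of K] by (simp add: contracting_def)
  moreover have "T \<in> boundary_op ` {K. contracting K}" if T: "L_min a b p Q \<subseteq> T" "smaximal T" for T
    using smaximal_extension_is_boundary_op[OF T] by blast
  ultimately show "boundary_op ` {K. contracting K} = {T. L_min a b p Q \<subseteq> T \<and> smaximal T}" by blast
qed

theorem boundary_op_bij_unitary:
  "bij_betw boundary_op {K. unitary_op K} {T. L_min a b p Q \<subseteq> T \<and> self_adjoint a b T}"
  unfolding bij_betw_def
proof
  show "inj_on boundary_op {K. unitary_op K}" by (rule inj_onI) (auto intro: boundary_op_inj simp: unitary_op_def)
  have "boundary_op K \<in> {T. L_min a b p Q \<subseteq> T \<and> self_adjoint a b T}" if "unitary_op K" for K
    using that L_min_subset_boundary_op self_adjoint_boundary_op_iff by (auto simp: unitary_op_def)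
  moreover have "T \<in> boundary_op ` {K. unitary_op K}" if T: "L_min a b p Q \<subseteq> T" "self_adjoint a b T" for T
  proof -
    obtain K where "contracting K" "T = boundary_op K"
      using smaximal_extension_is_boundary_op[OF T(1) self_adjoint_smaximal[OF T]] by blast
    then have "unitary_op K" using T(2) self_adjoint_boundary_op_iff by (auto simp: contracting_def)
    then show ?thesis using \<open>T = boundary_op K\<close> by blast
  qed
  ultimately show "boundary_op ` {K. unitary_op K} = {T. L_min a b p Q \<subseteq> T \<and> self_adjoint a b T}" by blast
qed

end

theorem theorem4:
  fixes a b :: real
    and p Q :: "real \<Rightarrow> complex ^ 's ^ ('s::finite)"
  assumes "a < b"
    and "p \<in> borel_measurable (lebesgue_on {a<..<b})"
    and "Q \<in> borel_measurable (lebesgue_on {a<..<b})"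
    and "\<forall>x\<in>{a<..<b}. hermitian (p x)"
    and "\<forall>x\<in>{a<..<b}. hermitian (Q x)"
    and "AE x in lebesgue_on {a<..<b}. invertible (p x)"
    and "integrable (lebesgue_on {a<..<b}) (\<lambda>x. matrix_inv (p x))"
    and "integrable (lebesgue_on {a<..<b}) (\<lambda>x. matrix_inv (p x) ** Q x)"
    and "integrable (lebesgue_on {a<..<b}) (\<lambda>x. Q x ** matrix_inv (p x))"
    and "integrable (lebesgue_on {a<..<b}) (\<lambda>x. Q x ** matrix_inv (p x) ** Q x)"
  shows
    "(\<forall>K. contracting K \<longrightarrow>
        L_min a b p Q \<subseteq> L_lower a b p Q K \<and> maximal_dissipative a b (L_lower a b p Q K) \<and>
        L_min a b p Q \<subseteq> L_upper a b p Q K \<and> maximal_accumulative a b (L_upper a b p Q K))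
     \<and>
     (\<forall>T. L_min a b p Q \<subseteq> T \<and> maximal_dissipative a b T \<longrightarrow>
        (\<exists>K. contracting K \<and> T = L_lower a b p Q K)) \<and>
     (\<forall>T. L_min a b p Q \<subseteq> T \<and> maximal_accumulative a b T \<longrightarrow>
        (\<exists>K. contracting K \<and> T = L_upper a b p Q K))
     \<and>
     (\<forall>K. clinear_op K \<longrightarrow>
        (self_adjoint a b (L_lower a b p Q K) \<longleftrightarrow> unitary_op K) \<and>
        (self_adjoint a b (L_upper a b p Q K) \<longleftrightarrow> unitary_op K))
     \<and>
     bij_betw (L_lower a b p Q) {K. contracting K}
       {T. L_min a b p Q \<subseteq> T \<and> maximal_dissipative a b T} \<and>
     bij_betw (L_upper a b p Q) {K. contracting K}
       {T. L_min a b p Q \<subseteq> T \<and> maximal_accumulative a b T} \<and>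
     bij_betw (L_lower a b p Q) {K. unitary_op K}
       {T. L_min a b p Q \<subseteq> T \<and> self_adjoint a b T} \<and>
     bij_betw (L_upper a b p Q) {K. unitary_op K}
       {T. L_min a b p Q \<subseteq> T \<and> self_adjoint a b T}"
proof -
  interpret lo: signed_coefficients a b p Q 1
    by unfold_locales (use assms in auto)
  interpret up: signed_coefficients a b p Q "-1"
    by unfold_locales simp
  have lo_eq: "L_lower a b p Q = lo.boundary_op"
    by (rule ext) (simp add: L_lower_def lo.boundary_op_def)
  have "X + (complex_of_real (-1) * \<i>) *s Y = X - \<i> *s Y" for X Y :: "complex ^ ('s + 's)"
    by (simp add: vec.scale_minus_left)
  then have up_eq: "L_upper a b p Q = up.boundary_op"
    by (intro ext) (simp only: L_upper_def up.boundary_op_def)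
  have lo_max: "maximal_dissipative a b T \<longleftrightarrow> lo.smaximal T" for T
    by (simp add: maximal_dissipative_def lo.smaximal_def sdissipative_1)
  have up_max: "maximal_accumulative a b T \<longleftrightarrow> up.smaximal T" for T
    by (simp add: maximal_accumulative_def up.smaximal_def sdissipative_m1)
  have lin: "clinear_op K" if "contracting K" for K :: "complex ^ ('s + 's) \<Rightarrow> complex ^ ('s + 's)"
    using that by (simp add: contracting_def)
  show ?thesis
    unfolding lo_eq up_eq lo_max up_max
  proof (intro conjI allI impI; (elim conjE)?)
    fix K :: "complex ^ ('s + 's) \<Rightarrow> complex ^ ('s + 's)" assume K: "contracting K"
    show "L_min a b p Q \<subseteq> lo.boundary_op K" "L_min a b p Q \<subseteq> up.boundary_op K"
      by (rule lo.L_min_subset_boundary_op[OF lin[OF K]] up.L_min_subset_boundary_op[OF lin[OF K]])+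
    show "lo.smaximal (lo.boundary_op K)" "up.smaximal (up.boundary_op K)"
      by (rule lo.smaximal_boundary_op[OF K] up.smaximal_boundary_op[OF K])+
  next
    fix T assume T: "L_min a b p Q \<subseteq> T" "lo.smaximal T"
    show "\<exists>K. contracting K \<and> T = lo.boundary_op K"
      by (rule lo.smaximal_extension_is_boundary_op[OF T]) blast
  next
    fix T assume T: "L_min a b p Q \<subseteq> T" "up.smaximal T"
    show "\<exists>K. contracting K \<and> T = up.boundary_op K"
      by (rule up.smaximal_extension_is_boundary_op[OF T]) blast
  next
    fix K :: "complex ^ ('s + 's) \<Rightarrow> complex ^ ('s + 's)" assume K: "clinear_op K"
    show "self_adjoint a b (lo.boundary_op K) \<longleftrightarrow> unitary_op K"
      "self_adjoint a b (up.boundary_op K) \<longleftrightarrow> unitary_op K"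
      by (rule lo.self_adjoint_boundary_op_iff[OF K] up.self_adjoint_boundary_op_iff[OF K])+
  qed (rule lo.boundary_op_bij_contracting up.boundary_op_bij_contracting
      lo.boundary_op_bij_unitary up.boundary_op_bij_unitary)+
qed

end
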